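(* Let $\Gamma$ be a commutative quasi-thin weakly distance-regular digraph of valency more than $3$, let $q\geq3$ and $(1,q-1)\in\tilde\partial(\Gamma)$. (i) If $p^{(1,q-1)}_{(1,s-1),(1,t-1)}\neq0$ for some $(1,s-1),(1,t-1)\in\tilde\partial(\Gamma)$ with $s<t$, then $s=2$ and $t=q$. (ii) The following are equivalent: (a) $(1,q-1)$ is mixed; (b) $p^{(1,q-2)}_{(1,q-1),(1,q-1)}\neq0$ and $(1,q-2)$ is pure; (c) $p^{(1,s-1)}_{(1,q-1),(1,q-1)}\neq0$ for some $s$ with $(1,s-1)\in\tilde\partial(\Gamma)$. (iii) If $p^{(1,s-1)}_{(1,q-1),(1,q-1)}\neq0$, then $s=q-1$.
   Context: All digraphs are finite and simple. $\partial(x,y)$ is the length of a shortest directed path from $x$ to $y$, $\tilde\partial(x,y)=(\partial(x,y),\partial(y,x))$, $\tilde\partial(\Gamma)=\{\tilde\partial(x,y)\}$. A strongly connected digraph is weakly distance-regular if for all $\tilde h,\tilde i,\tilde j\in\tilde\partial(\Gamma)$ the number $p^{\tilde h}_{\tilde i,\tilde j}=|\{z\mid\tilde\partial(x,z)=\tilde i,\tilde\partial(z,y)=\tilde j\}|$ depends only on $\tilde h=\tilde\partial(x,y)$; $k_{\tilde i}=|\{y\mid\tilde\partial(x,y)=\tilde i\}|$; valency $=\sum_{(1,j)\in\tilde\partial(\Gamma)}k_{(1,j)}$. Commutative: $p^{\tilde h}_{\tilde i,\tilde j}=p^{\tilde h}_{\tilde j,\tilde i}$; quasi-thin: maximum intersection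 number is $2$. An arc $(u,v)$ is of type $(1,r)$ if $\partial(v,u)=r$. A path $(w_0,\dots,w_{r-1})$ is a circuit of length $r$ if $\partial(w_{r-1},w_0)=1$. An arc of type $(1,q-1)$ is pure if every circuit of length $q$ containing it consists of arcs of type $(1,q-1)$, mixed otherwise; $(1,q-1)$ is pure if all its arcs are pure, mixed otherwise. Statements like "$p^{\tilde h}_{\tilde i,\tilde j}\neq0$" or "$(1,r)$ is pure" presuppose that the indices lie in $\tilde\partial(\Gamma)$. *)

theory Defs
  imports "Graph_Theory.Graph_Theory"
begin

section \<open>Two-way distance\<close>

text \<open>As is usual for weakly distance-regular digraphs, a path is a sequence of vertices in which
  consecutive ones are joined by an arc, with repetitions allowed (a \<^const>\<open>vwalk\<close>). The value
  of \<open>distance\<close> is meaningful only if \<open>y\<close> is reachable from \<open>x\<close>; all digraphs considered below are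
  strongly connected.\<close>

definition distance :: "('a, 'b) pre_digraph \<Rightarrow> 'a \<Rightarrow> 'a \<Rightarrow> nat" where
  "distance G x y = (LEAST n. \<exists>p. vwalk p G \<and> hd p = x \<and> last p = y \<and> vwalk_length p = n)"

definition two_way_distance :: "('a, 'b) pre_digraph \<Rightarrow> 'a \<Rightarrow> 'a \<Rightarrow> nat \<times> nat" where
  "two_way_distance G x y = (distance G x y, distance G y x)"

definition two_way_distances :: "('a, 'b) pre_digraph \<Rightarrow> (nat \<times> nat) set" where
  "two_way_distances G = {two_way_distance G x y | x y. x \<in> verts G \<and> y \<in> verts G}"

lemma (in wf_digraph) distance_eq_mu:
  assumes "x \<rightarrow>\<^sup>* y"
  shows "\<mu> (\<lambda>_. 1) x y = ereal (real (distance G x y))"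
proof -
  let ?P = "\<lambda>n. \<exists>p. vwalk p G \<and> hd p = x \<and> last p = y \<and> vwalk_length p = n"
  have conv: "?P n \<longleftrightarrow> (\<exists>p. awalk x p y \<and> length p = n)" for n
  proof
    assume "?P n"
    then obtain p where p: "vwalk p G" "hd p = x" "last p = y" "vwalk_length p = n" by blast
    from p(1) have "\<exists>q. awalk (hd p) q (last p) \<and> length q = vwalk_length p"
    proof (induct rule: vwalk_induct)
      case (Base u)
      then show ?case by (auto simp: awalk_Nil_iff)
    next
      case (Cons u v es)
      from Cons(2) obtain q where q: "awalk v q (last (v # es))" "length q = length es" by auto
      from Cons(1) obtain e where "e \<in> arcs G" "tail G e = u" "head G e = v" by (rule reachableE)
      with q have "awalk u (e # q) (last (v # es))" "length (e # q) = Suc (length es)"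
        by (auto simp: awalk_Cons_iff)
      then show ?case by (intro exI[of _ "e # q"]) simp
    qed
    with p show "\<exists>p. awalk x p y \<and> length p = n" by metis
  next
    assume "\<exists>p. awalk x p y \<and> length p = n"
    then obtain p where p: "awalk x p y" "length p = n" by blast
    then have "vwalk (awalk_verts x p) G" "hd (awalk_verts x p) = x" "last (awalk_verts x p) = y"
      by (auto simp: awalk_imp_vwalk)
    with p show "?P n"
      by (metis diff_Suc_1 length_awalk_verts vwalk_length_simp)
  qed
  have dist: "distance G x y = (LEAST n. \<exists>p. awalk x p y \<and> length p = n)"
    unfolding distance_def conv ..
  have cost: "awalk_cost (\<lambda>_. 1) p = real (length p)" for p :: "'b list"
    by (induct p) auto
  from assms obtain p where "awalk x p y" by (auto simp: reachable_awalk)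
  then have "\<exists>n p. awalk x p y \<and> length p = n" by blast
  then have ex: "\<exists>p. awalk x p y \<and> length p = distance G x y"
    unfolding dist by (rule LeastI_ex)
  have min: "distance G x y \<le> length p" if "awalk x p y" for p
    unfolding dist using that by (blast intro: Least_le)
  show ?thesis
    unfolding \<mu>_def cost
    by (rule antisym) (use ex min in \<open>auto intro!: INF_lower2 INF_greatest\<close>)
qed


section \<open>Weakly distance-regular digraphs\<close>

definition intersection_set ::
    "('a, 'b) pre_digraph \<Rightarrow> nat \<times> nat \<Rightarrow> nat \<times> nat \<Rightarrow> 'a \<Rightarrow> 'a \<Rightarrow> 'a set" where
  "intersection_set G i j x y =
    {z \<in> verts G. two_way_distance G x z = i \<and> two_way_distance G z y = j}"

locale weakly_distance_regular_digraph = digraph +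
  assumes strongly_connected: "strongly_connected G"
    and weakly_distance_regular:
      "\<lbrakk>h \<in> two_way_distances G; i \<in> two_way_distances G; j \<in> two_way_distances G;
        x \<in> verts G; y \<in> verts G; two_way_distance G x y = h;
        x' \<in> verts G; y' \<in> verts G; two_way_distance G x' y' = h\<rbrakk>
       \<Longrightarrow> card (intersection_set G i j x y) = card (intersection_set G i j x' y')"

text \<open>The numbers below are determined for a weakly distance-regular digraph and
  \<open>h\<close> in \<^const>\<open>two_way_distances\<close>; see \<open>intersection_number_eq\<close> and \<open>subvalency_eq\<close>.
  For other \<open>h\<close> the intersection number is unspecified.\<close>

definition intersection_number ::
    "('a, 'b) pre_digraph \<Rightarrow> nat \<times> nat \<Rightarrow> nat \<times> nat \<Rightarrow> nat \<times> nat \<Rightarrow> nat" where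
  "intersection_number G h i j =
    (THE c. \<forall>x \<in> verts G. \<forall>y \<in> verts G.
      two_way_distance G x y = h \<longrightarrow> card (intersection_set G i j x y) = c)"

definition subvalency :: "('a, 'b) pre_digraph \<Rightarrow> nat \<times> nat \<Rightarrow> nat" where
  "subvalency G i =
    (THE c. \<forall>x \<in> verts G. card {y \<in> verts G. two_way_distance G x y = i} = c)"

definition valency :: "('a, 'b) pre_digraph \<Rightarrow> nat" where
  "valency G = (\<Sum>j \<in> {j. (1, j) \<in> two_way_distances G}. subvalency G (1, j))"

definition commutative_wdrd :: "('a, 'b) pre_digraph \<Rightarrow> bool" where
  "commutative_wdrd G \<longleftrightarrow>
    (\<forall>h \<in> two_way_distances G. \<forall>i \<in> two_way_distances G. \<forall>j \<in> two_way_distances G.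
      intersection_number G h i j = intersection_number G h j i)"

definition quasi_thin :: "('a, 'b) pre_digraph \<Rightarrow> bool" where
  "quasi_thin G \<longleftrightarrow>
    Max {intersection_number G h i j | h i j.
      h \<in> two_way_distances G \<and> i \<in> two_way_distances G \<and> j \<in> two_way_distances G} = 2"

context weakly_distance_regular_digraph
begin

lemma intersection_number_eq:
  assumes "i \<in> two_way_distances G" "j \<in> two_way_distances G" "x \<in> verts G" "y \<in> verts G"
  shows "intersection_number G (two_way_distance G x y) i j = card (intersection_set G i j x y)"
proof -
  have "two_way_distance G x y \<in> two_way_distances G"
    using assms by (auto simp: two_way_distances_def)
  then show ?thesis
    unfolding intersection_number_def using assms
    by (intro the_equality) (blast intro: weakly_distance_regular)+
qed

lemma subvalency_eq:
  assumes "x \<in> verts G"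
  shows "subvalency G i = card {y \<in> verts G. two_way_distance G x y = i}"
proof -
  have refl: "two_way_distance G z z = (0, 0)" if "z \<in> verts G" for z
  proof -
    have "vwalk [z] G \<and> hd [z] = z \<and> last [z] = z \<and> vwalk_length [z] = 0"
      using that by (auto simp: vwalk_def)
    then have "distance G z z = 0"
      unfolding distance_def by (intro Least_eq_0) blast
    then show ?thesis by (simp add: two_way_distance_def)
  qed
  have eq: "intersection_set G i (prod.swap i) z z = {y \<in> verts G. two_way_distance G z y = i}" for z
    by (auto simp: intersection_set_def two_way_distance_def)
  have indep: "card {y \<in> verts G. two_way_distance G z y = i}
      = card {y \<in> verts G. two_way_distance G x y = i}" if z: "z \<in> verts G" for z
  proof (cases "i \<in> two_way_distances G")
    case True
    then have "prod.swap i \<in> two_way_distances G"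
      unfolding two_way_distances_def two_way_distance_def by force
    moreover have "(0, 0) \<in> two_way_distances G"
      using refl[OF z] z by (force simp: two_way_distances_def)
    ultimately show ?thesis
      unfolding eq[symmetric] using True z assms refl by (blast intro: weakly_distance_regular)
  next
    case False
    then have "{y \<in> verts G. two_way_distance G w y = i} = {}" if "w \<in> verts G" for w
      using that by (auto simp: two_way_distances_def)
    from this[OF z] this[OF assms] show ?thesis by (simp only:)
  qed
  show ?thesis
    unfolding subvalency_def
  proof (rule the_equality)
    show "\<forall>z \<in> verts G. card {y \<in> verts G. two_way_distance G z y = i}
        = card {y \<in> verts G. two_way_distance G x y = i}"
      using indep by blast
  next
    fix c assume "\<forall>z \<in> verts G. card {y \<in> verts G. two_way_distance G z y = i} = c"
    then show "c = card {y \<in> verts G. two_way_distance G x y = i}" using assms by simp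
  qed
qed

end


section \<open>Pure and mixed arcs\<close>

definition arc_of_type :: "('a, 'b) pre_digraph \<Rightarrow> nat \<times> nat \<Rightarrow> 'a \<times> 'a \<Rightarrow> bool" where
  "arc_of_type G i e \<longleftrightarrow> e \<in> arcs_ends G \<and> i = (1, distance G (snd e) (fst e))"

text \<open>A circuit is given by its vertices, each listed once per visit; so its length is the length
  of the list, and the arc from the last vertex to the first one belongs to the circuit.\<close>

definition circuit :: "('a, 'b) pre_digraph \<Rightarrow> 'a list \<Rightarrow> bool" where
  "circuit G w \<longleftrightarrow> vwalk w G \<and> distance G (last w) (hd w) = 1"

definition circuit_arcs :: "'a list \<Rightarrow> ('a \<times> 'a) set" where
  "circuit_arcs w = set (vwalk_arcs (w @ [hd w]))"

definition pure_arc :: "('a, 'b) pre_digraph \<Rightarrow> nat \<Rightarrow> 'a \<times> 'a \<Rightarrow> bool" where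
  "pure_arc G q e \<longleftrightarrow> arc_of_type G (1, q - 1) e \<and>
    (\<forall>w. circuit G w \<and> length w = q \<and> e \<in> circuit_arcs w \<longrightarrow>
      (\<forall>a \<in> circuit_arcs w. arc_of_type G (1, q - 1) a))"

text \<open>\<open>pure_type G q\<close> and \<open>mixed_type G q\<close> say that the type \<open>(1, q - 1)\<close> is pure and mixed,
  respectively; both include that this type occurs in \<open>G\<close>.\<close>

definition pure_type :: "('a, 'b) pre_digraph \<Rightarrow> nat \<Rightarrow> bool" where
  "pure_type G q \<longleftrightarrow> (1, q - 1) \<in> two_way_distances G \<and>
    (\<forall>e. arc_of_type G (1, q - 1) e \<longrightarrow> pure_arc G q e)"

definition mixed_type :: "('a, 'b) pre_digraph \<Rightarrow> nat \<Rightarrow> bool" where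
  "mixed_type G q \<longleftrightarrow> (1, q - 1) \<in> two_way_distances G \<and> \<not> pure_type G q"

end

theory Submission
  imports Defs "HOL-Library.Multiset"
begin

text \<open>The relations \<open>{(x, y). two_way_distance G x y = i}\<close> multiply like the classes of a commutative
  association scheme in which every relation has valency at most two. A relation \<open>a\<close> of valency two has
  \<open>a \<odot> cv a = {\<epsilon>, h a}\<close>, and if \<open>h a\<close> has valency two, then \<open>a \<odot> a\<close> contains a relation \<open>\<theta> a\<close> of
  valency one; this is propagated to the powers of \<open>a\<close>.

  Let \<open>q\<close> be an arc class of type \<open>(1, r - 1)\<close>. The multiset of arc classes on a shortest circuit through
  \<open>q\<close> is a word of \<open>q\<close>. Since a relation is determined by its two distances, a constituent of \<open>q \<odot> x\<close> for
  two letters of a word is either an arc of type \<open>(1, r - 2)\<close> or the unique relation at distances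
  \<open>(2, r - 2)\<close>, so letters can be exchanged between words. Induction on \<open>r\<close> shows that \<open>q\<close> occurs at least
  twice in each of its words, and that either \<open>q\<close> is pure or its only word consists of two letters \<open>q\<close> and
  \<open>r - 2\<close> letters \<open>b\<close> for a pure arc class \<open>b\<close> of type \<open>(1, r - 2)\<close> in \<open>q \<odot> q\<close>. Products of different
  arc classes are excluded by comparing the orders of the elements \<open>\<theta> a\<close>.\<close>

section \<open>Quasi-thin schemes with a length function\<close>

text \<open>Products are kept as sets of relations, so multiplicities never enter; the bound two on
  intersection numbers survives as \<open>prd_card\<close>, \<open>prd_single\<close> and
  \<open>square_thin\<close>. The typical contradiction is a third constituent of a product, or two
  different relations with the same two distances. The obstacle is the way back: a short walk from
  one vertex to another says nothing about the return. A \<open>t\<close> of valency one in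
  \<open>a \<odot> a\<close> removes it, because then \<open>cv a = cv t \<bullet> a\<close>, so a
  relation and its converse differ by a group element. This passes to all powers of
  \<open>a\<close>, since an involution on at most two elements with one fixed point is trivial.
  Circuits bound the order of \<open>t\<close> from above, minimality of distances bounds it from
  below, and many cases end by comparing the two bounds. The induction has to carry the full shape
  of the words and not only the alternative of pure and mixed: an arc found in
  \<open>q \<odot> x\<close> inherits its words from those of \<open>q\<close>, and only their shape
  makes it possible to go on.\<close>

locale quasi_thin_scheme =
  fixes R :: "'r set"
    and prd :: "'r \<Rightarrow> 'r \<Rightarrow> 'r set" (infixl "\<odot>" 70)
    and \<epsilon> :: 'r
    and cv :: "'r \<Rightarrow> 'r"
    and len :: "'r \<Rightarrow> nat"
  assumes prd_commute: "a \<odot> b = b \<odot> a"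
    and prd_assoc: "\<lbrakk>c \<in> a \<odot> x; x \<in> b \<odot> d\<rbrakk> \<Longrightarrow> \<exists>y \<in> a \<odot> b. c \<in> y \<odot> d"
    and prd_carrier: "c \<in> a \<odot> b \<Longrightarrow> a \<in> R \<and> b \<in> R \<and> c \<in> R"
    and prd_nonempty: "\<lbrakk>a \<in> R; b \<in> R\<rbrakk> \<Longrightarrow> a \<odot> b \<noteq> {}"
    and unit_carrier: "\<epsilon> \<in> R"
    and unit_prd: "a \<in> R \<Longrightarrow> \<epsilon> \<odot> a = {a}"
    and prd_rotate: "c \<in> a \<odot> b \<Longrightarrow> a \<in> c \<odot> cv b"
    and prd_converse: "c \<in> a \<odot> b \<Longrightarrow> cv c \<in> cv a \<odot> cv b"
    and cv_cv [simp]: "cv (cv a) = a"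
    and cv_unit [simp]: "cv \<epsilon> = \<epsilon>"
    and prd_card: "\<lbrakk>c \<in> a \<odot> b; c' \<in> a \<odot> b; c'' \<in> a \<odot> b\<rbrakk> \<Longrightarrow> c = c' \<or> c = c'' \<or> c' = c''"
    and prd_single: "\<lbrakk>h \<noteq> \<epsilon>; h \<odot> cv h = {\<epsilon>}; h \<in> a \<odot> cv a; h \<in> b \<odot> cv b;
        c \<in> a \<odot> b; c \<odot> cv c \<noteq> {\<epsilon>}\<rbrakk> \<Longrightarrow> a \<odot> b = {c}"
    and square_thin: "\<lbrakk>h \<in> a \<odot> cv a; h \<odot> cv h \<noteq> {\<epsilon>}\<rbrakk> \<Longrightarrow> \<exists>t \<in> a \<odot> a. t \<odot> cv t = {\<epsilon>}"
    and len_unit [simp]: "len \<epsilon> = 0"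
    and len_Suc: "\<lbrakk>c \<in> R; len c = Suc n\<rbrakk> \<Longrightarrow> \<exists>a d. len a = 1 \<and> len d = n \<and> c \<in> a \<odot> d"
    and len_prd: "\<lbrakk>c \<in> a \<odot> d; len a = 1\<rbrakk> \<Longrightarrow> len c \<le> Suc (len d)"
    and len_unique: "\<lbrakk>a \<in> R; b \<in> R; len a = len b; len (cv a) = len (cv b)\<rbrakk> \<Longrightarrow> a = b"
    and len_0: "\<lbrakk>c \<in> R; len c = 0\<rbrakk> \<Longrightarrow> c = \<epsilon>"
begin

section \<open>Rotating and reversing triangles\<close>

lemma rotate: "c \<in> a \<odot> b \<longleftrightarrow> a \<in> c \<odot> cv b"
  using prd_rotate[of c a b] prd_rotate[of a c "cv b"] by auto

lemma rotate2: "c \<in> a \<odot> b \<longleftrightarrow> b \<in> c \<odot> cv a"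
  using rotate[of c b a] by (simp add: prd_commute)

lemma prd_swap: "\<lbrakk>c \<in> a \<odot> x; x \<in> b \<odot> d\<rbrakk> \<Longrightarrow> \<exists>y. y \<in> a \<odot> d \<and> c \<in> b \<odot> y"
  using prd_assoc[of c a x d b] prd_commute by metis

lemma converse: "cv c \<in> cv a \<odot> cv b \<longleftrightarrow> c \<in> a \<odot> b"
  using prd_converse[of c a b] prd_converse[of "cv c" "cv a" "cv b"] by auto

lemma converse2: "cv c \<in> a \<odot> b \<longleftrightarrow> c \<in> cv a \<odot> cv b"
  using converse[of c "cv a" "cv b"] by simp

lemma cv_R [simp]: "cv a \<in> R \<longleftrightarrow> a \<in> R"
proof -
  have "cv a \<in> R" if "a \<in> R" for a
    using that unit_prd[OF that] prd_converse[of a "\<epsilon>" a] prd_carrier by auto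
  from this[of a] this[of "cv a"] show ?thesis by auto
qed

lemma unit_prd_cv: "a \<in> R \<Longrightarrow> \<epsilon> \<in> a \<odot> cv a"
  using unit_prd[of a] rotate[of a "\<epsilon>" a] by auto

lemma unit_in_prd: "\<epsilon> \<in> a \<odot> b \<longleftrightarrow> a \<in> R \<and> b = cv a"
proof
  assume *: "\<epsilon> \<in> a \<odot> b"
  then have "b \<in> \<epsilon> \<odot> cv a" using rotate2 by auto
  with * show "a \<in> R \<and> b = cv a" using prd_carrier[OF *] unit_prd[of "cv a"] by auto
qed (use unit_prd_cv in auto)

text \<open>\<open>a \<odot> cv a\<close> is closed under \<open>cv\<close> and contains
  \<open>\<epsilon>\<close>; with at most two constituents, the other one must be its own converse.
  Many contradictions with the asymmetry of an arc rest on this.\<close>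

lemma sym_in_prd_cv:
  assumes "x \<in> a \<odot> cv a" shows "cv x = x"
proof -
  have "cv x \<in> a \<odot> cv a" using prd_converse[OF assms] by (simp add: prd_commute)
  moreover have "\<epsilon> \<in> a \<odot> cv a" using assms prd_carrier unit_prd_cv by blast
  ultimately have "x = cv x \<or> x = \<epsilon> \<or> cv x = \<epsilon>"
    using assms prd_card by metis
  then show ?thesis by (metis cv_cv cv_unit)
qed

text \<open>Complex products of multisets of relations; the multiset is unambiguous since the product is
  commutative and associative.\<close>

definition W :: "('r) multiset \<Rightarrow> ('r) set" where
  "W M = fold_mset (\<lambda>a X. \<Union>x \<in> X. a \<odot> x) {\<epsilon>} M"

lemma W_comm: "comp_fun_commute (\<lambda>a X. \<Union>x \<in> X. a \<odot> x)"
proof -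
  have *: "c \<in> (\<Union>x \<in> (\<Union>x \<in> X. b \<odot> x). a \<odot> x)" if "c \<in> (\<Union>x \<in> (\<Union>x \<in> X. a \<odot> x). b \<odot> x)" for a b c X
  proof -
    from that obtain x y where x: "x \<in> X" "y \<in> a \<odot> x" "c \<in> b \<odot> y" by auto
    then obtain z where "z \<in> b \<odot> x" "c \<in> a \<odot> z"
      by (meson prd_swap)
    with x show ?thesis by auto
  qed
  show ?thesis unfolding comp_fun_commute_def o_def fun_eq_iff
    by (intro allI set_eqI iffI; rule *)
qed

lemma W_empty [simp]: "W {#} = {\<epsilon>}" by (simp add: W_def)

lemma W_add: "W (add_mset a M) = (\<Union>x \<in> W M. a \<odot> x)"
  unfolding W_def using comp_fun_commute.fold_mset_add_mset[OF W_comm] by simp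

lemma W_R: "W M \<subseteq> R"
  by (induct M) (auto simp: W_add unit_carrier dest: prd_carrier)

lemma W_letters: "x \<in> W M \<Longrightarrow> a \<in># M \<Longrightarrow> a \<in> R"
proof (induct M arbitrary: x)
  case (add b M)
  then show ?case by (auto simp: W_add dest: prd_carrier)
qed simp

lemma W_1: "a \<in> R \<Longrightarrow> W {#a#} = {a}"
  using unit_prd[of a] by (simp add: W_add prd_commute)

lemma W_1D: "x \<in> W {#a#} \<Longrightarrow> x = a"
  using W_letters[of x "{#a#}" a] W_1[of a] by auto

lemma W_2: "W {#a, b#} = a \<odot> b"
proof (cases "b \<in> R")
  case True then show ?thesis by (simp add: W_add[of a] W_1)
next
  case False
  have "W {#a, b#} = {}" using False W_letters by fastforce
  moreover have "a \<odot> b = {}" using False prd_carrier by blast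
  ultimately show ?thesis by simp
qed

lemma W_union: "x \<in> W (M + N) \<longleftrightarrow> (\<exists>c \<in> W M. \<exists>d \<in> W N. x \<in> c \<odot> d)"
proof (induct M arbitrary: x)
  case empty
  have "\<epsilon> \<odot> d = {d}" if "d \<in> W N" for d using that W_R[of N] unit_prd by blast
  then show ?case by auto
next
  case (add a M)
  have "x \<in> W (add_mset a M + N) \<longleftrightarrow> (\<exists>y. x \<in> a \<odot> y \<and> (\<exists>c \<in> W M. \<exists>d \<in> W N. y \<in> c \<odot> d))"
    using add by (auto simp: W_add)
  also have "\<dots> \<longleftrightarrow> (\<exists>c \<in> W M. \<exists>d \<in> W N. \<exists>z \<in> a \<odot> c. x \<in> z \<odot> d)"
  proof -
    have "(\<exists>y. x \<in> a \<odot> y \<and> y \<in> c \<odot> d) \<longleftrightarrow> (\<exists>z \<in> a \<odot> c. x \<in> z \<odot> d)" for c d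
      using prd_assoc[of x a _ c d] prd_assoc[of x d _ c a] by (auto simp: prd_commute)
    then show ?thesis by blast
  qed
  finally show ?case by (auto simp: W_add)
qed

lemma W_unit_add: "\<epsilon> \<in> W (add_mset a M) \<longleftrightarrow> a \<in> R \<and> cv a \<in> W M"
  by (auto simp: W_add unit_in_prd)

text \<open>Cuts a closed walk at two of its vertices: \<open>c\<close> is the relation spanned by
  the part \<open>M\<close>, and \<open>N\<close> leads back.\<close>

lemma W_split2:
  assumes "\<epsilon> \<in> W (M + N)" shows "\<exists>c \<in> W M. cv c \<in> W N"
  using assms unit_in_prd by (auto simp: W_union)

lemma W_glue2:
  assumes "c \<in> W M" "cv c \<in> W N" shows "\<epsilon> \<in> W (M + N)"
proof -
  have "\<epsilon> \<in> c \<odot> cv c" using assms W_R unit_in_prd by auto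
  then show ?thesis using assms by (auto simp: W_union)
qed

subsection \<open>Relations of valency one\<close>

text \<open>Valency one in terms of the product alone, since the locale has no cardinalities; for
  digraphs this is \<open>cprod_swap_unit\<close>.\<close>

definition thin :: "'r \<Rightarrow> bool" where
  "thin t \<longleftrightarrow> t \<odot> cv t = {\<epsilon>}"

lemma thin_R: "thin t \<Longrightarrow> t \<in> R"
  unfolding thin_def using prd_carrier by blast

lemma thin_unit [simp]: "thin \<epsilon>"
  unfolding thin_def using unit_prd unit_carrier by simp

lemma thin_cv [simp]: "thin (cv t) \<longleftrightarrow> thin t"
  unfolding thin_def by (auto simp: prd_commute)

lemma thin_prd_single:
  assumes "thin t" "c \<in> t \<odot> a" "c' \<in> t \<odot> a" shows "c = c'"
proof -
  have "a \<in> c \<odot> cv t" using assms rotate2 by blast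
  then obtain y where y: "y \<in> t \<odot> cv t" "c' \<in> y \<odot> c"
    using prd_assoc[of c' t a "cv t" c] assms by (auto simp: prd_commute)
  then have "y = \<epsilon>" using assms(1) unfolding thin_def by auto
  then show ?thesis using y unit_prd[of c] prd_carrier[OF assms(2)] by auto
qed

text \<open>Meaningful for \<open>t\<close> of valency one, where the product is a singleton. The
  relations of valency one thereby form an abelian group that acts on \<open>R\<close>.\<close>

definition act :: "'r \<Rightarrow> 'r \<Rightarrow> 'r" (infixr "\<bullet>" 75) where
  "t \<bullet> a = (SOME c. c \<in> t \<odot> a)"

lemma act_prd: assumes "thin t" "a \<in> R" shows "t \<odot> a = {t \<bullet> a}"
proof -
  have "t \<bullet> a \<in> t \<odot> a" unfolding act_def
    by (rule someI_ex) (use prd_nonempty[OF thin_R[OF assms(1)] assms(2)] in blast)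
  then show ?thesis using thin_prd_single[OF assms(1)] by blast
qed

lemma act_R [simp]: "thin t \<Longrightarrow> a \<in> R \<Longrightarrow> t \<bullet> a \<in> R"
  using act_prd prd_carrier by blast

lemma act_eqI: "thin t \<Longrightarrow> c \<in> t \<odot> a \<Longrightarrow> c = t \<bullet> a"
  using act_prd prd_carrier by blast

lemma unit_act [simp]: "a \<in> R \<Longrightarrow> \<epsilon> \<bullet> a = a"
  using act_prd[of "\<epsilon>" a] unit_prd[of a] by auto

lemma act_unit [simp]: "thin t \<Longrightarrow> t \<bullet> \<epsilon> = t"
  using act_prd[of t "\<epsilon>"] unit_prd[of t] thin_R[of t] unit_carrier by (auto simp: prd_commute)

lemma act_in: "\<lbrakk>thin t; a \<in> R\<rbrakk> \<Longrightarrow> c \<in> t \<odot> a \<longleftrightarrow> c = t \<bullet> a"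
  using act_prd by auto

lemma act_prd_in:
  assumes "thin t" "a \<in> R" shows "c \<in> (t \<bullet> a) \<odot> b \<longleftrightarrow> (\<exists>d \<in> a \<odot> b. c = t \<bullet> d)"
proof
  assume c: "c \<in> (t \<bullet> a) \<odot> b"
  have "t \<bullet> a \<in> t \<odot> a" using act_prd assms by auto
  then obtain y where "y \<in> a \<odot> b" "c \<in> t \<odot> y"
    using c prd_assoc[of c b "t \<bullet> a" a t] prd_commute by metis
  then show "\<exists>d \<in> a \<odot> b. c = t \<bullet> d" using act_eqI[OF assms(1)] by blast
next
  assume "\<exists>d \<in> a \<odot> b. c = t \<bullet> d"
  then obtain d where d: "d \<in> a \<odot> b" "c = t \<bullet> d" by auto
  then have "c \<in> t \<odot> d" using act_prd[OF assms(1)] prd_carrier[OF d(1)] by blast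
  then obtain y where "y \<in> t \<odot> a" "c \<in> y \<odot> b" using d prd_assoc by blast
  then show "c \<in> (t \<bullet> a) \<odot> b" using act_eqI assms by auto
qed

lemma cv_act [simp]: "\<lbrakk>thin t; a \<in> R\<rbrakk> \<Longrightarrow> cv (t \<bullet> a) = cv t \<bullet> cv a"
  using act_prd[of t a] prd_converse[of "t \<bullet> a" t a] act_eqI[of "cv t"] by auto

lemma thin_act [simp]: assumes "thin t" "thin u" shows "thin (t \<bullet> u)"
proof -
  have "x \<in> (t \<bullet> u) \<odot> (cv t \<bullet> cv u) \<Longrightarrow> x = \<epsilon>" for x
  proof -
    assume "x \<in> (t \<bullet> u) \<odot> (cv t \<bullet> cv u)"
    then obtain d where d: "d \<in> u \<odot> (cv t \<bullet> cv u)" "x = t \<bullet> d"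
      using act_prd_in[of t u] assms thin_R by blast
    then obtain d' where "d' \<in> cv u \<odot> u" "d = cv t \<bullet> d'"
      using act_prd_in[of "cv t" "cv u" d u] assms thin_R by (auto simp: prd_commute)
    then have "d = cv t" using assms unfolding thin_def using act_unit[of "cv t"] assms by (auto simp: prd_commute)
    then show "x = \<epsilon>" using d act_prd[of t "cv t"] assms thin_R[of t] unfolding thin_def by auto
  qed
  moreover have "\<epsilon> \<in> (t \<bullet> u) \<odot> (cv t \<bullet> cv u)"
    using unit_in_prd assms thin_R by auto
  ultimately have "(t \<bullet> u) \<odot> (cv t \<bullet> cv u) = {\<epsilon>}" by blast
  then show ?thesis unfolding thin_def using assms thin_R by simp
qed

lemma thin_square_thin: "\<lbrakk>thin a; b \<in> a \<odot> a\<rbrakk> \<Longrightarrow> thin b"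
  using act_eqI[of a b a] thin_act[of a a] by simp

lemma act_act: assumes "thin t" "thin u" "a \<in> R" shows "t \<bullet> u \<bullet> a = (t \<bullet> u) \<bullet> a"
proof -
  have "t \<bullet> u \<bullet> a \<in> (t \<bullet> u) \<odot> a"
    using act_prd_in[of t u "t \<bullet> u \<bullet> a" a] assms thin_R act_prd[of u a] by auto
  then show ?thesis using act_eqI thin_act assms by blast
qed

lemma act_cv [simp]: "thin t \<Longrightarrow> t \<bullet> cv t = \<epsilon>" "thin t \<Longrightarrow> cv t \<bullet> t = \<epsilon>"
  using act_prd[of t "cv t"] act_prd[of "cv t" t] thin_R[of t] unfolding thin_def
  by (auto simp: prd_commute)

lemma act_commute: "\<lbrakk>thin t; thin u\<rbrakk> \<Longrightarrow> t \<bullet> u = u \<bullet> t"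
  using act_prd[of t u] act_prd[of u t] thin_R by (auto simp: prd_commute)

lemma act_left_commute: "\<lbrakk>thin t; thin u; a \<in> R\<rbrakk> \<Longrightarrow> t \<bullet> u \<bullet> a = u \<bullet> t \<bullet> a"
  by (simp add: act_act act_commute)

lemma act_cancel [simp]: "\<lbrakk>thin t; a \<in> R\<rbrakk> \<Longrightarrow> cv t \<bullet> t \<bullet> a = a" "\<lbrakk>thin t; a \<in> R\<rbrakk> \<Longrightarrow> t \<bullet> cv t \<bullet> a = a"
  by (simp_all add: act_act)

lemma act_inj [simp]: "\<lbrakk>thin t; a \<in> R; b \<in> R\<rbrakk> \<Longrightarrow> t \<bullet> a = t \<bullet> b \<longleftrightarrow> a = b"
  using act_cancel(1)[of t] by metis

lemma act_eq_iff: "\<lbrakk>thin t; a \<in> R; b \<in> R\<rbrakk> \<Longrightarrow> a = t \<bullet> b \<longleftrightarrow> cv t \<bullet> a = b"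
  using act_cancel[of t] by (metis thin_cv)

lemma act_prd_iff:
  assumes "thin t" "a \<in> R" shows "c \<in> (t \<bullet> a) \<odot> b \<longleftrightarrow> c \<in> R \<and> cv t \<bullet> c \<in> a \<odot> b"
  using act_prd_in[OF assms, of c b] act_cancel[of t] assms prd_carrier
  by (metis act_R)

lemma thin_in_prd: assumes "thin c" "c \<in> a \<odot> b" shows "a = c \<bullet> cv b"
  using assms rotate act_eqI by blast

lemma thin_iff_act [simp]: assumes "thin t" "a \<in> R" shows "thin (t \<bullet> a) \<longleftrightarrow> thin a"
  using thin_act[of "cv t" "t \<bullet> a"] thin_act[of t a] act_cancel(1)[OF assms] thin_cv[of t] assms(1) by metis

section \<open>Powers and orders in the group of relations of valency one\<close>

primrec tpow :: "'r \<Rightarrow> nat \<Rightarrow> 'r" where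
  "tpow t 0 = \<epsilon>"
| "tpow t (Suc n) = t \<bullet> tpow t n"

lemma thin_tpow [simp]: "thin t \<Longrightarrow> thin (tpow t n)"
  by (induct n) auto

lemma tpow_R [simp]: "thin t \<Longrightarrow> tpow t n \<in> R"
  using thin_R thin_tpow by blast

lemma tpow_add: "thin t \<Longrightarrow> tpow t (i + j) = tpow t i \<bullet> tpow t j"
  by (induct i) (auto simp: act_act)

lemma tpow_mult: "thin t \<Longrightarrow> tpow (tpow t i) j = tpow t (i * j)"
  by (induct j) (auto simp: tpow_add)

lemma tpow_unit [simp]: "tpow \<epsilon> n = \<epsilon>"
  by (induct n) auto

lemma tpow_act: "\<lbrakk>thin t; thin u\<rbrakk> \<Longrightarrow> tpow (t \<bullet> u) n = tpow t n \<bullet> tpow u n"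
proof (induct n)
  case (Suc n)
  have "tpow (t \<bullet> u) (Suc n) = t \<bullet> u \<bullet> tpow t n \<bullet> tpow u n"
    using Suc by (simp add: act_act)
  also have "\<dots> = t \<bullet> tpow t n \<bullet> u \<bullet> tpow u n"
    using Suc by (simp add: act_left_commute[of u])
  finally show ?case using Suc by (simp add: act_act thin_R)
qed simp

lemma tpow_eq_diff:
  assumes "thin t" "tpow t i = \<epsilon>" "i \<le> j" shows "tpow t (j - i) = tpow t j"
  using tpow_add[of t i "j - i"] assms by simp

lemma tpow_dvd: "\<lbrakk>thin t; tpow t i = \<epsilon>; i dvd j\<rbrakk> \<Longrightarrow> tpow t j = \<epsilon>"
  by (auto simp: tpow_mult[symmetric])

lemma tpow_mod: "\<lbrakk>thin t; tpow t i = \<epsilon>\<rbrakk> \<Longrightarrow> tpow t (j mod i) = tpow t j"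
  using tpow_add[of t "i * (j div i)" "j mod i"] tpow_dvd[of t i "i * (j div i)"] by simp

lemma tpow_gcd: "\<lbrakk>thin t; tpow t i = \<epsilon>; tpow t j = \<epsilon>\<rbrakk> \<Longrightarrow> tpow t (gcd i j) = \<epsilon>"
proof (induct i j rule: gcd_nat_induct)
  case (step m n)
  then show ?case using tpow_mod[of t n m] by (simp add: gcd_red_nat[of m n])
qed simp

lemma tpow_order_dvd:
  assumes "thin t" "tpow t n = \<epsilon>" "n \<ge> 1" "\<And>k. \<lbrakk>tpow t k = \<epsilon>; k \<ge> 1\<rbrakk> \<Longrightarrow> n \<le> k" "tpow t i = \<epsilon>"
  shows "n dvd i"
proof -
  have "gcd i n \<noteq> 0" using assms(3) by auto
  then have "n \<le> gcd i n" using assms tpow_gcd[of t i n] by (simp add: Suc_leI)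
  then have "gcd i n = n" using assms(3) by (intro antisym gcd_le2_nat) auto
  then show ?thesis by (metis gcd_dvd1)
qed

text \<open>The quotient of \<open>2 * k\<close> by \<open>n\<close> is positive and below two.
  Applied to orders, it turns divisibility into an exact value.\<close>

lemma dvd_double_eq: fixes n k :: nat assumes "n dvd 2 * k" "k < n" "k \<ge> 1" shows "2 * k = n"
proof -
  obtain j where j: "2 * k = n * j" using assms(1) by (auto elim: dvdE)
  have "j \<noteq> 0" using j assms by (intro notI) simp
  moreover have "j < 2"
  proof (rule ccontr)
    assume "\<not> j < 2"
    then have "n * 2 \<le> n * j" by simp
    then show False using j assms by linarith
  qed
  ultimately have "j = 1" by linarith
  then show ?thesis using j by simp
qed

lemma W_tpow: "thin t \<Longrightarrow> W (replicate_mset n t) = {tpow t n}"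
  by (induct n) (auto simp: W_add act_prd)

lemma sym_thin_square: "\<lbrakk>thin t; cv t = t\<rbrakk> \<Longrightarrow> t \<bullet> t = \<epsilon>"
  using act_cv(1)[of t] by simp

subsection \<open>Relations of valency two\<close>

text \<open>In a digraph, the relation between the two \<open>a\<close>-successors of a vertex. For
  valency two the choice is unique by \<open>prd_cv\<close>; for thin \<open>a\<close> the value is
  arbitrary.\<close>

definition h :: "'r \<Rightarrow> 'r" where "h a = (SOME x. x \<in> a \<odot> cv a \<and> x \<noteq> \<epsilon>)"

lemma h_in: assumes "a \<in> R" "\<not> thin a" shows "h a \<in> a \<odot> cv a" "h a \<noteq> \<epsilon>"
proof -
  have "\<exists>x. x \<in> a \<odot> cv a \<and> x \<noteq> \<epsilon>"
    using assms unit_prd_cv[of a] unfolding thin_def by blast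
  from someI_ex[OF this] show "h a \<in> a \<odot> cv a" "h a \<noteq> \<epsilon>" unfolding h_def by auto
qed

lemma prd_cv: assumes "a \<in> R" "\<not> thin a" shows "a \<odot> cv a = {\<epsilon>, h a}"
proof
  show "a \<odot> cv a \<subseteq> {\<epsilon>, h a}"
  proof
    fix x assume x: "x \<in> a \<odot> cv a"
    show "x \<in> {\<epsilon>, h a}"
      using prd_card[OF x unit_prd_cv[OF assms(1)] h_in(1)[OF assms]] h_in(2)[OF assms] by auto
  qed
qed (use h_in[OF assms] unit_prd_cv[OF assms(1)] in blast)

lemma h_R [simp]: "\<lbrakk>a \<in> R; \<not> thin a\<rbrakk> \<Longrightarrow> h a \<in> R"
  using h_in prd_carrier by blast

lemma cv_h [simp]: "\<lbrakk>a \<in> R; \<not> thin a\<rbrakk> \<Longrightarrow> cv (h a) = h a"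
  using h_in sym_in_prd_cv by blast

lemma h_eqI: "\<lbrakk>a \<in> R; x \<in> a \<odot> cv a; x \<noteq> \<epsilon>\<rbrakk> \<Longrightarrow> h a = x \<and> \<not> thin a"
  using prd_cv[of a] unfolding thin_def by fastforce

lemma h_cv [simp]: "\<lbrakk>a \<in> R; \<not> thin a\<rbrakk> \<Longrightarrow> h (cv a) = h a"
  using h_eqI[of "cv a" "h a"] h_in[of a] by (simp add: prd_commute)

lemma act_prd_cv: assumes "thin t" "a \<in> R" shows "(t \<bullet> a) \<odot> cv (t \<bullet> a) = a \<odot> cv a"
proof -
  have *: "x \<in> a \<odot> (cv t \<bullet> cv a) \<longleftrightarrow> x \<in> R \<and> t \<bullet> x \<in> a \<odot> cv a" for x
    using act_prd_iff[of "cv t" "cv a" x a] assms by (simp add: prd_commute)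
  have "x \<in> (t \<bullet> a) \<odot> (cv t \<bullet> cv a) \<longleftrightarrow> x \<in> R \<and> t \<bullet> cv t \<bullet> x \<in> a \<odot> cv a" for x
    unfolding act_prd_iff[OF assms] * using assms by auto
  then have "x \<in> (t \<bullet> a) \<odot> (cv t \<bullet> cv a) \<longleftrightarrow> x \<in> a \<odot> cv a" for x
    using assms prd_carrier by auto
  then show ?thesis using assms by auto
qed

lemma h_act [simp]: "\<lbrakk>thin t; a \<in> R; \<not> thin a\<rbrakk> \<Longrightarrow> h (t \<bullet> a) = h a"
  using act_prd_cv[of t a] unfolding h_def by simp

lemma h_prd: "\<lbrakk>a \<in> R; \<not> thin a\<rbrakk> \<Longrightarrow> a \<in> h a \<odot> a"
  using h_in[of a] rotate[of "h a" a "cv a"] by simp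

text \<open>For a relation \<open>a\<close> of valency two, \<open>a \<odot> cv a = {\<epsilon>, h a}\<close>. According to whether \<open>h a\<close> has
  valency one or two, \<open>a\<close> is called of the first or of the second kind.\<close>

definition kind1 :: "'r \<Rightarrow> bool" where "kind1 a \<longleftrightarrow> a \<in> R \<and> \<not> thin a \<and> thin (h a)"
definition kind2 :: "'r \<Rightarrow> bool" where "kind2 a \<longleftrightarrow> a \<in> R \<and> \<not> thin a \<and> \<not> thin (h a)"

lemma kinds: "a \<in> R \<Longrightarrow> thin a \<or> kind1 a \<or> kind2 a"
  by (auto simp: kind1_def kind2_def)

lemma kind1D: "kind1 a \<Longrightarrow> a \<in> R" "kind1 a \<Longrightarrow> \<not> thin a" "kind1 a \<Longrightarrow> thin (h a)"
  by (auto simp: kind1_def)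

lemma kind2D: "kind2 a \<Longrightarrow> a \<in> R" "kind2 a \<Longrightarrow> \<not> thin a" "kind2 a \<Longrightarrow> \<not> thin (h a)"
  by (auto simp: kind2_def)

lemma kind1_h_square [simp]: "kind1 a \<Longrightarrow> h a \<bullet> h a = \<epsilon>"
  using sym_thin_square[of "h a"] by (simp add: kind1_def)

lemma kind1_act [simp]: "kind1 a \<Longrightarrow> h a \<bullet> a = a"
  using h_prd[of a] act_eqI[of "h a" a a] by (auto simp: kind1_def)

text \<open>The action of \<open>h a\<close> can be moved onto the factor \<open>a\<close>, which it
  fixes.\<close>

lemma kind1_act_prd: assumes "kind1 a" "x \<in> a \<odot> y" shows "h a \<bullet> x \<in> a \<odot> y"
proof -
  have "\<exists>d \<in> a \<odot> y. h a \<bullet> x = h a \<bullet> d" using assms(2) by blast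
  then show ?thesis using act_prd_in[of "h a" a "h a \<bullet> x" y] assms kind1D by simp
qed

lemma act_fix_h:
  assumes "thin t" "a \<in> R" "\<not> thin a" "t \<bullet> a = a" "t \<noteq> \<epsilon>" shows "h a = t"
proof -
  have "a \<in> t \<odot> a" using act_prd[of t a] assms by simp
  then have "t \<in> a \<odot> cv a" using rotate by blast
  then show ?thesis using h_eqI assms by blast
qed

lemma kind1_prd:
  assumes "kind1 a" "kind1 b" "h a = h b" "c \<in> a \<odot> b" "\<not> thin c" shows "a \<odot> b = {c}"
  using prd_single[of "h a" a b c] assms h_in[of a] h_in[of b] unfolding kind1_def thin_def by auto

text \<open>The square consists of \<open>b\<close> alone by \<open>kind1_prd\<close> and is
  invariant under \<open>h a\<close>, so \<open>h a\<close> fixes \<open>b\<close>.\<close>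

lemma kind1_square_h: assumes "kind1 a" "b \<in> a \<odot> a" "\<not> thin b" shows "h b = h a"
proof -
  have "a \<odot> a = {b}" using kind1_prd[OF assms(1,1) refl assms(2,3)] .
  then have "h a \<bullet> b = b" using kind1_act_prd[OF assms(1,2)] by simp
  then show ?thesis using act_fix_h[of "h a" b] kind1D[OF assms(1)] assms prd_carrier[OF assms(2)] h_in[of a] by simp
qed

text \<open>Ties a relation to its converse by a group element; later this converts orders of such
  elements into lengths of the way back.\<close>

lemma thin_square_cv: "\<lbrakk>thin t; t \<in> a \<odot> a\<rbrakk> \<Longrightarrow> cv a = cv t \<bullet> a"
  using thin_in_prd[of t a a] act_eq_iff[of t a "cv a"] prd_carrier by fastforce

lemma thin_square_eq: assumes "thin t" "t \<in> a \<odot> a" shows "x \<in> a \<odot> a \<longleftrightarrow> x \<in> R \<and> cv t \<bullet> x \<in> a \<odot> cv a"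
proof -
  have "a \<in> R" using assms prd_carrier by blast
  have "x \<in> a \<odot> (t \<bullet> cv a) \<longleftrightarrow> x \<in> R \<and> cv t \<bullet> x \<in> a \<odot> cv a"
    using act_prd_iff[of t "cv a" x a] assms \<open>a \<in> R\<close> by (simp add: prd_commute)
  then show ?thesis using thin_in_prd[OF assms] by simp
qed

lemma thin_square_set:
  assumes "thin t" "t \<in> a \<odot> a" "\<not> thin a" shows "a \<odot> a = {t, t \<bullet> h a}"
proof -
  have a: "a \<in> R" using assms prd_carrier by blast
  have "x \<in> a \<odot> a \<longleftrightarrow> x \<in> R \<and> (cv t \<bullet> x = \<epsilon> \<or> cv t \<bullet> x = h a)" for x
    using thin_square_eq[OF assms(1,2)] prd_cv[OF a assms(3)] by simp
  moreover have "x \<in> R \<Longrightarrow> cv t \<bullet> x = \<epsilon> \<longleftrightarrow> x = t" "x \<in> R \<Longrightarrow> cv t \<bullet> x = h a \<longleftrightarrow> x = t \<bullet> h a" for x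
    using act_eq_iff[of t x \<epsilon>] act_eq_iff[of t x "h a"] assms a unit_carrier by auto
  ultimately show ?thesis using assms(1) a assms(3) thin_R[of t] by auto
qed

lemma thin_square_unique:
  assumes "thin t" "t \<in> a \<odot> a" "thin t'" "t' \<in> a \<odot> a"
  shows "t' = t \<or> kind1 a \<and> t' = t \<bullet> h a"
proof (cases "thin a")
  case True
  then show ?thesis using thin_prd_single assms by blast
next
  case False
  have a: "a \<in> R" using assms prd_carrier by blast
  have "t' = t \<or> t' = t \<bullet> h a" using thin_square_set[OF assms(1,2) False] assms by auto
  moreover have "thin (h a)" if "t' = t \<bullet> h a" using that assms a False by auto
  ultimately show ?thesis using a False by (auto simp: kind1_def)
qed

text \<open>For the second kind, \<open>square_thin\<close> provides such a \<open>t\<close>, and it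
  is unique because the other constituent of the square has valency two.\<close>

definition \<theta> :: "'r \<Rightarrow> 'r" where "\<theta> a = (SOME t. t \<in> a \<odot> a \<and> thin t)"

lemma kind2_\<theta>: assumes "kind2 a" shows "\<theta> a \<in> a \<odot> a" "thin (\<theta> a)"
proof -
  have "\<exists>t. t \<in> a \<odot> a \<and> thin t"
    using square_thin[of "h a" a] h_in[of a] assms unfolding kind2_def thin_def by auto
  from someI_ex[OF this] show "\<theta> a \<in> a \<odot> a" "thin (\<theta> a)" unfolding \<theta>_def by auto
qed

lemma kind2_\<theta>_unique: "\<lbrakk>kind2 a; thin t; t \<in> a \<odot> a\<rbrakk> \<Longrightarrow> t = \<theta> a"
  using thin_square_unique[of "\<theta> a" a t] kind2_\<theta> by (auto simp: kind1_def kind2_def)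

text \<open>The constituent of valency two in the square of a relation of the second kind; see
  \<open>kind2_square\<close>.\<close>

definition \<rho> :: "'r \<Rightarrow> 'r" where "\<rho> a = \<theta> a \<bullet> h a"

lemma kind2_square: "kind2 a \<Longrightarrow> a \<odot> a = {\<theta> a, \<rho> a}"
  using thin_square_set kind2_\<theta> kind2D unfolding \<rho>_def by blast

lemma kind2_\<rho>: assumes "kind2 a" shows "\<rho> a \<in> R" "\<not> thin (\<rho> a)" "\<rho> a \<noteq> \<theta> a"
proof -
  show "\<rho> a \<in> R" "\<not> thin (\<rho> a)" using kind2_\<theta>[OF assms] kind2D[OF assms] by (auto simp: \<rho>_def)
  then show "\<rho> a \<noteq> \<theta> a" using kind2_\<theta>(2)[OF assms] by auto
qed

lemma kind2_cv: "kind2 a \<Longrightarrow> cv a = cv (\<theta> a) \<bullet> a"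
  using thin_square_cv kind2_\<theta> by blast

lemma kind2_eq_act_cv: "kind2 a \<Longrightarrow> \<theta> a \<bullet> cv a = a"
  using thin_in_prd kind2_\<theta> by fastforce

lemma \<theta>_prd_cv: assumes "kind2 a" shows "\<theta> a \<odot> cv a = {a}"
  using act_prd[of "\<theta> a" "cv a"] kind2_eq_act_cv kind2_\<theta> kind2D assms by auto

text \<open>\<open>\<rho> a\<close> carries a factor \<open>\<theta> a\<close> and
  \<open>cv a\<close> a factor \<open>cv (\<theta> a)\<close>; they cancel.\<close>

lemma \<rho>_prd_cv: assumes "kind2 a" shows "\<rho> a \<odot> cv a = h a \<odot> a"
proof -
  have r: "a \<in> R" "h a \<in> R" "thin (\<theta> a)" using kind2D[OF assms] kind2_\<theta>[OF assms] by auto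
  have "x \<in> \<rho> a \<odot> cv a \<longleftrightarrow> x \<in> R \<and> cv (\<theta> a) \<bullet> x \<in> cv a \<odot> h a" for x
    using act_prd_iff[of "\<theta> a" "h a" x "cv a"] r by (simp add: \<rho>_def prd_commute)
  moreover have "cv (\<theta> a) \<bullet> x \<in> cv a \<odot> h a \<longleftrightarrow> x \<in> a \<odot> h a" if "x \<in> R" for x
    using act_prd_iff[of "cv (\<theta> a)" a "cv (\<theta> a) \<bullet> x" "h a"] r that kind2_cv[OF assms] by simp
  ultimately have "x \<in> \<rho> a \<odot> cv a \<longleftrightarrow> x \<in> h a \<odot> a" for x
    using prd_carrier[of x a "h a"] by (auto simp: prd_commute)
  then show ?thesis by blast
qed

lemma square_prd_cv:
  assumes "kind2 a" "z \<in> a \<odot> a" "y \<in> z \<odot> cv a" shows "y \<in> h a \<odot> a"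
proof -
  have "z = \<theta> a \<or> z = \<rho> a" using kind2_square assms by auto
  then show ?thesis using assms \<theta>_prd_cv \<rho>_prd_cv h_prd kind2D by fastforce
qed

text \<open>The map \<open>x \<mapsto> (t \<bullet> t') \<bullet> cv x\<close> is an involution of
  \<open>a \<odot> b\<close>, and its fixed points are the \<open>x\<close> with
  \<open>t \<bullet> t' \<in> x \<odot> x\<close>. On at most two constituents, one fixed point
  \<open>d\<close> forces the other to be fixed.\<close>

lemma thin_in_square_step:
  assumes "thin t" "t \<in> a \<odot> a" "thin t'" "t' \<in> b \<odot> b" "c \<in> a \<odot> b" "d \<in> a \<odot> b" "t \<bullet> t' \<in> d \<odot> d"
  shows "t \<bullet> t' \<in> c \<odot> c"
proof -
  have r: "a \<in> R" "b \<in> R" "c \<in> R" using assms prd_carrier by auto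
  have "cv c \<in> (cv t \<bullet> a) \<odot> (cv t' \<bullet> b)"
    using prd_converse[OF assms(5)] thin_square_cv assms by simp
  then have "t \<bullet> cv c \<in> a \<odot> (cv t' \<bullet> b)" using act_prd_iff[of "cv t" a] assms r by simp
  then have "t' \<bullet> t \<bullet> cv c \<in> a \<odot> b" using act_prd_iff[of "cv t'" b "t \<bullet> cv c" a] assms r by (simp add: prd_commute)
  moreover have "t' \<bullet> t \<bullet> cv c = (t \<bullet> t') \<bullet> cv c" using assms r by (simp add: act_act act_commute)
  ultimately have c: "(t \<bullet> t') \<bullet> cv c \<in> a \<odot> b" by simp
  have th: "thin (t \<bullet> t')" using assms by simp
  have d: "(t \<bullet> t') \<bullet> cv d = d" using thin_in_prd[OF th assms(7)] by simp
  have "d \<in> R" using assms prd_carrier by blast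
  consider "c = d" | "(t \<bullet> t') \<bullet> cv c = d" | "c = (t \<bullet> t') \<bullet> cv c"
    using prd_card[OF assms(5,6) c] by blast
  then have "c = (t \<bullet> t') \<bullet> cv c"
  proof cases
    case 2
    then have "(t \<bullet> t') \<bullet> cv c = (t \<bullet> t') \<bullet> cv d" using d by simp
    then have "cv c = cv d" using th r \<open>d \<in> R\<close> by (simp del: act_act)
    then show ?thesis using d by (metis cv_cv)
  qed (use d in auto)
  then have "c \<in> (t \<bullet> t') \<odot> cv c" using act_prd[OF th, of "cv c"] r by auto
  then show ?thesis using rotate[of "t \<bullet> t'" c c] by simp
qed

text \<open>\<open>thin_in_square_step\<close> requires one constituent of
  \<open>u \<odot> a\<close> whose square is known already. For \<open>a \<in> u \<odot> a'\<close>
  it is \<open>t \<bullet> a'\<close>: rotation gives \<open>a' \<in> a \<odot> cv u\<close> with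
  \<open>cv u = cv t \<bullet> u\<close>, and the hypothesis for \<open>a'\<close>, two powers
  lower, supplies the square.\<close>

lemma thin_power_square:
  assumes t: "thin t" "t \<in> u \<odot> u" and "c \<in> W (replicate_mset n u)"
  shows "tpow t n \<in> c \<odot> c"
  using assms(3)
proof (induct n arbitrary: c rule: less_induct)
  case (less n)
  have u: "u \<in> R" using t prd_carrier by blast
  show ?case
  proof (cases n)
    case 0
    then show ?thesis using less unit_prd[of \<epsilon>] unit_carrier by simp
  next
    case n: (Suc k)
    from less(2) n obtain a where a: "a \<in> W (replicate_mset k u)" "c \<in> u \<odot> a" by (auto simp: W_add)
    have ta: "tpow t k \<in> a \<odot> a" using less(1)[of k a] a n by simp
    show ?thesis
    proof (cases k)
      case 0
      then have "c = u" using a u unit_prd[of u] by (auto simp: prd_commute)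
      then show ?thesis using n 0 t by simp
    next
      case k: (Suc j)
      from a k obtain a' where a': "a' \<in> W (replicate_mset j u)" "a \<in> u \<odot> a'" by (auto simp: W_add)
      have ta': "tpow t j \<in> a' \<odot> a'" using less(1)[of j a'] a' n k by simp
      have r: "a \<in> R" "a' \<in> R" using a' prd_carrier by auto
      have "a' \<in> a \<odot> cv u" using a'(2) rotate2 by blast
      then have "a' \<in> (cv t \<bullet> u) \<odot> a" using thin_square_cv[OF t] by (simp add: prd_commute)
      then have d: "t \<bullet> a' \<in> u \<odot> a" using act_prd_iff[of "cv t" u a' a] t u by simp
      have sq: "t \<bullet> tpow t k \<in> (t \<bullet> a') \<odot> (t \<bullet> a')"
      proof -
        have "t \<bullet> tpow t j \<in> (t \<bullet> a') \<odot> a'" using act_prd_in[of t a' _ a'] t r ta' by blast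
        then have "t \<bullet> tpow t j \<in> a' \<odot> (t \<bullet> a')" by (simp add: prd_commute)
        then have "t \<bullet> t \<bullet> tpow t j \<in> (t \<bullet> a') \<odot> (t \<bullet> a')"
          using act_prd_in[of t a' _ "t \<bullet> a'"] t r by blast
        then show ?thesis using k by simp
      qed
      show ?thesis
        using thin_in_square_step[OF t _ ta a(2) d] sq t n by simp
    qed
  qed
qed

text \<open>Since \<open>cv u = cv t \<bullet> u\<close>, the relation \<open>t \<bullet> c\<close>
  lies in the third power of \<open>u\<close>, so its square contains \<open>tpow t 3\<close>;
  removing \<open>t\<close> twice leaves \<open>t\<close>.\<close>

lemma thin_square_cube:
  assumes t: "thin t" "t \<in> u \<odot> u" and "x \<in> u \<odot> u" "c \<in> x \<odot> cv u"
  shows "t \<in> c \<odot> c"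
proof -
  have r: "u \<in> R" "x \<in> R" "c \<in> R" using assms prd_carrier by auto
  have "c \<in> (cv t \<bullet> u) \<odot> x" using assms thin_square_cv[OF t] by (simp add: prd_commute)
  then have "t \<bullet> c \<in> u \<odot> x" using act_prd_iff[of "cv t" u c x] t r by simp
  then have "t \<bullet> c \<in> W {#u, u, u#}" using assms(3) by (auto simp: W_add[of u "{#u, u#}"] W_2)
  then have "tpow t 3 \<in> (t \<bullet> c) \<odot> (t \<bullet> c)"
    using thin_power_square[OF t, of "t \<bullet> c" 3] by (simp add: numeral_3_eq_3)
  then have "cv t \<bullet> tpow t 3 \<in> c \<odot> (t \<bullet> c)" using act_prd_iff[of t c _ "t \<bullet> c"] t r by simp
  then have "cv t \<bullet> cv t \<bullet> tpow t 3 \<in> c \<odot> c"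
    using act_prd_iff[of t c _ c] t r by (simp add: prd_commute)
  then show ?thesis using t thin_R[of t] by (simp add: numeral_3_eq_3)
qed

text \<open>Each power is invariant under \<open>h a\<close>. Multiplying a thin pair by
  \<open>a\<close> merges it, because \<open>h a\<close> fixes \<open>a\<close>; multiplying a
  single \<open>c\<close> of valency two gives a thin pair or, by \<open>kind1_prd\<close> and
  \<open>h c = h a\<close>, again a single class.\<close>

lemma kind1_power:
  assumes "kind1 a" "n \<ge> 1"
  shows "\<exists>c. W (replicate_mset n a) = {c} \<and> \<not> thin c \<and> h a \<bullet> c = c \<or> thin c \<and> W (replicate_mset n a) = {c, h a \<bullet> c}"
  using assms(2)
proof (induct n rule: dec_induct)
  case base
  have "W {#a#} = {a}" using assms kind1D W_1 by blast
  then show ?case using assms kind1D kind1_act by (intro exI[of _ a]) auto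
next
  case (step n)
  then obtain c where c: "W (replicate_mset n a) = {c} \<and> \<not> thin c \<and> h a \<bullet> c = c
     \<or> thin c \<and> W (replicate_mset n a) = {c, h a \<bullet> c}" by blast
  have a: "a \<in> R" "\<not> thin a" "thin (h a)" "h a \<noteq> \<epsilon>" using assms kind1D h_in by auto
  have cR: "c \<in> R" using c W_R[of "replicate_mset n a"] by auto
  show ?case
  proof (cases "thin c")
    case True
    have "W (replicate_mset (Suc n) a) = a \<odot> c \<union> a \<odot> (h a \<bullet> c)" using c True by (auto simp: W_add)
    also have "a \<odot> (h a \<bullet> c) = {h a \<bullet> c \<bullet> a}"
      using act_prd[of "h a \<bullet> c" a] True a by (simp add: prd_commute act_act)
    also have "h a \<bullet> c \<bullet> a = c \<bullet> h a \<bullet> a" using act_left_commute True a by blast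
    also have "\<dots> = c \<bullet> a" using assms by simp
    also have "a \<odot> c = {c \<bullet> a}" using act_prd[of c a] True a by (simp add: prd_commute)
    finally have "W (replicate_mset (Suc n) a) = {c \<bullet> a}" by simp
    moreover have "h a \<bullet> c \<bullet> a = c \<bullet> a" using act_left_commute[of "h a" c a] True a assms by simp
    ultimately show ?thesis using a True by (intro exI[of _ "c \<bullet> a"]) auto
  next
    case False
    then have Wc: "W (replicate_mset (Suc n) a) = a \<odot> c" and hc: "h a \<bullet> c = c" using c by (auto simp: W_add)
    have h: "h c = h a" using act_fix_h[of "h a" c] a hc cR False by auto
    then have k: "kind1 c" using False cR a by (auto simp: kind1_def)
    obtain d where d: "d \<in> a \<odot> c" using prd_nonempty a cR by blast
    have d': "h a \<bullet> d \<in> a \<odot> c" using kind1_act_prd[OF assms(1) d] .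
    show ?thesis
    proof (cases "thin d")
      case True
      have "d \<noteq> h a \<bullet> d"
      proof
        assume "d = h a \<bullet> d"
        then have "d = d \<bullet> h a" using act_commute True a by simp
        then have "d \<bullet> \<epsilon> = d \<bullet> h a" using True by simp
        then show False using act_inj[of d \<epsilon> "h a"] True a unit_carrier by auto
      qed
      then have "a \<odot> c = {d, h a \<bullet> d}" using d d' prd_card[OF _ d d'] by blast
      then show ?thesis using Wc True by auto
    next
      case False
      then have "a \<odot> c = {d}" using kind1_prd[OF assms(1) k _ d] h by simp
      then show ?thesis using Wc False d' by (intro exI[of _ d]) auto
    qed
  qed
qed

subsection \<open>Arcs, words and purity\<close>

definition arc :: "'r \<Rightarrow> bool" where "arc a \<longleftrightarrow> a \<in> R \<and> len a = 1"

text \<open>The shift makes \<open>ty a\<close> the length of a shortest circuit through an arc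
  \<open>a\<close>; type \<open>(1, q - 1)\<close> becomes \<open>ty a = q\<close>.\<close>

definition ty :: "'r \<Rightarrow> nat" where "ty a = Suc (len (cv a))"

abbreviation arcs :: "'r multiset \<Rightarrow> bool" where "arcs M \<equiv> \<forall>a \<in># M. arc a"

abbreviation rep :: "nat \<Rightarrow> 'r \<Rightarrow> 'r multiset" where "rep \<equiv> replicate_mset"

lemma rep_add: "rep (i + j) x = rep i x + rep j x"
  by (induct i) auto

lemma rep_split: "k \<le> n \<Longrightarrow> rep n x = rep k x + rep (n - k) x"
  using rep_add[of k "n - k" x] by simp

definition two_way :: "'r \<Rightarrow> nat \<Rightarrow> nat \<Rightarrow> bool" where
  "two_way c i j \<longleftrightarrow> c \<in> R \<and> len c = i \<and> len (cv c) = j"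

lemma two_way_unique: "\<lbrakk>two_way c i j; two_way d i j\<rbrakk> \<Longrightarrow> c = d"
  using len_unique[of c d] by (auto simp: two_way_def)

lemma arc_R: "arc a \<Longrightarrow> a \<in> R"
  by (simp add: arc_def)

lemma arc_neq_unit: "arc a \<Longrightarrow> a \<noteq> \<epsilon>"
  using len_unit by (auto simp: arc_def)

lemma cv_eq_unit [simp]: "cv a = \<epsilon> \<longleftrightarrow> a = \<epsilon>"
  by (metis cv_cv cv_unit)

lemma arc_ty: "arc a \<Longrightarrow> ty a \<ge> 2"
  using len_0[of "cv a"] arc_neq_unit[of a] arc_R[of a] cv_R[of a] cv_eq_unit[of a] unfolding ty_def
  by (cases "len (cv a)") (blast, linarith)

lemma len_cv_arc: "len (cv a) = ty a - 1"
  by (simp add: ty_def)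

lemma arc_unique: "\<lbrakk>arc a; arc b; ty a = ty b\<rbrakk> \<Longrightarrow> a = b"
  using len_unique[of a b] by (auto simp: arc_def ty_def)

lemma arc_sym_iff: "arc a \<Longrightarrow> cv a = a \<longleftrightarrow> ty a = 2"
  using len_unique[of a "cv a"] by (auto simp: arc_def ty_def)

lemma len_W: "\<lbrakk>c \<in> W M; arcs M\<rbrakk> \<Longrightarrow> len c \<le> size M"
proof (induct M arbitrary: c)
  case (add a M)
  then obtain x where "x \<in> W M" "c \<in> a \<odot> x" by (auto simp: W_add)
  with add show ?case using len_prd[of c a x] by (fastforce simp: arc_def)
qed auto

lemma ex_W: "c \<in> R \<Longrightarrow> \<exists>M. arcs M \<and> size M = len c \<and> c \<in> W M"
proof (induct "len c" arbitrary: c)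
  case 0
  then show ?case using len_0[of c] by (intro exI[of _ "{#}"]) auto
next
  case (Suc n)
  then obtain a d where a: "len a = 1" "len d = n" "c \<in> a \<odot> d" using len_Suc by metis
  moreover have "d \<in> R" "a \<in> R" using a prd_carrier by auto
  ultimately obtain M where "arcs M" "size M = n" "d \<in> W M" using Suc(1)[of d] by auto
  then show ?case using a \<open>a \<in> R\<close> Suc(2) by (intro exI[of _ "add_mset a M"]) (auto simp: arc_def W_add)
qed

lemma len_triangle: assumes "c \<in> a \<odot> b" shows "len c \<le> len a + len b"
proof -
  obtain M where M: "arcs M" "size M = len a" "a \<in> W M" using ex_W prd_carrier[OF assms] by blast
  obtain N where N: "arcs N" "size N = len b" "b \<in> W N" using ex_W prd_carrier[OF assms] by blast
  have "c \<in> W (M + N)" using M N assms by (auto simp: W_union)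
  then show ?thesis using len_W[of c "M + N"] M N by auto
qed

lemma len_triangle_cv: assumes "c \<in> a \<odot> b"
  shows "len (cv c) \<le> len (cv a) + len (cv b)" "len (cv a) \<le> len (cv c) + len b"
    "len (cv b) \<le> len (cv c) + len a" "len a \<le> len c + len (cv b)" "len b \<le> len c + len (cv a)"
proof -
  have "cv a \<in> cv c \<odot> b" "cv b \<in> cv c \<odot> a"
    using assms rotate[of "cv c" "cv a" "cv b"] rotate2[of "cv c" "cv a" "cv b"] converse by auto
  moreover have "a \<in> c \<odot> cv b" "b \<in> c \<odot> cv a" using assms rotate rotate2 by blast+
  ultimately show "len (cv c) \<le> len (cv a) + len (cv b)" "len (cv a) \<le> len (cv c) + len b"
    "len (cv b) \<le> len (cv c) + len a" "len a \<le> len c + len (cv b)" "len b \<le> len c + len (cv a)"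
    using len_triangle converse assms by blast+
qed

lemma count_ge_2_split: assumes "2 \<le> count M a" shows "\<exists>N. M = {#a, a#} + N"
proof -
  have "a \<in># M" using assms by (intro count_inI) simp
  then obtain M1 where M1: "M = add_mset a M1" by (metis multi_member_split)
  then have "0 < count M1 a" using assms by simp
  then have "a \<in># M1" by simp
  then show ?thesis using M1 by (metis multi_member_split add_mset_add_single union_mset_add_mset_left add_0)
qed

text \<open>As products commute, only the multiset of arc classes on a closed walk matters.\<close>

definition circ :: "'r multiset \<Rightarrow> bool" where "circ M \<longleftrightarrow> arcs M \<and> \<epsilon> \<in> W M"

text \<open>A word of \<open>a\<close> lists the arcs of a shortest circuit through an arc \<open>a\<close>.\<close>

definition word :: "'r \<Rightarrow> 'r multiset \<Rightarrow> bool" where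
  "word a M \<longleftrightarrow> circ M \<and> a \<in># M \<and> size M = ty a"

text \<open>The letters other than one copy of \<open>a\<close> form a walk back along
  \<open>a\<close>.\<close>

lemma circ_size: assumes "circ M" "a \<in># M" shows "ty a \<le> size M"
proof -
  obtain N where N: "M = add_mset a N" using assms(2) by (metis multi_member_split)
  then have "cv a \<in> W N" using assms(1) by (auto simp: circ_def W_unit_add)
  then have "len (cv a) \<le> size N" using len_W[of "cv a" N] assms(1) N by (auto simp: circ_def)
  then show ?thesis using N by (simp add: ty_def)
qed

lemma circI: "\<lbrakk>arcs M; arcs N; c \<in> W M; cv c \<in> W N\<rbrakk> \<Longrightarrow> circ (M + N)"
  unfolding circ_def using W_glue2 by auto

lemma wordI: "\<lbrakk>circ M; a \<in># M; size M \<le> ty a\<rbrakk> \<Longrightarrow> word a M"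
  using circ_size[of M a] by (auto simp: word_def)

lemma wordD: assumes "word a M" shows "circ M" "arcs M" "\<epsilon> \<in> W M" "a \<in># M" "size M = ty a" "arc a"
  using assms by (auto simp: word_def circ_def)

lemma word_letter_ty: "\<lbrakk>word a M; x \<in># M\<rbrakk> \<Longrightarrow> ty x \<le> ty a"
  using circ_size wordD by metis

lemma word_letter_less: "\<lbrakk>word a M; x \<in># M; x \<noteq> a\<rbrakk> \<Longrightarrow> ty x < ty a"
  using word_letter_ty[of a M x] arc_unique[of x a] wordD[of a M] by fastforce

lemma circ_split: "circ (M + N) \<Longrightarrow> \<exists>c \<in> W M. cv c \<in> W N"
  using W_split2 by (auto simp: circ_def)

text \<open>A walk shorter than \<open>N\<close> would close up with \<open>M\<close>, which
  contains \<open>a\<close>, to a circuit of length less than \<open>ty a\<close>.\<close>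

lemma word_len_cv:
  assumes "word a (M + N)" "c \<in> W M" "cv c \<in> W N" "a \<in># M" shows "len (cv c) = size N"
proof -
  have "cv c \<in> R" using assms W_R by blast
  then obtain N' where N': "arcs N'" "size N' = len (cv c)" "cv c \<in> W N'" using ex_W by blast
  have "circ (M + N')" using circI[of M N' c] N' assms wordD(2)[OF assms(1)] by auto
  then have "ty a \<le> size M + size N'" using circ_size[of "M + N'" a] assms(4) by auto
  then have "size N \<le> len (cv c)" using wordD(5)[OF assms(1)] N' by simp
  then show ?thesis using len_W[of "cv c" N] assms wordD(2)[OF assms(1)] by auto
qed

lemma word_len:
  assumes "word a (M + N)" "c \<in> W M" "cv c \<in> W N" "a \<in># N" shows "len c = size M"
  using word_len_cv[of a N M "cv c"] assms by (simp add: add.commute)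

lemma ex_word: assumes "arc a" shows "\<exists>M. word a (add_mset a M)"
proof -
  obtain M where M: "arcs M" "size M = len (cv a)" "cv a \<in> W M" using ex_W[of "cv a"] assms arc_R by auto
  then have "circ (add_mset a M)" using assms arc_R by (auto simp: circ_def W_unit_add)
  then show ?thesis using M by (intro exI[of _ M]) (auto simp: word_def ty_def)
qed

text \<open>If \<open>c\<close> leads back to its origin in the shortest possible way, then the arcs on the way complete
  every factorisation of \<open>c\<close> to a word.\<close>

lemma word_complete:
  assumes "c \<in> a \<odot> x" "arc a" "arc x" "len (cv c) + 2 \<le> ty a"
  shows "\<exists>N. cv c \<in> W N \<and> arcs N \<and> word a (add_mset a (add_mset x N))"
proof -
  have "cv c \<in> R" using prd_carrier[OF assms(1)] by simp
  then obtain N where N: "arcs N" "size N = len (cv c)" "cv c \<in> W N" using ex_W by blast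
  have "circ ({#a, x#} + N)" using circI[of "{#a, x#}" N c] N assms by (auto simp: W_2)
  then have "word a ({#a, x#} + N)" using wordI[of "{#a, x#} + N" a] assms N by auto
  then show ?thesis using N by auto
qed

section \<open>Pure arcs\<close>

definition pure :: "'r \<Rightarrow> bool" where
  "pure a \<longleftrightarrow> arc a \<and> (\<forall>M. word a M \<longrightarrow> M = rep (ty a) a)"

lemma pureD: "\<lbrakk>pure a; word a M\<rbrakk> \<Longrightarrow> M = rep (ty a) a"
  by (simp add: pure_def)

lemma pure_letter: "\<lbrakk>pure a; word a M; x \<in># M\<rbrakk> \<Longrightarrow> x = a"
  using pureD[of a M] by (auto split: if_splits)

lemma pure_word: "pure a \<Longrightarrow> word a (rep (ty a) a)"
  using ex_word[of a] pureD[of a] by (metis pure_def)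

text \<open>Both pieces of the cut contain a letter \<open>a\<close>, so neither can be
  shortened.\<close>

lemma pure_two_way:
  assumes "pure a" "i + j = ty a" "1 \<le> i" "1 \<le> j" "c \<in> W (rep i a)" "cv c \<in> W (rep j a)"
  shows "two_way c i j"
proof -
  have w: "word a (rep i a + rep j a)"
    using pure_word[OF assms(1)] assms(2) by (simp add: rep_add[symmetric])
  have "c \<in> R" using assms W_R by blast
  then show ?thesis using word_len[OF w] word_len_cv[OF w] assms by (simp add: two_way_def)
qed

lemma ty_2_pure: assumes "arc a" "ty a = 2" shows "pure a"
  unfolding pure_def
proof (intro conjI allI impI)
  fix M assume w: "word a M"
  then obtain N where N: "M = add_mset a N" by (metis multi_member_split wordD(4))
  then have "size N = 1" using w assms wordD(5) by fastforce
  then obtain x where x: "N = {#x#}" by (metis size_1_singleton_mset)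
  then have "\<epsilon> \<in> a \<odot> x" using w N wordD(3) by (fastforce simp: W_2)
  then have "x = cv a" using unit_in_prd by blast
  then show "M = rep (ty a) a" using N x assms arc_sym_iff[of a] by (simp add: numeral_2_eq_2)
qed (use assms in simp)

lemma arc_thin_order: assumes "arc t" "thin t" "tpow t k = \<epsilon>" "k \<ge> 1" shows "ty t \<le> k"
proof -
  have "circ (rep k t)" using assms W_tpow[of t k] by (auto simp: circ_def)
  then show ?thesis using circ_size[of "rep k t" t] assms by auto
qed

lemma pure_thin_order: "\<lbrakk>pure t; thin t\<rbrakk> \<Longrightarrow> tpow t (ty t) = \<epsilon>"
  using pure_word[of t] wordD(3)[of t "rep (ty t) t"] W_tpow[of t "ty t"] by auto

lemma W_rep_2: "W (rep 2 x) = x \<odot> x"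
  by (simp add: numeral_2_eq_2 W_2)

section \<open>Pure arcs of the second kind and the order of \<open>\<theta> a\<close>\<close>

context
  fixes a assumes a: "pure a" "kind2 a" "ty a \<ge> 3"
begin

lemma pure_kind2_order: "tpow (\<theta> a) (ty a) = \<epsilon>"
  using thin_power_square[of "\<theta> a" a \<epsilon> "ty a"] kind2_\<theta>[OF a(2)] wordD(3)[OF pure_word[OF a(1)]]
    unit_prd[of \<epsilon>] unit_carrier by auto

text \<open>If \<open>cv (\<theta> a) \<in> a \<odot> f\<close>, then
  \<open>f = cv (\<theta> a) \<bullet> cv a\<close>, and \<open>f \<odot> a\<close> contains
  \<open>cv (\<rho> a)\<close> too. Thus \<open>\<theta> a\<close> and \<open>\<rho> a\<close> would
  have the same two distances.\<close>

lemma pure_kind2_\<theta>: "cv (\<theta> a) \<notin> W (rep (ty a - 2) a)"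
proof
  assume *: "cv (\<theta> a) \<in> W (rep (ty a - 2) a)"
  obtain n where n: "ty a - 2 = Suc n" using a(3) by (metis Suc_diff_le numeral_3_eq_3 diff_Suc_Suc numeral_2_eq_2)
  then obtain f where f: "f \<in> W (rep n a)" "cv (\<theta> a) \<in> a \<odot> f" using * by (auto simp: W_add)
  have r: "a \<in> R" "thin (\<theta> a)" "h a \<in> R" "\<not> thin a" using kind2D[OF a(2)] kind2_\<theta>[OF a(2)] by auto
  have "f \<in> cv (\<theta> a) \<odot> cv a" using f(2) rotate2 by blast
  then have f': "f = cv (\<theta> a) \<bullet> cv a" using act_in[of "cv (\<theta> a)" "cv a" f] r by auto
  have "h a \<in> cv a \<odot> a" using h_in[of a] r by (simp add: prd_commute)
  then have "cv (\<rho> a) \<in> f \<odot> a" using act_prd_in[of "cv (\<theta> a)" "cv a" "cv (\<rho> a)" a] r f'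
    by (auto simp: \<rho>_def)
  then have rho: "cv (\<rho> a) \<in> W (rep (ty a - 2) a)" using n f by (auto simp: W_add prd_commute)
  have "two_way (\<theta> a) 2 (ty a - 2)" "two_way (\<rho> a) 2 (ty a - 2)"
    using pure_two_way[of a 2 "ty a - 2"] a * rho kind2_square[OF a(2)] by (auto simp: W_rep_2)
  then show False using two_way_unique kind2_\<rho>[OF a(2)] by metis
qed

lemma pure_kind2_\<rho>: "cv (\<rho> a) \<in> W (rep (ty a - 2) a)"
proof -
  have "\<epsilon> \<in> W (rep 2 a + rep (ty a - 2) a)"
    using wordD(3)[OF pure_word[OF a(1)]] rep_split[of 2 "ty a" a] a(3) by (metis Suc_leD eval_nat_numeral(3))
  then obtain c where "c \<in> W (rep 2 a)" "cv c \<in> W (rep (ty a - 2) a)" using W_split2 by blast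
  then show ?thesis using pure_kind2_\<theta> kind2_square[OF a(2)] by (auto simp: W_rep_2)
qed

lemma pure_kind2_two_way: "two_way (\<rho> a) 2 (ty a - 2)"
  using pure_two_way[of a 2 "ty a - 2"] a pure_kind2_\<rho> kind2_square[OF a(2)] by (auto simp: W_rep_2)

text \<open>With \<open>pure_kind2_order\<close>, the order of \<open>\<theta> a\<close> is exactly
  \<open>ty a\<close>. A smaller order yields a proper divisor \<open>d\<close> of
  \<open>ty a\<close> with \<open>tpow (\<theta> a) d = \<epsilon>\<close>, so that
  \<open>cv (\<theta> a)\<close>, and then \<open>cv a\<close>, lies in a power of \<open>a\<close>.
  The resulting circuit of length \<open>2 * d\<close> forces \<open>2 * d = ty a\<close>, which
  \<open>pure_kind2_\<theta>\<close> excludes.\<close>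

lemma pure_kind2_order_ge: assumes "tpow (\<theta> a) k = \<epsilon>" "k \<ge> 1" shows "ty a \<le> k"
proof (rule ccontr)
  assume k: "\<not> ty a \<le> k"
  define d where "d = gcd k (ty a)"
  have th: "thin (\<theta> a)" "\<theta> a \<in> a \<odot> a" using kind2_\<theta>[OF a(2)] by auto
  have d: "tpow (\<theta> a) d = \<epsilon>" using tpow_gcd[of "\<theta> a" k "ty a"] assms pure_kind2_order th by (simp add: d_def)
  have "d dvd ty a" "d \<le> k" "d \<ge> 1" using assms by (auto simp: d_def intro: gcd_le1_nat simp: Suc_leI)
  then obtain j where j: "ty a = d * j" by (auto elim: dvdE)
  have "j \<noteq> 0" "j \<noteq> 1" using j k \<open>d \<le> k\<close> a(3) by (intro notI; simp)+
  then have "j \<ge> 2" by linarith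
  then have "2 * d \<le> ty a" using j by (simp add: mult.commute)
  have cvt: "cv (\<theta> a) = tpow (\<theta> a) (d - 1)"
  proof -
    have "\<theta> a \<bullet> tpow (\<theta> a) (d - 1) = \<epsilon>" using d \<open>d \<ge> 1\<close> by (cases d) auto
    then show ?thesis using act_eq_iff[of "\<theta> a" \<epsilon> "tpow (\<theta> a) (d - 1)"] th unit_carrier by simp
  qed
  have tp: "tpow (\<theta> a) i \<in> W (rep (2 * i) a)" for i
  proof (induct i)
    case (Suc i)
    have "tpow (\<theta> a) (Suc i) \<in> \<theta> a \<odot> tpow (\<theta> a) i" using act_prd[of "\<theta> a" "tpow (\<theta> a) i"] th by simp
    then have "tpow (\<theta> a) (Suc i) \<in> W (rep 2 a + rep (2 * i) a)"
      using Suc th by (auto simp: W_union W_rep_2)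
    then show ?case by (simp add: rep_add[symmetric])
  qed simp
  have "cv a \<in> (tpow (\<theta> a) (d - 1)) \<odot> a"
    using kind2_cv[OF a(2)] cvt act_prd[of "tpow (\<theta> a) (d - 1)" a] th kind2D[OF a(2)] by auto
  then have "cv a \<in> W (add_mset a (rep (2 * (d - 1)) a))" using tp by (auto simp: W_add prd_commute)
  then have "\<epsilon> \<in> W (rep (2 * d) a)" using \<open>d \<ge> 1\<close> kind2D[OF a(2)] W_unit_add[of a "rep (2*d-1) a"]
    by (cases d) auto
  then have "circ (rep (2 * d) a)" using a by (auto simp: circ_def pure_def)
  then have "ty a \<le> 2 * d" using circ_size[of "rep (2*d) a" a] \<open>d \<ge> 1\<close> by auto
  then have "2 * (d - 1) = ty a - 2" using \<open>2 * d \<le> ty a\<close> by simp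
  then show False using tp[of "d - 1"] cvt pure_kind2_\<theta> by simp
qed

end

text \<open>\<open>{\<epsilon>, k}\<close> behaves like a subgroup, and the powers of
  \<open>a\<close> run through its cosets. Only from the second power on do both members of the
  coset occur.\<close>

lemma W_rep_coset:
  assumes p: "thin p" and k: "k \<in> R" "k \<odot> k = {\<epsilon>, k}" and a: "a = p \<bullet> k" and n: "n \<ge> 2"
  shows "W (rep n a) = {tpow p n, tpow p n \<bullet> k}"
  using n
proof (induct n rule: dec_induct)
  case base
  have "x \<in> a \<odot> a \<longleftrightarrow> x = p \<bullet> p \<or> x = p \<bullet> p \<bullet> k" for x
  proof -
    have "x \<in> a \<odot> a \<longleftrightarrow> (\<exists>d \<in> k \<odot> a. x = p \<bullet> d)" using act_prd_in[OF p k(1)] a by simp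
    also have "\<dots> \<longleftrightarrow> (\<exists>d' \<in> k \<odot> k. x = p \<bullet> p \<bullet> d')"
      using act_prd_in[OF p k(1), of _ k] a by (auto simp: prd_commute)
    finally show ?thesis using k p by auto
  qed
  then have "a \<odot> a = {p \<bullet> p, p \<bullet> p \<bullet> k}" by blast
  then show ?case using p k by (simp add: W_rep_2 numeral_2_eq_2 act_act W_2)
next
  case (step n)
  have pn: "thin (tpow p n)" "tpow p n \<in> R" using p by auto
  have "a \<odot> tpow p n = {p \<bullet> tpow p n \<bullet> k}"
    using act_prd[of "tpow p n" a] pn k(1) a p act_left_commute[of p "tpow p n" k] by (simp add: prd_commute)
  moreover have "a \<odot> (tpow p n \<bullet> k) = {p \<bullet> tpow p n, p \<bullet> tpow p n \<bullet> k}"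
  proof -
    have "x \<in> a \<odot> (tpow p n \<bullet> k) \<longleftrightarrow> (\<exists>d \<in> (tpow p n \<bullet> k) \<odot> k. x = p \<bullet> d)" for x
      using act_prd_in[OF p k(1), of x "tpow p n \<bullet> k"] a by (simp add: prd_commute)
    then have "x \<in> a \<odot> (tpow p n \<bullet> k) \<longleftrightarrow> (\<exists>d \<in> k \<odot> k. x = p \<bullet> tpow p n \<bullet> d)" for x
      unfolding Bex_def act_prd_in[OF pn(1) k(1)] by blast
    then show ?thesis using k pn by auto
  qed
  ultimately show ?case using step p k pn by (auto simp: W_add act_act)
qed

text \<open>Such a \<open>p\<close> gives \<open>a = p \<bullet> h a\<close> with
  \<open>{\<epsilon>, h a}\<close> closed under products, so the powers of \<open>a\<close> are
  cosets. Then \<open>\<theta> a = tpow p 2\<close>, and its converse lies in the power with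
  exponent \<open>ty a - 2\<close>, against \<open>pure_kind2_\<theta>\<close>. The bound 4 makes
  this exponent at least two.\<close>

lemma pure_kind2_no_thin_neighbour:
  assumes a: "pure a" "kind2 a" "ty a \<ge> 4" and p: "p \<in> h a \<odot> a" "thin p"
  shows False
proof -
  have r: "a \<in> R" "h a \<in> R" "\<not> thin a" "\<not> thin (h a)" "cv (h a) = h a" "p \<in> R" "h a \<noteq> \<epsilon>"
    using kind2D[OF a(2)] p prd_carrier h_in by auto
  have "a \<in> p \<odot> h a" using p(1) rotate2[of p "h a" a] r by simp
  then have ap: "a = p \<bullet> h a" using act_in[of p "h a" a] p r by auto
  have "h a \<odot> h a = a \<odot> cv a" using act_prd_cv[of p "h a"] ap p r by simp
  then have "h a \<odot> h a = {\<epsilon>, h a}" using prd_cv r by simp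
  note W = W_rep_coset[OF p(2) r(2) this ap]
  have "\<epsilon> \<in> W (rep (ty a) a)" using wordD(3)[OF pure_word[OF a(1)]] .
  moreover have "tpow p (ty a) \<bullet> h a \<noteq> \<epsilon>"
    using thin_iff_act[of "tpow p (ty a)" "h a"] p r thin_unit thin_tpow by metis
  ultimately have e: "tpow p (ty a) = \<epsilon>" using W[of "ty a"] a(3) by auto
  have sq: "a \<odot> a = {tpow p 2, tpow p 2 \<bullet> h a}" using W[of 2] by (simp add: W_rep_2)
  have th: "\<theta> a = tpow p 2"
    using sq kind2_\<theta>_unique[OF a(2), of "tpow p 2"] p by auto
  have "tpow p 2 \<bullet> tpow p (ty a - 2) = \<epsilon>" using tpow_add[of p 2 "ty a - 2"] p(2) e a(3) le_add_diff_inverse[of 2 "ty a"] by (metis add_leD1 numeral_Bit0)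
  then have "cv (\<theta> a) = tpow p (ty a - 2)"
    using act_eq_iff[of "tpow p 2" \<epsilon> "tpow p (ty a - 2)"] p th unit_carrier by simp
  then have "cv (\<theta> a) \<in> W (rep (ty a - 2) a)" using W[of "ty a - 2"] a(3) by simp
  then show False using pure_kind2_\<theta> a by simp
qed

lemma kind1_W_act: assumes "kind1 a" "n \<ge> 1" "x \<in> W (rep n a)" shows "h a \<bullet> x \<in> W (rep n a)"
  using assms(2,3) kind1_act_prd[OF assms(1)] by (cases n) (auto simp: W_add)

lemma pure_kind1_W: assumes "pure a" "kind1 a" shows "W (rep (ty a) a) = {\<epsilon>, h a}"
proof -
  have e: "\<epsilon> \<in> W (rep (ty a) a)" using wordD(3)[OF pure_word[OF assms(1)]] .
  have "ty a \<ge> 1" using assms(1) arc_ty by (fastforce simp: pure_def)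
  then obtain c where c: "thin c" "W (rep (ty a) a) = {c, h a \<bullet> c}"
    using kind1_power[OF assms(2), of "ty a"] e by force
  have hh: "h a \<bullet> h a \<bullet> c = c"
    using act_act[of "h a" "h a" c] c(1) kind1D[OF assms(2)] thin_R kind1_h_square[OF assms(2)] by simp
  have "c = \<epsilon> \<or> h a \<bullet> c = \<epsilon>" using e c by auto
  then show ?thesis
  proof
    assume "h a \<bullet> c = \<epsilon>"
    then have "c = h a" using hh act_unit[of "h a"] kind1D[OF assms(2)] by metis
    then show ?thesis using c \<open>h a \<bullet> c = \<epsilon>\<close> by auto
  qed (use c kind1D[OF assms(2)] in simp)
qed

text \<open>A class \<open>d\<close> at which the circuit is cut and \<open>h a \<bullet> d\<close>
  have the same two distances, so \<open>h a\<close> fixes \<open>d\<close>. This is impossible for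
  thin \<open>d\<close>, and \<open>kind1_power\<close> leaves the single class.\<close>

lemma pure_kind1_single: assumes "pure a" "kind1 a" "1 \<le> i" "i < ty a"
  shows "\<exists>c. W (rep i a) = {c} \<and> \<not> thin c \<and> h a \<bullet> c = c"
proof (rule ccontr)
  assume no: "\<not> ?thesis"
  have k: "thin (h a)" "h a \<noteq> \<epsilon>" "h a \<in> R" "cv (h a) = h a"
    using kind1D[OF assms(2)] h_in by auto
  have w: "word a (rep i a + rep (ty a - i) a)"
    using pure_word[OF assms(1)] assms by (simp add: rep_add[symmetric])
  then obtain d where d: "d \<in> W (rep i a)" "cv d \<in> W (rep (ty a - i) a)"
    using circ_split wordD(1) by blast
  have dR: "d \<in> R" using d W_R by blast
  have "h a \<bullet> d \<in> W (rep i a)" using kind1_W_act assms d by blast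
  moreover have "cv (h a \<bullet> d) \<in> W (rep (ty a - i) a)"
    using kind1_W_act[of a "ty a - i" "cv d"] assms d k dR by simp
  ultimately have "two_way (h a \<bullet> d) i (ty a - i)" "two_way d i (ty a - i)"
    using pure_two_way[of a i "ty a - i"] assms d by auto
  then have hd: "h a \<bullet> d = d" using two_way_unique by blast
  obtain c where c: "thin c" "W (rep i a) = {c, h a \<bullet> c}"
    using kind1_power[OF assms(2), of i] no assms by blast
  then have "thin d" using d k by auto
  then have "d \<bullet> h a = d \<bullet> \<epsilon>" using hd act_commute[of d "h a"] k by simp
  then show False using act_inj[of d "h a" \<epsilon>] \<open>thin d\<close> k unit_carrier by simp
qed

subsection \<open>Squares of arcs\<close>

definition mixed :: "'r \<Rightarrow> 'r \<Rightarrow> bool" where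
  "mixed a b \<longleftrightarrow> arc a \<and> pure b \<and> Suc (ty b) = ty a \<and> b \<in> a \<odot> a \<and>
    (\<forall>M. word a M \<longrightarrow> M = {#a, a#} + rep (ty b - 1) b)"

text \<open>The invariant of the induction on the type: \<open>structured_step\<close> derives it
  for \<open>q\<close> from the arcs of smaller type.\<close>

definition structured :: "'r \<Rightarrow> bool" where
  "structured a \<longleftrightarrow> (\<forall>M. word a M \<longrightarrow> 2 \<le> count M a) \<and> (pure a \<or> (\<exists>b. mixed a b))"

lemma pure_arc: "pure a \<Longrightarrow> arc a" by (simp add: pure_def)

lemma mixedD:
  assumes "mixed a b"
  shows "arc a" "pure b" "arc b" "Suc (ty b) = ty a" "b \<in> a \<odot> a" "a \<noteq> b"
    "\<And>M. word a M \<Longrightarrow> M = {#a, a#} + rep (ty b - 1) b"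
  using assms by (auto simp: mixed_def pure_arc)

lemma pure_cv: assumes "pure a" shows "cv a \<in> W (rep (ty a - 1) a)"
proof -
  have "ty a = Suc (ty a - 1)" using arc_ty[OF pure_arc[OF assms]] by simp
  then have "rep (ty a) a = add_mset a (rep (ty a - 1) a)" by (metis replicate_mset_Suc)
  then show ?thesis using wordD(3)[OF pure_word[OF assms]] W_unit_add by metis
qed

lemma W_rep_square: assumes "b \<in> a \<odot> a" "x \<in> W (rep n b)" shows "x \<in> W (rep (2 * n) a)"
  using assms(2)
proof (induct n arbitrary: x)
  case (Suc n)
  then obtain y where y: "y \<in> W (rep n b)" "x \<in> b \<odot> y" by (auto simp: W_add)
  then have "x \<in> W (rep 2 a + rep (2 * n) a)" using Suc assms(1) by (auto simp: W_union W_rep_2)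
  then show ?case by (simp add: rep_add[symmetric])
qed simp

lemma cv_tpow_diff: assumes "thin t" "tpow t p = \<epsilon>" "k \<le> p" shows "cv (tpow t k) = tpow t (p - k)"
proof -
  have "tpow t k \<bullet> tpow t (p - k) = \<epsilon>" using tpow_add[of t k "p - k"] assms by simp
  then show ?thesis using act_eq_iff[of "tpow t k" \<epsilon> "tpow t (p - k)"] assms unit_carrier by simp
qed

lemma arc_square_len: assumes "x \<in> a \<odot> a" "arc a" shows "ty a - 2 \<le> len (cv x)" "len x \<le> 2"
  using len_triangle_cv(2)[OF assms(1)] len_triangle[OF assms(1)] assms(2) by (auto simp: arc_def ty_def)

lemma pure_square_len:
  assumes "pure a" "ty a \<ge> 3" shows "\<exists>l \<in> a \<odot> a. cv l \<in> W (rep (ty a - 2) a)"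
proof -
  have "\<epsilon> \<in> W (rep 2 a + rep (ty a - 2) a)"
    using wordD(3)[OF pure_word[OF assms(1)]] rep_split[of 2 "ty a" a] assms(2) by (metis Suc_leD eval_nat_numeral(3))
  then show ?thesis using W_split2[of "rep 2 a" "rep (ty a - 2) a"] unfolding W_rep_2 by blast
qed

lemma arcs_rep: "arc a \<Longrightarrow> arcs (rep n a)"
  by auto

text \<open>Names the constituent \<open>l\<close> of the square that lies on a shortest circuit
  through \<open>a\<close>. An arc of larger type in the square has to be the other
  constituent.\<close>

lemma structured_square_len:
  assumes "structured a" "ty a \<ge> 3" shows "\<exists>l \<in> a \<odot> a. len (cv l) \<le> ty a - 2 \<and> (pure a \<and> cv l \<in> W (rep (ty a - 2) a) \<or> mixed a l)"
proof (cases "pure a")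
  case True
  then obtain l where l: "l \<in> a \<odot> a" "cv l \<in> W (rep (ty a - 2) a)" using pure_square_len assms by blast
  then have "len (cv l) \<le> ty a - 2"
    using len_W[OF l(2) arcs_rep[OF pure_arc[OF True]]] by simp
  then show ?thesis using l True by blast
next
  case False
  then obtain b where "mixed a b" using assms by (auto simp: structured_def)
  then show ?thesis using mixedD[of a b] by (intro bexI[of _ b]) (auto simp: ty_def)
qed

text \<open>For the first kind the square would be a single class of valency two by
  \<open>pure_kind1_single\<close>.\<close>

lemma pure_not_thin_square:
  assumes "pure a" "\<not> thin a" "ty a \<ge> 3" "thin t" "t \<in> a \<odot> a" shows "kind2 a"
proof (rule ccontr)
  assume "\<not> kind2 a"
  then have "kind1 a" using kinds assms prd_carrier by blast
  then obtain c where "W (rep 2 a) = {c}" "\<not> thin c" using pure_kind1_single[of a 2] assms by auto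
  then show False using assms by (auto simp: W_rep_2)
qed

lemma tpow_2: "thin t \<Longrightarrow> tpow t 2 = t \<bullet> t"
  by (simp add: numeral_2_eq_2)

lemma thin_square_square: "\<lbrakk>thin t; t \<in> a \<odot> a; b \<in> a \<odot> a\<rbrakk> \<Longrightarrow> tpow t 2 \<in> b \<odot> b"
  using thin_power_square[of t a b 2] by (simp add: W_rep_2)

lemma tpow_involution: "\<lbrakk>thin k; k \<bullet> k = \<epsilon>\<rbrakk> \<Longrightarrow> tpow k n = (if even n then \<epsilon> else k)"
  by (induct n) auto

text \<open>Both \<open>h a\<close> and \<open>h b\<close> are at distance \<open>ty b\<close> in both directions, hence equal. Then
  \<open>h a \<odot> h a = {\<epsilon>, h a}\<close>, so that \<open>\<epsilon> \<in> W (rep (ty b) b)\<close> forces the order of \<open>t\<close> to be at most \<open>ty b\<close>.\<close>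

lemma mixed_kind2_thin_arc:
  assumes m: "mixed a b" and k: "kind2 a" and t: "\<theta> a = t" "arc t" and b: "b = \<rho> a"
    and o: "ty t = 2 * ty b" "tpow t (ty t) = \<epsilon>" and p: "ty b \<ge> 3"
  shows False
proof -
  define p where "p = ty b"
  have th: "thin t" "t \<in> a \<odot> a" using kind2_\<theta>[OF k] t by auto
  have r: "a \<in> R" "h a \<in> R" "b \<in> R" "t \<in> R" "cv (h a) = h a" "\<not> thin a" "\<not> thin (h a)"
    using kind2D[OF k] th mixedD[OF m] arc_R thin_R by auto
  have bt: "b = t \<bullet> h a" using b t by (simp add: \<rho>_def)
  have nb: "\<not> thin b" using kind2_\<rho>[OF k] b by simp
  have pb: "pure b" "arc b" "b \<in> a \<odot> a" using mixedD[OF m] by auto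
  have t2: "thin (tpow t 2)" "tpow t 2 \<in> b \<odot> b" using thin_square_square[of t a b] th pb by auto
  have kb: "kind2 b" using pure_not_thin_square[of b "tpow t 2"] pb nb p t2 by simp
  have tb: "\<theta> b = tpow t 2" using kind2_\<theta>_unique[OF kb] t2 by simp
  have cvb: "cv b \<in> W (rep (p - 1) b)" using pure_cv pb p_def by simp
  have p3: "p \<ge> 3" using p p_def by simp
  have arcs_b: "arcs (rep n b)" for n using pb by simp
  have "h a = cv t \<bullet> b" using act_eq_iff[of t b "h a"] bt th r by auto
  then have "cv (h a) = t \<bullet> cv b" using th r by simp
  then have "h a \<in> t \<odot> cv b" using act_prd[of t "cv b"] th r by simp
  then have "h a \<in> W (add_mset t (rep (p - 1) b))" using cvb by (auto simp: W_add)
  then have up: "len (h a) \<le> p" using len_W[of "h a"] t(2) arcs_b[of "p - 1"] p3 by fastforce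
  obtain M where M: "arcs M" "size M = len (h a)" "h a \<in> W M" using ex_W r by blast
  have "b \<in> t \<odot> h a" using act_prd[of t "h a"] bt th r by simp
  then have "b \<in> W (add_mset t M)" using M by (auto simp: W_add)
  then have "circ (add_mset t M + rep (p - 1) b)"
    using circI[OF _ arcs_b[of "p - 1"] _ cvb, of "add_mset t M"] M t(2) by simp
  then have lo: "p \<le> len (h a)" using circ_size[of _ t] M o p_def p3 by fastforce
  have ha: "two_way (h a) p p" using up lo r by (auto simp: two_way_def)
  have rb: "h b \<in> R" "cv (h b) = h b" "h b \<in> b \<odot> cv b" using kind2D[OF kb] h_in[of b] by auto
  have "h b \<in> W (add_mset b (rep (p - 1) b))" using rb cvb by (auto simp: W_add)
  then have upb: "len (h b) \<le> p" using len_W[of "h b"] pb(2) arcs_b[of "p - 1"] p3 by fastforce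
  obtain N where N: "arcs N" "size N = len (h b)" "h b \<in> W N" using ex_W rb by blast
  have "\<rho> b \<in> tpow t 2 \<odot> h b" using act_prd[of "tpow t 2" "h b"] t2 rb tb by (simp add: \<rho>_def)
  moreover have "tpow t 2 \<in> t \<odot> t" using act_prd[of t t] th r by (simp add: tpow_2)
  ultimately have "\<rho> b \<in> W ({#t, t#} + N)" using N by (auto simp only: W_union W_2)
  moreover have "cv (\<rho> b) \<in> W (rep (p - 2) b)" using pure_kind2_\<rho>[OF pb(1) kb] p p_def by simp
  ultimately have "circ ({#t, t#} + N + rep (p - 2) b)"

    using circI[OF _ arcs_b[of "p - 2"], of "{#t, t#} + N" "\<rho> b"] N t(2) by simp
  then have lob: "p \<le> len (h b)" using circ_size[of _ t] N o p_def p3 by fastforce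
  have "two_way (h b) p p" using upb lob rb by (auto simp: two_way_def)
  then have hb: "h b = h a" using ha two_way_unique by blast
  have "h a \<odot> h a = b \<odot> cv b" using act_prd_cv[of t "h a"] bt th r by simp
  then have "h a \<odot> h a = {\<epsilon>, h a}" using prd_cv[of b] r nb hb by simp
  then have "W (rep p b) = {tpow t p, tpow t p \<bullet> h a}" using W_rep_coset[OF th(1) r(2) _ bt, of p] p3 by simp
  moreover have "\<epsilon> \<in> W (rep p b)" using wordD(3)[OF pure_word[OF pb(1)]] p_def by simp
  ultimately have "tpow t p = \<epsilon> \<or> tpow t p \<bullet> h a = \<epsilon>" by auto
  moreover have "tpow t p \<bullet> h a \<noteq> \<epsilon>"
    using thin_iff_act[of "tpow t p" "h a"] th r thin_unit thin_tpow by metis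
  ultimately have "ty t \<le> p" using arc_thin_order[OF t(2) th(1), of p] p3 by simp
  then show False using o p_def p3 by simp
qed

text \<open>Counterpart for \<open>ty b = 2\<close>. Now \<open>b\<close> is the only symmetric arc,
  so the symmetric relations \<open>tpow t 2\<close> and \<open>h a\<close> are both at distances
  \<open>(2, 2)\<close> and coincide, but only the first has valency one.\<close>

lemma mixed_kind2_thin_arc_2:
  assumes m: "mixed a b" and k: "kind2 a" and t: "\<theta> a = t" "arc t" and b: "b = \<rho> a"
    and o: "ty t = 2 * ty b" "tpow t (ty t) = \<epsilon>" and p: "ty b = 2"
  shows False
proof -
  have th: "thin t" "t \<in> a \<odot> a" using kind2_\<theta>[OF k] t by auto
  have r: "a \<in> R" "h a \<in> R" "b \<in> R" "t \<in> R" "cv (h a) = h a" "\<not> thin a" "\<not> thin (h a)" "h a \<noteq> \<epsilon>"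
    using kind2D[OF k] th mixedD[OF m] arc_R thin_R h_in[of a] by auto
  have bt: "b = t \<bullet> h a" using b t by (simp add: \<rho>_def)
  have nb: "\<not> thin b" using kind2_\<rho>[OF k] b by simp
  have pb: "arc b" using mixedD[OF m] by auto
  have o4: "tpow t 4 = \<epsilon>" "ty t = 4" using o p by auto
  have sb: "cv b = b" using arc_sym_iff pb p by simp
  have s: "cv (tpow t 2) = tpow t 2" using cv_tpow_diff[of t 4 2] th o4 by simp
  have sne: "tpow t 2 \<noteq> \<epsilon>" using arc_thin_order[of t 2] t th o4 by auto
  have sym_arc: "x = b" if "arc x" "cv x = x" for x
    using that arc_unique[of x b] arc_sym_iff[of x] pb p by simp
  have two: "two_way x 2 2" if "x \<in> R" "cv x = x" "x \<noteq> \<epsilon>" "x \<noteq> b" "len x \<le> 2" for x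
  proof -
    have "len x \<noteq> 0" "len x \<noteq> 1" using that len_0[of x] sym_arc[of x] by (auto simp: arc_def)
    then show ?thesis using that by (auto simp: two_way_def)
  qed
  have "tpow t 2 \<in> t \<odot> t" using act_prd[of t t] th r by (simp add: tpow_2)
  then have "len (tpow t 2) \<le> 2" using len_triangle t(2) by (fastforce simp: arc_def)
  then have s2: "two_way (tpow t 2) 2 2"
    using two[of "tpow t 2"] s sne th nb thin_tpow[of t 2] by (metis tpow_R)
  have "h a = cv t \<bullet> b" using act_eq_iff[of t b "h a"] bt th r by auto
  then have "cv (h a) = t \<bullet> b" using th r sb by simp
  then have hb: "h a = t \<bullet> b" using r by simp
  then have "h a \<in> t \<odot> b" using act_prd[of t b] th r by simp
  then have lh: "len (h a) \<le> 2" using len_triangle t(2) pb by (fastforce simp: arc_def)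
  have "h a \<noteq> b"
  proof
    assume "h a = b"
    then have "t \<bullet> b = b" using hb by simp
    then have "h b = t" using act_fix_h[of t b] th r nb arc_neq_unit[OF t(2)] by simp
    then have "cv t = t" using cv_h[of b] r nb by simp
    then show False using sym_thin_square[of t] th sne tpow_2[of t] by simp
  qed
  then have "two_way (h a) 2 2" using two[of "h a"] lh r by simp
  then have "h a = tpow t 2" using s2 two_way_unique by blast
  then show False using r th by simp
qed

text \<open>With \<open>l\<close> on a shortest circuit through \<open>a\<close>, the square is
  \<open>{l, t}\<close>, and the kind of \<open>a\<close> determines how \<open>t\<close> and
  \<open>l\<close> are related. Then the way back along \<open>t\<close> or the order of a thin
  element becomes too small. The induction serves the case that \<open>a\<close> is mixed over
  \<open>l\<close> and \<open>t\<close> over some \<open>c\<close>: there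
  \<open>c \<in> l \<odot> l\<close> repeats the situation one type lower.\<close>

lemma square_no_longer_arc:
  assumes S: "\<And>x. \<lbrakk>arc x; 3 \<le> ty x; ty x \<le> N\<rbrakk> \<Longrightarrow> structured x"
  shows "\<lbrakk>arc a; arc t; ty a < ty t; ty t \<le> N\<rbrakk> \<Longrightarrow> t \<notin> a \<odot> a"
proof (induct "ty a" arbitrary: a t rule: less_induct)
  case less
  show ?case
  proof
    assume ta: "t \<in> a \<odot> a"
    have r: "a \<in> R" "t \<in> R" using less arc_R by auto
    have "ty a \<noteq> 2"
    proof
      assume "ty a = 2"
      then have "cv t = t" using ta arc_sym_iff[of a] less sym_in_prd_cv[of t a] by simp
      then show False using arc_sym_iff[of t] less \<open>ty a = 2\<close> by simp
    qed
    then have q: "ty a \<ge> 3" using arc_ty less by fastforce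
    have sa: "structured a" "structured t" using S less q by auto
    obtain l where l: "l \<in> a \<odot> a" "len (cv l) \<le> ty a - 2"
      "pure a \<and> cv l \<in> W (rep (ty a - 2) a) \<or> mixed a l"
      using structured_square_len[OF sa(1) q] by blast
    have lcvt: "len (cv t) > ty a - 2" using less by (simp add: ty_def)
    then have lt: "l \<noteq> t" using l by auto
    have lR: "l \<in> R" using l prd_carrier by blast
    have IH: False if "mixed a l" "arc c" "Suc (ty c) = ty t" "c \<in> l \<odot> l" for c
      using less(1)[of l c] mixedD[OF that(1)] that less by auto
    consider "thin a" | "kind1 a" | "kind2 a" using kinds r by blast
    then show False
    proof cases
      case 1
      then show ?thesis using thin_prd_single l ta lt by blast
    next
      case 2
      have hk: "thin (h a)" "h a \<in> R" "cv (h a) = h a" "h a \<bullet> h a = \<epsilon>" "\<not> thin a"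
        using kind1D[OF 2] kind1_h_square[OF 2] by auto
      have tt: "thin t" using kind1_prd[OF 2 2 refl ta] l lt by auto
      then have "a \<odot> a = {t, t \<bullet> h a}" using thin_square_set ta hk by blast
      then have "l = t \<bullet> h a" using l lt by auto
      then have lth: "l = h a \<bullet> t" using act_commute tt hk by simp
      then have tl: "t = h a \<bullet> l" using act_act[of "h a" "h a" t] hk r by simp
      have thl: "thin l" using lth tt hk by simp
      from l(3) show ?thesis
      proof
        assume "pure a \<and> cv l \<in> W (rep (ty a - 2) a)"
        then have "h a \<bullet> cv l \<in> W (rep (ty a - 2) a)" using kind1_W_act[OF 2] q by simp
        then have "len (cv t) \<le> ty a - 2"
          using tl hk lR len_W[of "cv t" "rep (ty a - 2) a"] less by auto
        then show False using lcvt by simp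
      next
        assume m: "mixed a l"
        define p where "p = ty l"
        have p: "p \<ge> 2" "tpow l p = \<epsilon>" "p < ty t" "Suc p = ty a"
          using mixedD[OF m] arc_ty[of l] less pure_thin_order thl by (auto simp: p_def)
        have tp: "tpow t p = tpow (h a) p" using tl tpow_act[of "h a" l p] hk thl p by simp
        \<comment> \<open>For even \<open>p\<close> the involution cancels, and the order of
          \<open>t\<close> would be at most \<open>p < ty t\<close>.\<close>
        then have "odd p" using tpow_involution[OF hk(1,4), of p] arc_thin_order[of t p] less p tt by auto
        then have "tpow t p = h a" using tp tpow_involution[OF hk(1,4), of p] by simp
        then have tSp: "tpow t (Suc p) = l" using lth act_commute[of t "h a"] tt hk by simp
        have "pure t \<or> (\<exists>c. mixed t c)" using sa by (auto simp: structured_def)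
        then show False
        proof
          assume "pure t"
          then have "tpow t (ty t) = \<epsilon>" using pure_thin_order tt by simp
          then have "l \<bullet> tpow t (ty t - Suc p) = \<epsilon>"
            using tpow_add[of t "Suc p" "ty t - Suc p"] tSp tt less p by simp
          \<comment> \<open>The single arc \<open>l\<close> replaces \<open>Suc p\<close>
            consecutive arcs \<open>t\<close>, which shortens the circuit of
            \<open>t\<close>.\<close>
          then have "\<epsilon> \<in> l \<odot> tpow t (ty t - Suc p)" using act_prd[of l] thl tt by auto
          then have "circ (add_mset l (rep (ty t - Suc p) t))"
            using W_tpow[of t] tt mixedD[OF m] less by (auto simp: circ_def W_add)
          then have "ty t \<le> Suc (ty t - Suc p)" using circ_size[of _ t] less p by fastforce
          then show False using p by simp
        next
          assume "\<exists>c. mixed t c"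
          then obtain c where c: "mixed t c" by blast
          have "t \<odot> t = {t \<bullet> t}" using act_prd tt r by simp
          then have "c = t \<bullet> t" using mixedD[OF c] by auto
          also have "\<dots> = tpow (h a \<bullet> l) 2" using tl tpow_2 tt by simp
          also have "\<dots> = tpow l 2" using tpow_act[of "h a" l 2] tpow_2[of "h a"] hk thl by simp
          finally have "c \<in> l \<odot> l" using act_prd[of l l] thl lR by (simp add: tpow_2)
          then show False using IH[OF m, of c] mixedD[OF c] by simp
        qed
      qed
    next
      case 3
      have th: "thin (\<theta> a)" "\<theta> a \<in> a \<odot> a" "a \<odot> a = {\<theta> a, \<rho> a}" using kind2_\<theta>[OF 3] kind2_square[OF 3] by auto
      consider "t = \<theta> a" "l = \<rho> a" | "t = \<rho> a" "l = \<theta> a" using ta l lt th by auto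
      then show ?thesis
      proof cases
        case tl: 1
        from l(3) show ?thesis
        proof
          assume "pure a \<and> cv l \<in> W (rep (ty a - 2) a)"
          then have "tpow t (ty a) = \<epsilon>" using pure_kind2_order[of a] 3 q tl by simp
          then show False using arc_thin_order[of t "ty a"] less th tl q by simp
        next
          assume m: "mixed a l"
          define p where "p = ty l"
          have p: "p \<ge> 2" "Suc p = ty a" "pure l" "arc l"
            using mixedD[OF m] arc_ty[of l] by (auto simp: p_def)
          have "\<epsilon> \<in> W (rep (2 * p) a)"
            using W_rep_square[OF l(1), of \<epsilon> p] wordD(3)[OF pure_word[OF p(3)]] p_def by simp
          then have t2p: "tpow t (2 * p) = \<epsilon>"
            using thin_power_square[of "\<theta> a" a \<epsilon> "2*p"] th tl unit_prd[of \<epsilon>] unit_carrier by auto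
          have "pure t \<or> (\<exists>c. mixed t c)" using sa by (auto simp: structured_def)
          then show False
          proof
            assume "pure t"
            then have o: "tpow t (ty t) = \<epsilon>" using pure_thin_order th tl by simp
            \<comment> \<open>The orders leave only \<open>ty t = 2 * ty l\<close>, the situation
              that \<open>mixed_kind2_thin_arc\<close> and \<open>mixed_kind2_thin_arc_2\<close>
              exclude.\<close>
            have "ty t dvd 2 * p"
              using tpow_order_dvd[of t "ty t" "2 * p"] arc_thin_order[of t] less(3) th tl(1) o t2p arc_ty[of t] by auto
            then have tt: "ty t = 2 * ty l" using dvd_double_eq[of "ty t" p] less(4) p p_def by simp
            show False
            proof (cases "p = 2")
              case True
              then show False using mixed_kind2_thin_arc_2[OF m 3 _ _ _ tt o] less tl p_def by simp
            next
              case False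
              then show False using mixed_kind2_thin_arc[OF m 3 _ _ _ tt o] less tl p p_def by simp
            qed
          next
            assume "\<exists>c. mixed t c"
            then obtain c where c: "mixed t c" by blast
            have "t \<odot> t = {tpow t 2}" using act_prd[of t t] th r tl tpow_2 by simp
            then have "c = tpow t 2" using mixedD[OF c] by auto
            then have "c \<in> l \<odot> l" using thin_square_square[of t a l] th tl l by simp
            then show False using IH[OF m, of c] mixedD[OF c] by simp
          qed
        qed
      next
        case tl: 2
        from l(3) show ?thesis
        proof
          assume "pure a \<and> cv l \<in> W (rep (ty a - 2) a)"
          then show False using pure_kind2_\<theta>[of a] 3 q tl by simp
        next
          assume m: "mixed a l"
          define p where "p = ty l"
          have p: "p \<ge> 2" "Suc p = ty a" "pure l" "arc l"
            using mixedD[OF m] arc_ty[of l] by (auto simp: p_def)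
          have o: "tpow l p = \<epsilon>" using pure_thin_order[of l] p th tl p_def by simp
          have "tpow l 2 \<in> t \<odot> t" using thin_square_square[of l a t] th tl ta by simp
          then have "cv t = cv (tpow l 2) \<bullet> t" using thin_square_cv th tl by simp
          also have "cv (tpow l 2) = tpow l (p - 2)" using cv_tpow_diff[of l p 2] o p th tl by simp
          finally have "cv t \<in> tpow l (p - 2) \<odot> t" using act_prd[of "tpow l (p - 2)" t] th tl r by simp
          then have "cv t \<in> W (add_mset t (rep (p - 2) l))"
            using W_tpow[of l "p - 2"] th tl by (auto simp: W_add prd_commute)
          then have "len (cv t) \<le> Suc (p - 2)"
            using len_W[of "cv t" "add_mset t (rep (p - 2) l)"] less p by simp
          then show False using lcvt p by simp
        qed
      qed
    qed
  qed
qed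

section \<open>Arcs in powers of an arc of smaller type\<close>

lemma power_shortcut:
  assumes "\<And>c. c \<in> W (rep 3 u) \<Longrightarrow> len c \<le> 2" "arc u" "x \<in> W (rep n u)" "n \<ge> 3"
  shows "len x < n"
proof -
  have "x \<in> W (rep 3 u + rep (n - 3) u)" using assms rep_split[of 3 n u] by metis
  then obtain c d where c: "c \<in> W (rep 3 u)" "d \<in> W (rep (n - 3) u)" "x \<in> c \<odot> d" using W_union by blast
  have "len d \<le> n - 3" using len_W[OF c(2) arcs_rep[OF assms(2)]] by simp
  then show ?thesis using len_triangle[OF c(3)] assms(1)[OF c(1)] assms(4) by linarith
qed

text \<open>The cube of \<open>u\<close> stays inside \<open>u \<odot> v\<close>, a product of two
  arcs, because the other constituent of \<open>u \<odot> u\<close> contributes nothing new. The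
  case left out is \<open>v = \<theta> u\<close> for the second kind.\<close>

lemma mixed_power_shortcut:
  assumes m: "mixed u v" and k: "thin u \<or> kind1 u \<or> kind2 u \<and> v = \<rho> u" and c: "c \<in> W (rep 3 u)"
  shows "len c \<le> 2"
proof -
  have v: "arc u" "arc v" "v \<in> u \<odot> u" using mixedD[OF m] by auto
  have r: "u \<in> R" "v \<in> R" using v arc_R by auto
  from c obtain x where x: "x \<in> u \<odot> u" "c \<in> u \<odot> x" by (auto simp: numeral_3_eq_3 W_add[of u "{#u, u#}"] W_2)
  have "c \<in> u \<odot> v"
  proof (cases "x = v")
    case False
    then have nt: "\<not> thin u" using thin_prd_single v x by blast
    consider "kind1 u" | "kind2 u" "v = \<rho> u" using k nt by blast
    then show ?thesis
    proof cases
      case 1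
      have "thin v" using kind1_prd[OF 1 1 refl v(3)] False x by blast
      then have "x = h u \<bullet> v"
        using thin_square_set[of v u] v x nt False act_commute[of v "h u"] kind1D[OF 1] by auto
      then have "c \<in> (h u \<bullet> v) \<odot> u" using x by (simp add: prd_commute)
      then obtain d where d: "d \<in> v \<odot> u" "c = h u \<bullet> d" using act_prd_in[of "h u" v c u] kind1D[OF 1] r by blast
      have "d \<in> u \<odot> v" using d(1) by (simp add: prd_commute)
      then show ?thesis using kind1_act_prd[OF 1, of d v] d by simp
    next
      case 2
      have th: "thin (\<theta> u)" using kind2_\<theta>[OF 2(1)] by simp
      have "x = \<theta> u" using kind2_square[OF 2(1)] x 2 False by auto
      then have "c = \<theta> u \<bullet> u" using x act_in[OF th r(1), of c] by (simp add: prd_commute)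
      moreover have "u \<in> h u \<odot> u" using h_prd kind2D[OF 2(1)] by blast
      ultimately have "c \<in> (\<theta> u \<bullet> h u) \<odot> u"
        using act_prd_in[OF th, of "h u" c u] kind2D[OF 2(1)] by auto
      then show ?thesis using 2 by (simp add: \<rho>_def prd_commute)
    qed
  qed (use x in simp)
  then show ?thesis using len_triangle[of c u v] v by (simp add: arc_def)
qed

text \<open>As \<open>cv q\<close> arises from \<open>q\<close> by a power of \<open>\<theta> u\<close>, reducing the exponent modulo the order of \<open>\<theta> u\<close>
  gives too short a way back along \<open>q\<close>, unless \<open>ty q = 2 * ty u\<close>.\<close>

lemma not_in_arc_power:
  assumes q: "arc q" "ty q \<ge> 4" and u: "arc u" "ty u < ty q" "ty u \<ge> 3 \<Longrightarrow> structured u"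
    and c: "cv q \<in> W (rep (ty q - 1) u)"
  shows "kind2 u \<and> \<theta> u \<in> q \<odot> q \<and> len (cv (\<theta> u)) = ty q - 2"
proof -
  have r: "q \<in> R" "u \<in> R" using q u arc_R by auto
  have len: "len (cv q) = ty q - 1" by (rule len_cv_arc)
  have qns: "cv q \<noteq> q" using arc_sym_iff q by auto
  have "ty u \<noteq> 2"
  proof
    assume "ty u = 2"
    then have "\<epsilon> \<in> u \<odot> u" using arc_sym_iff[OF u(1)] unit_in_prd r by simp
    then have "\<epsilon> \<in> cv q \<odot> cv q" using thin_power_square[of \<epsilon> u "cv q"] c by simp
    then show False using qns unit_in_prd by simp
  qed
  then have u3: "ty u \<ge> 3" using arc_ty[OF u(1)] by simp
  have st: "pure u \<or> (\<exists>v. mixed u v)" using u(3)[OF u3] by (simp add: structured_def)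
  have rest: "rep (ty q - 1) u = rep (ty u) u + rep (ty q - 1 - ty u) u" using rep_split[of "ty u" "ty q - 1" u] u(2) by simp
  have nsc: "\<not> (\<exists>v. mixed u v \<and> (thin u \<or> kind1 u \<or> kind2 u \<and> v = \<rho> u))"
    using power_shortcut[OF mixed_power_shortcut u(1) c] len q(2) by fastforce
  have short: False if "cv q \<in> W (rep n u)" "n < ty q - 1" for n
    using len_W[OF that(1) arcs_rep[OF u(1)]] that(2) len by simp
  have act_short: False if "cv q = t \<bullet> q" "thin t" "len t + 1 < ty q - 1" for t
  proof -
    have "cv q \<in> t \<odot> q" using that act_prd[of t q] r by auto
    then show False using len_triangle[of "cv q" t q] that len q by (simp add: arc_def)
  qed
  consider "thin u" | "kind1 u" | "kind2 u" using kinds r by blast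
  then show ?thesis
  proof cases
    case 1
    then have "pure u" using st nsc by blast
    then have "tpow u (ty u) = \<epsilon>" using pure_thin_order 1 by blast
    then have "tpow u (ty q - 1) = tpow u (ty q - 1 - ty u)" using tpow_eq_diff[of u "ty u" "ty q - 1"] 1 u by simp
    then have "cv q \<in> W (rep (ty q - 1 - ty u) u)" using c W_tpow[of u] 1 by simp
    moreover have "ty q - 1 - ty u < ty q - 1" using u3 q(2) by linarith
    ultimately show ?thesis using short by blast
  next
    case 2
    then have pu: "pure u" using st nsc by blast
    obtain x d where x: "x \<in> {\<epsilon>, h u}" "d \<in> W (rep (ty q - 1 - ty u) u)" "cv q \<in> x \<odot> d"
      using c rest pure_kind1_W[OF pu 2] by (metis W_union)
    have dR: "d \<in> R" using x W_R by blast
    have xd: "cv q = d \<or> cv q = h u \<bullet> d" using x dR unit_prd[of d] act_prd[of "h u" d] kind1D[OF 2] by auto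
    show ?thesis
    proof (cases "ty q - 1 - ty u = 0")
      case True
      then have "cv q = \<epsilon> \<or> cv q = h u" using xd x(2) kind1D[OF 2] by auto
      then have "cv (cv q) = cv q" using cv_h[of u] kind1D[OF 2] by (metis cv_unit)
      then show ?thesis using qns by simp
    next
      case False
      then have "cv q \<in> W (rep (ty q - 1 - ty u) u)" using kind1_W_act[OF 2, of "ty q - 1 - ty u" d] x xd by auto
      then show ?thesis using short u3 u q by force
    qed
  next
    case 3
    have th: "thin (\<theta> u)" "\<theta> u \<in> u \<odot> u" using kind2_\<theta>[OF 3] by auto
    have sq: "tpow (\<theta> u) (ty q - 1) \<in> cv q \<odot> cv q" using thin_power_square[OF th c] .
    then have cvq: "cv q = tpow (\<theta> u) (ty q - 1) \<bullet> q" using thin_in_prd[of _ "cv q" "cv q"] th by simp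
    have "len (\<theta> u) \<le> 2" using arc_square_len th u by blast
    from st show ?thesis
    proof
      assume "\<exists>v. mixed u v"
      then obtain v where m: "mixed u v" by blast
      then have v: "v = \<theta> u" using nsc 3 kind2_square[OF 3] mixedD[OF m] by auto
      then have o: "tpow v (ty v) = \<epsilon>" using pure_thin_order mixedD[OF m] th by simp
      define j where "j = (ty q - 1) mod ty v"
      have "ty v \<ge> 2" using mixedD[OF m] arc_ty by simp
      then have j: "j < ty v" by (simp add: j_def)
      have "tpow v j = tpow v (ty q - 1)" using tpow_mod[of v "ty v" "ty q - 1"] o th v by (simp add: j_def)
      then have "cv q = tpow v j \<bullet> q" using cvq v by simp
      moreover have "len (tpow v j) \<le> j"
        using len_W[of "tpow v j" "rep j v"] W_tpow[of v j] th v mixedD[OF m] by auto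
      moreover have "j + 1 < ty q - 1" using j mixedD(4)[OF m] u(2) by linarith
      ultimately have False using act_short[of "tpow v j"] thin_tpow[of v j] th v by auto
      then show ?thesis ..
    next
      assume pu: "pure u"
      then have o: "tpow (\<theta> u) (ty u) = \<epsilon>" using pure_kind2_order[OF pu 3 u3] by simp
      have lt: "len (tpow (\<theta> u) i) \<le> 2 * i" for i
      proof (induct i)
        case (Suc i)
        have "tpow (\<theta> u) (Suc i) \<in> \<theta> u \<odot> tpow (\<theta> u) i" using act_prd[of "\<theta> u"] th by simp
        then show ?case using len_triangle Suc \<open>len (\<theta> u) \<le> 2\<close> by fastforce
      qed simp
      define j where "j = (ty q - 1) mod ty u"
      have j: "j < ty u" using u3 by (simp add: j_def)
      have tj: "tpow (\<theta> u) j = tpow (\<theta> u) (ty q - 1)" using tpow_mod[of "\<theta> u" "ty u" "ty q - 1"] o th by (simp add: j_def)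
      then have cj: "cv q = tpow (\<theta> u) j \<bullet> q" using cvq by simp
      have "\<not> 2 * j + 1 < ty q - 1" using act_short[OF cj] th lt[of j] by fastforce
      moreover have qe: "ty q - 1 = ty u * ((ty q - 1) div ty u) + j" by (simp add: j_def)
      moreover have "(ty q - 1) div ty u \<ge> 1" using u u3 by (simp add: div_greater_zero_iff Suc_le_eq)
      \<comment> \<open>With quotient \<open>k\<close>, the inequality
        \<open>ty u * k + j \<le> 2 * j + 1\<close> and \<open>j < ty u\<close> leave only
        \<open>k = 1\<close> and \<open>j = ty u - 1\<close>.\<close>
      ultimately have "(ty q - 1) div ty u = 1 \<and> j = ty u - 1"
      proof -
        define k where "k = (ty q - 1) div ty u"
        have k: "k \<ge> 1" "ty q - 1 = ty u * k + j" "\<not> 2 * j + 1 < ty u * k + j"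
          using qe \<open>(ty q - 1) div ty u \<ge> 1\<close> \<open>\<not> 2 * j + 1 < ty q - 1\<close> by (auto simp: k_def)
        have "k < 2"
        proof (rule ccontr)
          assume "\<not> k < 2"
          then have "ty u * 2 \<le> ty u * k" by simp
          then show False using k j u3 by linarith
        qed
        then have "k = 1" using k by simp
        then show ?thesis using k j by (simp add: k_def)
      qed
      then have tq: "ty q = 2 * ty u" "j = ty u - 1" using qe u3 by simp_all
      have "\<theta> u \<bullet> tpow (\<theta> u) j = \<epsilon>" using o tq(2) u3 by (cases "ty u") auto
      then have cvt: "cv (\<theta> u) = tpow (\<theta> u) j" using act_eq_iff[of "\<theta> u" \<epsilon> "tpow (\<theta> u) j"] th unit_carrier by simp
      then have "cv (\<theta> u) \<in> cv q \<odot> cv q" using sq tj by simp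
      then have tqq: "\<theta> u \<in> q \<odot> q" using converse by blast
      have "len (cv (\<theta> u)) \<le> ty q - 2" using cvt lt[of j] tq u3 by simp
      then show ?thesis using arc_square_len(1)[OF tqq q(1)] 3 tqq by simp
    qed
  qed
qed

subsection \<open>The words of an arc\<close>

text \<open>\<open>N\<close> need not contain \<open>q\<close>, so the cut forces only the length of
  the way back; the second alternative is a shortcut for the pair \<open>q\<close>,
  \<open>x\<close>.\<close>

lemma word_pair:
  assumes "word q ({#q, x#} + N)" "ty q \<ge> 4" "c \<in> q \<odot> x" "cv c \<in> W N"
  shows "len (cv c) = ty q - 2" "two_way c 2 (ty q - 2) \<or> arc c \<and> Suc (ty c) = ty q"
proof -
  have "size N = ty q - 2" using wordD(5)[OF assms(1)] by simp
  moreover have "len (cv c) = size N" using word_len_cv[OF assms(1), of c] assms by (simp add: W_2)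
  ultimately show l: "len (cv c) = ty q - 2" by simp
  have "len c \<le> 2" using len_triangle[OF assms(3)] wordD(2)[OF assms(1)] by (simp add: arc_def)
  moreover have "c \<in> R" using prd_carrier assms(3) by blast
  moreover have "len c \<noteq> 0" using len_0[of c] \<open>c \<in> R\<close> l assms(2) by (intro notI) simp
  ultimately consider "len c = 1" | "len c = 2" by linarith
  then show "two_way c 2 (ty q - 2) \<or> arc c \<and> Suc (ty c) = ty q"
    using l \<open>c \<in> R\<close> assms(2) by cases (auto simp: two_way_def arc_def ty_def)
qed

text \<open>Otherwise \<open>b\<close> is a constituent of \<open>a \<odot> cv a\<close> and hence
  symmetric.\<close>

lemma no_arc_in_arc_prd: "\<lbrakk>arc a; arc b; ty b \<noteq> 2\<rbrakk> \<Longrightarrow> a \<notin> a \<odot> b"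
  using rotate2[of a a b] sym_in_prd_cv[of b a] arc_sym_iff[of b] by blast

text \<open>Everything in \<open>{\<epsilon>, h a} \<odot> h a\<close> is symmetric, which keeps
  arcs of type at least 3 out of it.\<close>

lemma prd_cv_prd: assumes "a \<in> R" "y \<in> a \<odot> cv a" "x \<in> y \<odot> h a" "\<not> thin a" shows "cv x = x"
proof -
  have h: "h a \<in> R" "cv (h a) = h a" using assms by auto
  consider "y = \<epsilon>" | "y = h a" using assms prd_cv by blast
  then show ?thesis
  proof cases
    case 1
    then show ?thesis using assms unit_prd[of "h a"] h by auto
  next
    case 2
    then show ?thesis using assms sym_in_prd_cv[of x "h a"] h by simp
  qed
qed

text \<open>The two steps \<open>s\<close> are merged into one class \<open>y\<close>, which falls
  into \<open>h p \<odot> p\<close>. That product contains \<open>p\<close> and at most one further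
  class, so the \<open>y\<close> obtained for different \<open>s\<close> can be compared.\<close>

lemma neighbour_square:
  assumes "z \<in> g \<odot> s" "g \<in> p \<odot> s" "z \<in> p \<odot> p" "kind2 p"
  obtains y where "y \<in> s \<odot> s" "y \<in> h p \<odot> p" "z \<in> y \<odot> p" "y \<in> z \<odot> cv p"
proof -
  have "z \<in> s \<odot> g" "g \<in> s \<odot> p" using assms by (simp_all add: prd_commute)
  then obtain y where y: "y \<in> s \<odot> s" "z \<in> y \<odot> p" using prd_assoc by blast
  then have "y \<in> z \<odot> cv p" using rotate by blast
  then show thesis using that y square_prd_cv[OF assms(4,3)] by blast
qed

text \<open>The class \<open>z\<close> on a circuit of \<open>b\<close> is factored through
  \<open>q \<odot> u\<close> in both orders, giving \<open>e \<in> b \<odot> u\<close> and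
  \<open>e' \<in> b \<odot> q\<close>. If the way back from \<open>e\<close> is short, then
  \<open>e = z\<close> and \<open>q\<close> becomes symmetric. Otherwise \<open>e = e'\<close>, and
  for \<open>b\<close> of the second kind constituents of \<open>u \<odot> u\<close> and of
  \<open>q \<odot> q\<close> both fall into \<open>h b \<odot> b\<close>. This yields
  \<open>\<theta> u = \<theta> q\<close> and makes \<open>\<theta> b\<close> its square; the order
  of \<open>\<theta> b\<close> rules out pure \<open>u\<close>, distances rule out mixed
  \<open>u\<close>.\<close>

lemma single_word_pure:
  assumes q: "arc q" "ty q \<ge> 4" and b: "pure b" "Suc (ty b) = ty q" and u: "arc u" "ty u < ty b"
    and qu: "q \<noteq> u" "b \<in> q \<odot> u"
    and w: "word q ({#q, u#} + rep (ty b - 1) b)"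
    and su: "ty u \<ge> 3 \<Longrightarrow> structured u"
    and iii: "\<And>x y. \<lbrakk>arc x; arc y; ty x < ty y; ty y < ty q\<rbrakk> \<Longrightarrow> y \<notin> x \<odot> x"
  shows False
proof -
  define p where "p = ty b"
  have p: "p \<ge> 3" "ty q = Suc p" using q b by (auto simp: p_def)
  have ab: "arc b" using pure_arc b by blast
  have r: "q \<in> R" "b \<in> R" "u \<in> R" using q ab u arc_R by auto
  have bu: "b \<noteq> u" using u by auto
  have qns: "cv q \<noteq> q" using arc_sym_iff q by auto
  obtain z where z: "z \<in> b \<odot> b" "cv z \<in> W (rep (p - 2) b)" using pure_square_len[of b] b p p_def by auto
  have zt: "two_way z 2 (p - 2)" using pure_two_way[of b 2 "p - 2" z] b z p by (simp add: W_rep_2 p_def)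
  have w1: "word q ({#u, b#} + add_mset q (rep (p - 2) b))" "word q ({#b, q#} + add_mset u (rep (p - 2) b))"
  proof -
    have "ty b - 1 = Suc (p - 2)" using p p_def by simp
    then have "rep (ty b - 1) b = add_mset b (rep (p - 2) b)" by simp
    then show "word q ({#u, b#} + add_mset q (rep (p - 2) b))" "word q ({#b, q#} + add_mset u (rep (p - 2) b))"
      using w by (simp_all add: add_mset_commute)
  qed
  have "b \<in> u \<odot> q" using qu by (simp add: prd_commute)
  then obtain e where e: "e \<in> b \<odot> u" "z \<in> e \<odot> q" using prd_assoc z(1) by blast
  obtain e' where e': "e' \<in> b \<odot> q" "z \<in> e' \<odot> u" using prd_assoc z(1) qu(2) by blast
  have "cv e \<in> cv z \<odot> q" using e(2) rotate[of "cv z" "cv e" "cv q"] converse by simp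
  then have cve: "cv e \<in> W (add_mset q (rep (p - 2) b))" using z(2) by (auto simp: W_add prd_commute)
  have "cv e' \<in> cv z \<odot> u" using e'(2) rotate[of "cv z" "cv e'" "cv u"] converse by simp
  then have cve': "cv e' \<in> W (add_mset u (rep (p - 2) b))" using z(2) by (auto simp: W_add prd_commute)
  have eR: "e \<in> R" "e' \<in> R" using e e' prd_carrier by auto
  have le: "len e = 2" using word_len[OF w1(1), of e] cve e by (simp add: W_2 prd_commute)
  have "len (cv e) \<le> p - 1" using len_W[OF cve] q ab p by auto
  moreover have "p - 1 \<le> len (cv e) + 1"
    using len_triangle_cv(2)[OF e(1)] len_cv_arc[of b] u(1) by (simp add: arc_def p_def)
  ultimately consider "len (cv e) = p - 2" | "len (cv e) = p - 1" using p by linarith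
  then show False
  proof cases
    case 1
    then have "e = z" using le eR zt two_way_unique[of e 2 "p - 2" z] by (simp add: two_way_def)
    then have zu: "z \<in> b \<odot> u" using e by simp
    have nt: "\<not> thin b"
    proof
      assume "thin b"
      then have "b \<bullet> u = b \<bullet> b" using zu z(1) act_eqI by metis
      then show False using \<open>thin b\<close> r bu by simp
    qed
    have "u \<in> cv b \<odot> z" using zu rotate2[of z b u] by (simp add: prd_commute)
    then obtain y where y: "y \<in> cv b \<odot> b" "u \<in> y \<odot> b" using prd_assoc z(1) by blast
    then have "y = \<epsilon> \<or> y = h b" using prd_cv[OF r(2) nt] by (auto simp: prd_commute)
    moreover have "y \<noteq> \<epsilon>" using y unit_prd[of b] r bu by auto
    ultimately have "cv u \<in> cv b \<odot> h b" using y r nt prd_converse[of u "h b" b] by (simp add: prd_commute)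
    moreover have "q \<in> b \<odot> cv u" using qu(2) rotate by blast
    ultimately obtain x where "x \<in> b \<odot> cv b" "q \<in> x \<odot> h b" using prd_assoc by blast
    then show False using prd_cv_prd r nt qns by blast
  next
    case 2
    have "two_way e' 2 (ty q - 2) \<or> arc e' \<and> Suc (ty e') = ty q"
      using word_pair(2)[of q b _ e'] w1(2) q(2) e'(1) cve' by (simp add: add_mset_commute prd_commute)
    moreover have "\<not> (arc e' \<and> Suc (ty e') = ty q)"
    proof
      assume "arc e' \<and> Suc (ty e') = ty q"
      then have "e' = b" using arc_unique[of e' b] ab b by simp
      then show False using e'(1) no_arc_in_arc_prd[of b q] ab q by simp
    qed
    moreover have two: "two_way e 2 (ty q - 2)" using le 2 eR p by (simp add: two_way_def)
    ultimately have "e' = e" using two_way_unique by blast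
    then have g: "e \<in> b \<odot> u" "e \<in> b \<odot> q" "z \<in> e \<odot> q" "z \<in> e \<odot> u" using e e' by auto
    consider "thin b" | "kind1 b" | "kind2 b" using kinds r by blast
    then show False
    proof cases
      case 1
      then have "b \<bullet> u = b \<bullet> q" using g act_eqI by metis
      then show ?thesis using 1 r qu by simp
    next
      case k: 2
      have hb: "thin (h b)" using kind1D[OF k] by simp
      have "q \<in> cv b \<odot> e" using g(2) rotate2[of e b q] by (simp add: prd_commute)
      then obtain y where y: "y \<in> cv b \<odot> b" "q \<in> y \<odot> u" using g(1) prd_assoc by blast
      then have "y = \<epsilon> \<or> y = h b" using prd_cv[OF r(2)] kind1D[OF k] by (auto simp: prd_commute)
      moreover have "y \<noteq> \<epsilon>" using y unit_prd[of u] r qu by auto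
      ultimately have "q = h b \<bullet> u" using y act_eqI[OF hb] by simp
      then obtain d where "d \<in> u \<odot> u" "b = h b \<bullet> d" using qu(2) act_prd_in[OF hb r(3)] by blast
      moreover have "cv (h b) = h b" using kind1D[OF k] by simp
      ultimately have "b \<in> u \<odot> u"
        using act_eq_iff[of "h b" b d] hb prd_carrier[of d u u] r kind1_act[OF k] by simp
      then show ?thesis using iii u ab b by simp
    next
      case k: 3
      have nt: "\<not> thin b" "\<not> thin (h b)" using kind2D[OF k] by auto
      have th: "thin (\<theta> b)" "\<theta> b \<in> b \<odot> b" using kind2_\<theta>[OF k] by auto
      have ord: "tpow (\<theta> b) k = \<epsilon> \<Longrightarrow> k \<ge> 1 \<Longrightarrow> p \<le> k" for k
        using pure_kind2_order_ge[OF b(1) k] p p_def by simp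
      obtain y where y: "y \<in> u \<odot> u" "y \<in> h b \<odot> b" "z \<in> y \<odot> b" "y \<in> z \<odot> cv b"
        using neighbour_square[OF g(4,1) z(1) k] .
      obtain y2 where y2: "y2 \<in> q \<odot> q" "y2 \<in> h b \<odot> b" "z \<in> y2 \<odot> b" "y2 \<in> z \<odot> cv b"
        using neighbour_square[OF g(3,2) z(1) k] .
      have yb: "y \<noteq> b" using y(1) iii[of u b] u ab b by auto
      have ty: "\<theta> b \<in> y \<odot> y" using thin_square_cube[OF th z(1) y(4)] .
      have symt: "cv (\<theta> b) \<noteq> \<theta> b"
        using sym_thin_square[OF th(1)] ord[of 2] p th tpow_2 by fastforce
      have u3: "ty u \<ge> 3"
      proof (rule ccontr)
        assume "\<not> ty u \<ge> 3"
        then have "cv u = u" using arc_sym_iff u arc_ty[OF u(1)] by simp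
        then have "cv y = y" using y(1) sym_in_prd_cv[of y u] by simp
        then show False using ty sym_in_prd_cv[of "\<theta> b" y] symt by simp
      qed
      then have p4: "p \<ge> 4" using u p_def by simp
      have ynt: "\<not> thin y" using pure_kind2_no_thin_neighbour[OF b(1) k] p4 p_def y(2) by auto
      have yna: "\<not> arc y"
      proof
        assume "arc y"
        moreover have "len (cv z) + 2 \<le> ty b" using zt p p_def by (simp add: two_way_def)
        moreover have "z \<in> b \<odot> y" using y(3) by (simp add: prd_commute)
        ultimately obtain N where "word b (add_mset b (add_mset y N))"
          using word_complete[of z b y] ab by blast
        then show False using pure_letter[OF b(1)] yb by auto
      qed
      \<comment> \<open>Otherwise \<open>y2 = y\<close> has the distances of \<open>e\<close>, so
        \<open>q\<close> lies in \<open>{\<epsilon>, h b} \<odot> h b\<close> and is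
        symmetric.\<close>
      have "y2 = b"
      proof (rule ccontr)
        assume "y2 \<noteq> b"
        then have "y2 = y" using prd_card[OF y(2) y2(2) h_prd[OF r(2) nt(1)]] yb by blast
        then have yq: "y \<in> q \<odot> q" using y2 by simp
        have l1: "p - 1 \<le> len (cv y)" using arc_square_len[OF yq q(1)] p by simp
        have "cv y \<in> cv z \<odot> b" using y(3) rotate[of "cv z" "cv y" "cv b"] converse by simp
        then have "cv y \<in> W (add_mset b (rep (p - 2) b))" using z(2) by (auto simp: W_add prd_commute)
        then have "len (cv y) \<le> p - 1" using len_W[of "cv y" "add_mset b (rep (p - 2) b)"] ab p by auto
        moreover have "len y \<le> 2" using arc_square_len[OF yq q(1)] by simp
        moreover have yR: "y \<in> R" using y prd_carrier by blast
        moreover have "len y \<noteq> 0" using len_0[OF yR] ynt thin_unit by metis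
        moreover have "len y \<noteq> 1" using yna yR by (simp add: arc_def)
        ultimately have "two_way y 2 (ty q - 2)" using l1 p by (simp add: two_way_def)
        then have ey: "e = y" using two two_way_unique by blast
        have "q \<in> cv b \<odot> e" using g(2) rotate2[of e b q] by (simp add: prd_commute)
        moreover have "e \<in> b \<odot> h b" using ey y(2) by (simp add: prd_commute)
        ultimately obtain x where "x \<in> cv b \<odot> b" "q \<in> x \<odot> h b" using prd_assoc by blast
        then show False using prd_cv_prd[of b x q] r nt qns by (simp add: prd_commute)
      qed
      then have bqq: "b \<in> q \<odot> q" using y2 by simp
      have qnt: "\<not> thin q" using thin_square_thin bqq nt by blast
      have "\<not> kind1 q"
      proof
        assume kq: "kind1 q"
        have "h b = h q" using kind1_square_h[OF kq bqq nt(1)] .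
        then show False using nt kind1D[OF kq] by simp
      qed
      then have kq: "kind2 q" using kinds r qnt by blast
      have tq: "thin (\<theta> q)" "\<theta> q \<in> q \<odot> q" using kind2_\<theta>[OF kq] by auto
      have tb: "\<theta> b = tpow (\<theta> q) 2" using kind2_\<theta>_unique[OF k _ thin_square_square[OF tq bqq]] tq by simp
      have "u \<in> b \<odot> cv q" using qu(2) rotate2 by blast
      then have tu: "\<theta> q \<in> u \<odot> u" using thin_square_cube[OF tq bqq] by blast
      have unt: "\<not> thin u" using thin_prd_single[of u "\<theta> q" u y] tu y(1) tq ynt by auto
      have "\<not> kind1 u" using kind1_prd[of u u y] y(1) ynt tu tq by auto
      then have ku: "kind2 u" using kinds r unt by blast
      have tuq: "\<theta> u = \<theta> q" using kind2_\<theta>_unique[OF ku tq(1) tu] by simp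
      have "pure u \<or> (\<exists>v. mixed u v)" using su u3 by (simp add: structured_def)
      then show False
      proof
        assume pu: "pure u"
        have "tpow (\<theta> q) (ty u) = \<epsilon>" using pure_kind2_order[OF pu ku u3] tuq by simp
        then have "tpow (\<theta> b) (ty u) = \<epsilon>" using tb tpow_mult[of "\<theta> q" 2 "ty u"] tpow_dvd[of "\<theta> q" "ty u" "2 * ty u"] tq by simp
        then show False using ord[of "ty u"] u u3 p_def by simp
      next
        assume "\<exists>v. mixed u v"
        then obtain v where m: "mixed u v" by blast
        have "v = \<theta> q \<or> v = y" using prd_card[OF mixedD(5)[OF m] tu y(1)] tq ynt by auto
        then show False
        proof
          assume "v = \<theta> q"
          then have "len (cv v) \<ge> ty q - 2" using arc_square_len[OF tq(2) q(1)] by simp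
          then show False using mixedD(4)[OF m] u p p_def by (simp add: ty_def)
        next
          assume "v = y" then show False using yna mixedD[OF m] by simp
        qed
      qed
    qed
  qed
qed

text \<open>If \<open>u \<noteq> v\<close>, exchanging letters exhibits \<open>u\<close>,
  \<open>b\<close> and \<open>v\<close> as three constituents of \<open>g \<odot> cv q\<close>. If
  \<open>u = v\<close>, the letters besides \<open>q\<close> and \<open>b\<close> are
  \<open>ty v\<close> copies of \<open>v\<close>; they span some
  \<open>x \<noteq> \<epsilon>\<close> although \<open>\<epsilon>\<close> is possible too, so
  \<open>v\<close> is not thin, and the kinds of \<open>v\<close> and \<open>b\<close>
  decide.\<close>

lemma single_word_mixed:
  assumes q: "arc q" "ty q \<ge> 4" and m: "mixed b v" and b: "Suc (ty b) = ty q" "\<And>M. word b M \<Longrightarrow> 2 \<le> count M b"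
    and u: "arc u" "u \<noteq> b" "q \<noteq> u" "b \<in> q \<odot> u"
    and w: "word q ({#q, u, b#} + rep (ty v - 1) v)"
  shows False
proof -
  define p where "p = ty b"
  have p: "p \<ge> 3" "ty q = Suc p" "ty v = p - 1" "ty v - 1 = p - 2" using q b(1) mixedD(4)[OF m] by (auto simp: p_def)
  have a: "arc b" "arc v" "pure v" "v \<in> b \<odot> b" "b \<noteq> v" using mixedD[OF m] by auto
  have r: "q \<in> R" "b \<in> R" "u \<in> R" "v \<in> R" using q a u arc_R by auto
  have qv: "q \<noteq> v" "q \<noteq> b" using p mixedD(4)[OF m] by auto
  have mw: "word b M \<Longrightarrow> M = {#b, b#} + rep (p - 2) v" for M using mixedD(7)[OF m, of M] p by simp
  have len: "len (cv q) = p" using len_cv_arc[of q] p by simp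
  have qb: "b \<notin> q \<odot> b"
    using rotate[of b q b] sym_in_prd_cv[of q b] arc_sym_iff[OF q(1)] q by auto
  have sp: "rep (p - 2) v = add_mset v (rep (p - 3) v)"
  proof -
    have "p - 2 = Suc (p - 3)" using p by simp
    then show ?thesis by simp
  qed
  have w: "word q ({#q, u, b#} + rep (p - 2) v)" using w p by simp
  have arcs_w: "arcs N" "b \<in> c \<odot> x \<Longrightarrow> cv b \<in> W N \<Longrightarrow> size N = p - 1 \<Longrightarrow> word b (add_mset b N)"
    if "word q ({#q, x#} + N)" for N c x
    using that wordD(2)[OF that] a r p by (auto simp: word_def circ_def W_unit_add p_def)
  \<comment> \<open>a pair of letters \<open>q\<close>, \<open>x\<close> has a constituent at distance \<open>(2, ty q - 2)\<close>, unless \<open>b\<close> completes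
    the other letters to a word\<close>
  have pair: "\<exists>c. c \<in> q \<odot> x \<and> cv c \<in> W N \<and> (two_way c 2 (p - 1) \<or> c = b \<and> word b (add_mset b N))"
    if N: "word q ({#q, x#} + N)" for x N
  proof -
    obtain c where "c \<in> W {#q, x#}" "cv c \<in> W N" using circ_split wordD(1)[OF N] by blast
    then have c: "c \<in> q \<odot> x" "cv c \<in> W N" by (auto simp: W_2)
    have "size N = p - 1" using wordD(5)[OF N] p by simp
    moreover have "two_way c 2 (p - 1) \<or> arc c \<and> Suc (ty c) = ty q" using word_pair(2)[OF N q(2) c] p by simp
    moreover have "c = b" if "arc c" "Suc (ty c) = ty q" using arc_unique[of c b] that a b by simp
    ultimately show ?thesis using c arcs_w(2)[OF N] by blast
  qed
  obtain g where g: "g \<in> q \<odot> b" "cv g \<in> W (add_mset u (rep (p - 2) v))" "two_way g 2 (p - 1)"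
    using pair[of b "add_mset u (rep (p - 2) v)"] w qb by (auto simp: add_mset_commute)
  show False
  proof (cases "u = v")
    case False
    have "word q ({#q, v#} + ({#u, b#} + rep (p - 3) v))" using w sp by (simp add: add_mset_commute)
    then obtain c where c: "c \<in> q \<odot> v" "two_way c 2 (p - 1) \<or> word b (add_mset b ({#u, b#} + rep (p - 3) v))"
      using pair by blast
    have "\<not> word b (add_mset b ({#u, b#} + rep (p - 3) v))"
    proof
      assume "word b (add_mset b ({#u, b#} + rep (p - 3) v))"
      then have "u \<in># {#b, b#} + rep (p - 2) v" using mw by (metis union_iff add_mset_add_single insert_iff set_mset_add_mset_insert)
      then show False using u False by (auto split: if_splits)
    qed
    then have cg: "g \<in> q \<odot> v" using c g(3) two_way_unique by blast
    have "arcs (add_mset u (rep (p - 2) v))" using u(1) a arcs_rep by simp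
    then have "circ ({#q, v#} + add_mset u (rep (p - 2) v))"
      using circI[of "{#q, v#}" "add_mset u (rep (p - 2) v)" g] cg g(2) q a by (simp add: W_2)
    then have "word q ({#q, v#} + add_mset u (rep (p - 2) v))" using wordI p by simp
    then have "word q ({#q, u#} + add_mset v (rep (p - 2) v))" by (simp add: add_mset_commute)
    then obtain d where d: "d \<in> q \<odot> u" "two_way d 2 (p - 1) \<or> word b (add_mset b (add_mset v (rep (p - 2) v)))"
      using pair by blast
    have "\<not> word b (add_mset b (add_mset v (rep (p - 2) v)))"
      using b(2)[of "add_mset b (add_mset v (rep (p - 2) v))"] a by auto
    then have dg: "g \<in> q \<odot> u" using d g(3) two_way_unique by blast
    have "u \<in> g \<odot> cv q" "b \<in> g \<odot> cv q" "v \<in> g \<odot> cv q" using dg g(1) cg rotate2 by blast+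
    then show False using prd_card u(2) a False by blast
  next
    case uv: True
    have "word q (add_mset q (add_mset b (rep (p - 1) v)))"
    proof -
      have "p - 1 = Suc (p - 2)" using p by simp
      then have "rep (p - 1) v = add_mset v (rep (p - 2) v)" by simp
      then show ?thesis using w uv by (simp add: add_mset_commute)
    qed
    then have "cv q \<in> W (add_mset b (rep (p - 1) v))" using wordD(3) W_unit_add by blast
    then obtain x where x: "x \<in> W (rep (p - 1) v)" "cv q \<in> b \<odot> x" by (auto simp: W_add)
    have ne: "cv q \<noteq> b" using len a p by (auto simp: arc_def)
    have "cv q \<in> b \<odot> \<epsilon> \<Longrightarrow> False" using unit_prd[OF r(2)] ne by (simp add: prd_commute)
    then have xe: "x \<noteq> \<epsilon>" using x by auto
    have vw: "\<epsilon> \<in> W (rep (p - 1) v)" using wordD(3)[OF pure_word[OF a(3)]] p by simp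
    have vnt: "\<not> thin v" using vw x xe W_tpow[of v "p - 1"] by auto
    have bnt: "\<not> thin b" using thin_square_thin a(4) vnt by blast
    have kbv: "h v = h b" if "kind1 b" using kind1_square_h[OF that a(4) vnt] .
    show False
    \<comment> \<open>For \<open>p = 3\<close> the arc \<open>v\<close> is symmetric; the estimates
      of distances in the other case need \<open>p \<ge> 4\<close>.\<close>
    proof (cases "p = 3")
      case False
      then have v3: "ty v \<ge> 3" "p \<ge> 4" using p by auto
      consider "kind1 v" | "kind2 v" using kinds r vnt by blast
      then show False
      proof cases
        case k: 1
        have hv: "thin (h v)" "cv (h v) = h v" "h v \<in> R" using kind1D[OF k] by auto
        have "x = h v" using x(1) xe pure_kind1_W[OF a(3) k] p by auto
        then have "cv q = h v \<bullet> b" using x(2) act_in[OF hv(1) r(2)] by (simp add: prd_commute)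
        then have "q = h v \<bullet> cv b" using cv_act[OF hv(1) r(2)] hv by (metis cv_cv)
        then obtain d where d: "d \<in> cv b \<odot> b" "g = h v \<bullet> d" using g(1) act_prd_in[of "h v" "cv b" g b] hv r by auto
        have "cv d = d" using sym_in_prd_cv[of d b] d by (simp add: prd_commute)
        then have "cv g = g" using d hv prd_carrier[OF d(1)] by simp
        then have "p - 1 = 2" using g(3) by (simp add: two_way_def)
        then show False using v3 by linarith
      next
        case k: 2
        have "\<not> kind1 b" using kbv kind1D[of b] kind2D[OF k] by auto
        then have kb: "kind2 b" using kinds r bnt by blast
        have tb: "thin (\<theta> b)" "\<theta> b \<in> b \<odot> b" using kind2_\<theta>[OF kb] by auto
        have tv: "\<theta> v = tpow (\<theta> b) 2" using kind2_\<theta>_unique[OF k _ thin_square_square[OF tb a(4)]] tb by simp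
        have "tpow (\<theta> v) (ty v) = \<epsilon>" using pure_kind2_order[OF a(3) k v3(1)] .
        then have o: "tpow (\<theta> b) (2 * (p - 1)) = \<epsilon>" using tv tpow_mult[OF tb(1)] p by simp
        have "x \<in> W (rep (2 * (p - 1)) b)" using W_rep_square[OF a(4) x(1)] .
        then have "cv q \<in> W (rep (Suc (2 * (p - 1))) b)" using x(2) by (auto simp: W_add)
        then have "tpow (\<theta> b) (Suc (2 * (p - 1))) \<in> cv q \<odot> cv q" by (rule thin_power_square[OF tb])
        then have "\<theta> b \<in> cv q \<odot> cv q" using o tb by simp
        then have "cv q \<in> \<theta> b \<odot> q" using rotate by fastforce
        then have "len (cv q) \<le> len (\<theta> b) + 1" using len_triangle q by (fastforce simp: arc_def)
        then show False using arc_square_len(2)[OF tb(2) a(1)] len v3 by simp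
      qed
    next
      case p3: True
      have vs: "cv v = v" using arc_sym_iff[OF a(2)] p p3 by simp
      have "x \<in> v \<odot> v" using x(1) p3 W_rep_2[of v] by simp
      then have "x = h v" using prd_cv[OF r(4) vnt] vs xe by auto
      then have cq: "cv q \<in> b \<odot> h v" using x by simp
      have "\<not> kind1 b"
      proof
        assume kb: "kind1 b"
        then have "cv q \<in> h b \<odot> b" using cq kbv by (simp add: prd_commute)
        then show False using act_in[of "h b" b "cv q"] kind1D[OF kb] kind1_act[OF kb] ne by simp
      qed
      then have kb: "kind2 b" using kinds r bnt by blast
      have tb: "thin (\<theta> b)" "\<theta> b \<in> b \<odot> b" using kind2_\<theta>[OF kb] by auto
      have "tpow (\<theta> b) 2 \<in> v \<odot> v" using thin_square_square[OF tb a(4)] .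
      then have "tpow (\<theta> b) 2 = \<epsilon> \<or> tpow (\<theta> b) 2 = h v" using prd_cv[OF r(4) vnt] vs by auto
      then show False
      proof
        assume o: "tpow (\<theta> b) 2 = \<epsilon>"
        then have cvt: "cv (\<theta> b) = \<theta> b" using cv_tpow_diff[of "\<theta> b" 2 1] tb by simp
        have l: "len (\<theta> b) \<le> 2" using arc_square_len[OF tb(2) a(1)] by simp
        have tR: "\<theta> b \<in> R" using thin_R tb by blast
        have "\<theta> b \<noteq> \<epsilon>" using tb(2) unit_in_prd arc_sym_iff[OF a(1)] p p3 p_def by auto
        then have "len (\<theta> b) \<noteq> 0" using len_0 tR by blast
        moreover have "len (\<theta> b) \<noteq> 1"
        proof
          assume "len (\<theta> b) = 1"
          then have "arc (\<theta> b)" using tR by (simp add: arc_def)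
          then have "\<theta> b = v" using cvt arc_sym_iff arc_unique[of "\<theta> b" v] a p p3 by simp
          then show False using vnt tb by simp
        qed
        ultimately have "two_way (\<theta> b) 2 2" using l tR cvt by (simp add: two_way_def)
        then have "g = \<theta> b" using g(3) p3 two_way_unique by simp
        then have "q \<in> \<theta> b \<odot> cv b" using g(1) rotate by blast
        then show False using \<theta>_prd_cv[OF kb] qv by simp
      next
        assume o: "tpow (\<theta> b) 2 = h v"
        then have hv: "thin (h v)" "cv (h v) = h v" using tb r vnt thin_tpow[of "\<theta> b" 2] by auto
        then have k: "kind1 v" using r vnt by (simp add: kind1_def)
        have "cv q = h v \<bullet> b" using cq act_in[OF hv(1) r(2)] by (simp add: prd_commute)
        then have "q = h v \<bullet> cv b" using cv_act[OF hv(1) r(2)] hv by (metis cv_cv)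
        also have "\<dots> = \<theta> b \<bullet> \<theta> b \<bullet> cv b" using o tb r by (simp add: tpow_2 act_act)
        also have "\<dots> = \<theta> b \<bullet> b" using kind2_eq_act_cv[OF kb] by simp
        finally have qt: "q = \<theta> b \<bullet> b" .
        have "\<theta> b \<bullet> v \<in> q \<odot> b" using act_prd_in[OF tb(1) r(2)] a(4) qt by blast
        then have "\<theta> b \<bullet> v \<in> b \<odot> q" by (simp add: prd_commute)
        then have "\<theta> b \<bullet> \<theta> b \<bullet> v \<in> q \<odot> q" using act_prd_in[OF tb(1) r(2), of _ q] qt by auto
        moreover have "\<theta> b \<bullet> \<theta> b \<bullet> v = h v \<bullet> v" using o tb r by (simp add: tpow_2 act_act)
        ultimately have "v \<in> q \<odot> q" using kind1_act[OF k] by simp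
        then have "ty q - 2 \<le> len (cv v)" using arc_square_len(1) q(1) by blast
        then show False using p p3 by (simp add: len_cv_arc)
      qed
    qed
  qed
qed

text \<open>\<open>b\<close> has type one less than \<open>q\<close>, and
  \<open>add_mset b N\<close> is a word of \<open>b\<close>. By the known shape of such words this
  is a configuration excluded by \<open>single_word_pure\<close> or
  \<open>single_word_mixed\<close>.\<close>

lemma single_word_no_arc:
  assumes q: "arc q" "ty q \<ge> 4" and S: "\<And>x. \<lbrakk>arc x; 3 \<le> ty x; ty x < ty q\<rbrakk> \<Longrightarrow> structured x"
    and w: "word q (add_mset q (add_mset u N))" "q \<notin># N" "u \<noteq> q"
    and b: "b \<in> q \<odot> u" "cv b \<in> W N" "arc b"
  shows False
proof -
  have w': "word q ({#q, u#} + N)" using w by simp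
  have ua: "arc u" and aN: "arcs N" using wordD(2)[OF w'] by auto
  have sN: "Suc (Suc (size N)) = ty q" using wordD(5)[OF w'] by simp
  have tb: "Suc (ty b) = ty q" using word_pair(2)[OF w' q(2) b(1,2)] b(3) by (auto simp: two_way_def arc_def)
  have wb: "word b (add_mset b N)" using b aN sN tb arc_R by (auto simp: word_def circ_def W_unit_add)
  have ub: "u \<noteq> b" using b(1) rotate[of b q b] sym_in_prd_cv[of q b] arc_sym_iff[OF q(1)] q by auto
  have ut: "ty u < ty b"
    using word_letter_less[OF w(1), of u] w(3) tb arc_unique[OF ua b(3)] ub by fastforce
  have iii: "\<lbrakk>arc x; arc y; ty x < ty y; ty y < ty q\<rbrakk> \<Longrightarrow> y \<notin> x \<odot> x" for x y
    using square_no_longer_arc[of "ty q - 1" x y] S by fastforce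
  have sb: "structured b" using S b tb q by simp
  then consider "pure b" | v where "mixed b v" by (auto simp: structured_def)
  then show False
  proof cases
    case 1
    have "add_mset b N = rep (ty b) b" using pureD[OF 1 wb] .
    moreover have "ty b = Suc (ty b - 1)" using arc_ty[OF b(3)] by simp
    ultimately have "N = rep (ty b - 1) b" by (metis add_mset_add_mset_same_iff replicate_mset_Suc)
    then show False
      using single_word_pure[OF q 1 tb ua ut _ b(1) _ _ iii] w w' S ut tb ua by fastforce
  next
    case (2 v)
    have "add_mset b N = {#b, b#} + rep (ty v - 1) v" using mixedD(7)[OF 2 wb] .
    then have "N = add_mset b (rep (ty v - 1) v)" by simp
    then have "word q ({#q, u, b#} + rep (ty v - 1) v)" using w' by (simp add: add_mset_commute)
    then show False using single_word_mixed[OF q 2 tb _ ua ub _ b(1)] sb w(3) by (auto simp: structured_def)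
  qed
qed

text \<open>Suppose \<open>q\<close> occurs once. For \<open>ty q = 3\<close> the two other letters
  are the same symmetric arc, which makes \<open>q\<close> symmetric. Otherwise no pair
  \<open>q\<close>, \<open>x\<close> has a shortcut, so all pairs share the relation at distances
  \<open>(2, ty q - 2)\<close>, and the letters besides \<open>q\<close> may be exchanged for each
  other until only copies of some \<open>u\<close> remain. By \<open>not_in_arc_power\<close> the
  shared relation is \<open>\<theta> u\<close>; but \<open>\<theta> u \<odot> cv u\<close> contains
  only \<open>u\<close>, not \<open>q\<close>.\<close>

lemma two_letters:
  assumes q: "arc q" "ty q \<ge> 3" and S: "\<And>x. \<lbrakk>arc x; 3 \<le> ty x; ty x < ty q\<rbrakk> \<Longrightarrow> structured x"
    and w: "word q M"
  shows "2 \<le> count M q"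
proof (rule ccontr)
  assume "\<not> 2 \<le> count M q"
  moreover have "count M q \<noteq> 0" using wordD(4)[OF w] by simp
  ultimately have c1: "count M q = 1" by linarith
  obtain N where N: "M = add_mset q N" using multi_member_split[OF wordD(4)[OF w]] by blast
  then have qN: "q \<notin># N" using c1 by (simp add: not_in_iff)
  have qns: "cv q \<noteq> q" using arc_sym_iff q by auto
  define sw where "sw = (\<lambda>N. word q (add_mset q N) \<and> q \<notin># N)"
  have swN: "sw N" using w N qN by (simp add: sw_def)
  have lt: "arc x \<and> ty x < ty q \<and> x \<noteq> q" if "sw N" "x \<in># N" for x N
    using that word_letter_less[of q "add_mset q N" x] wordD(2)[of q "add_mset q N"] by (auto simp: sw_def)
  have sz: "size N = ty q - 1" if "sw N" for N
    using that wordD(5)[of q "add_mset q N"] by (auto simp: sw_def)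
  show False
  proof (cases "ty q = 3")
    case True
    then have "size N = Suc 1" using sz[OF swN] by simp
    then obtain u N1 where "N = add_mset u N1" "size N1 = 1" using size_eq_Suc_imp_eq_union[of N 1] by auto
    then obtain v where uv: "N = {#u, v#}" by (metis size_1_singleton_mset)
    have "ty u = 2" "ty v = 2" "arc u" "arc v" using lt[OF swN, of u] lt[OF swN, of v] arc_ty[of u] arc_ty[of v] uv True by auto
    then have "v = cv u" using arc_unique[of u v] arc_sym_iff[of u] by simp
    moreover have "cv q \<in> u \<odot> v" using wordD(3)[OF w] N uv by (simp add: W_unit_add W_2)
    ultimately show False using sym_in_prd_cv[of "cv q" u] qns by simp
  next
    case False
    then have q4: "ty q \<ge> 4" using q by simp
    have pair: "two_way c 2 (ty q - 2)" if s: "sw (add_mset x N)" and c: "c \<in> q \<odot> x" "cv c \<in> W N" for x N c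
    proof -
      have w: "word q (add_mset q (add_mset x N))" "q \<notin># N" "x \<noteq> q" using s by (auto simp: sw_def)
      then show ?thesis using word_pair(2)[of q x N c] single_word_no_arc[OF q(1) q4 S w] q4 c by auto
    qed
    have ex: "\<exists>c. c \<in> q \<odot> x \<and> cv c \<in> W N" if "sw (add_mset x N)" for x N
      using that circ_split[of "{#q, x#}" N] wordD(1)[of q "{#q, x#} + N"] by (auto simp: sw_def W_2)
    obtain u where "u \<in># N" using sz[OF swN] q4 by (metis diff_is_0_eq multiset_nonemptyE not_numeral_le_zero numeral_le_one_iff order_trans semiring_norm(69) size_empty)
    then have N0: "sw N \<and> u \<in># N" using swN by blast
    have bd: "\<forall>N'. sw N' \<and> u \<in># N' \<longrightarrow> count N' u < Suc (ty q)"
    proof (intro allI impI)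
      fix N' assume "sw N' \<and> u \<in># N'"
      then show "count N' u < Suc (ty q)" using sz[of N'] count_le_size[of N' u] by simp
    qed
    \<comment> \<open>A word with as many letters \<open>u\<close> as possible: a different letter
      could still be exchanged for \<open>u\<close>.\<close>
    have "\<exists>N. (sw N \<and> u \<in># N) \<and> (\<forall>N'. sw N' \<and> u \<in># N' \<longrightarrow> count N' u \<le> count N u)"
      by (rule ex_has_greatest_nat[of "\<lambda>N. sw N \<and> u \<in># N" N "\<lambda>N. count N u" "Suc (ty q)", OF N0 bd])
    then obtain N where N: "sw N" "u \<in># N" and max: "\<And>N'. sw N' \<Longrightarrow> u \<in># N' \<Longrightarrow> count N' u \<le> count N u"
      by blast
    have "x = u" if x: "x \<in># N" for x
    proof (rule ccontr)
      assume xu: "x \<noteq> u"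
      obtain N1 where N1: "N = add_mset x N1" using multi_member_split[OF x] by blast
      then have "u \<in># N1" using N(2) xu by simp
      then obtain N2 where N2: "N1 = add_mset u N2" by (metis multi_member_split)
      have s1: "sw (add_mset x N1)" using N(1) N1 by simp
      then obtain c where c: "c \<in> q \<odot> x" "cv c \<in> W N1" using ex by blast
      have cg: "two_way c 2 (ty q - 2)" using pair[OF s1 c] .
      have s2: "sw (add_mset u (add_mset x N2))" using N N1 N2 by (simp add: add_mset_commute)
      then obtain d where d: "d \<in> q \<odot> u" "cv d \<in> W (add_mset x N2)" using ex by blast
      then have "d = c" using pair[OF s2 d] cg two_way_unique by blast
      then have cu: "c \<in> q \<odot> u" using d by simp
      have a: "arcs N1" "arc u" using lt[OF N(1)] N N1 by auto
      have "circ ({#q, u#} + N1)" using circI[of "{#q, u#}" N1 c] cu c a q by (simp add: W_2)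
      moreover have "size ({#q, u#} + N1) = ty q" using sz[OF N(1)] N1 q by simp
      ultimately have "word q (add_mset q (add_mset u N1))" by (simp add: word_def)
      moreover have "q \<notin># add_mset u N1" using N N1 lt[OF N(1) N(2)] by (auto simp: sw_def)
      ultimately have "sw (add_mset u N1)" by (simp add: sw_def)
      then have "count (add_mset u N1) u \<le> count N u" using max[of "add_mset u N1"] by simp
      then show False using N1 xu by simp
    qed
    then have Nu: "N = rep (ty q - 1) u" using sz[OF N(1)] by (metis set_mset_subset_singletonD subsetI singleton_iff)
    have u: "arc u" "ty u < ty q" "u \<noteq> q" using lt[OF N] by auto
    have "cv q \<in> W (rep (ty q - 1) u)" using N Nu wordD(3) W_unit_add unfolding sw_def by blast
    then have k: "kind2 u" "\<theta> u \<in> q \<odot> q" "len (cv (\<theta> u)) = ty q - 2"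
      using not_in_arc_power[OF q(1) q4 u(1,2)] S u by auto
    have t: "thin (\<theta> u)" "\<theta> u \<in> u \<odot> u" "\<theta> u \<in> R" using kind2_\<theta>[OF k(1)] thin_R by auto
    have l: "len (\<theta> u) \<le> 2" using arc_square_len[OF k(2) q(1)] by simp
    have "len (\<theta> u) \<noteq> 0" using len_0[OF t(3)] k(3) q4 by (intro notI) simp
    moreover have "len (\<theta> u) \<noteq> 1"
    proof
      assume "len (\<theta> u) = 1"
      then have "arc (\<theta> u)" "Suc (ty (\<theta> u)) = ty q" using t k q4 by (auto simp: arc_def ty_def)
      moreover have "ty (\<theta> u) \<noteq> ty u" using arc_unique[of "\<theta> u" u] calculation u kind2D[OF k(1)] t by auto
      ultimately show False
        using square_no_longer_arc[of "ty q - 1" u "\<theta> u"] S u t by fastforce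
    qed
    ultimately have two: "two_way (\<theta> u) 2 (ty q - 2)" using l k t by (simp add: two_way_def)
    obtain N' where N': "N = add_mset u N'" using multi_member_split[OF N(2)] by blast
    then have s': "sw (add_mset u N')" using N(1) by simp
    then obtain c where c: "c \<in> q \<odot> u" "cv c \<in> W N'" using ex by blast
    then have "c = \<theta> u" using pair[OF s' c] two two_way_unique by blast
    then have "q \<in> \<theta> u \<odot> cv u" using c rotate by blast
    then show False using \<theta>_prd_cv[OF k(1)] u by simp
  qed
qed

section \<open>Exchanging letters in words with at least two letters \<open>q\<close>\<close>

lemma rep_pred: "1 \<le> n \<Longrightarrow> rep n x = add_mset x (rep (n - 1) x)"
  by (cases n) auto

lemma rep_eqI: "\<forall>x \<in># M. x = a \<Longrightarrow> M = rep (size M) a"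
  by (induct M) auto

text \<open>Unlike in \<open>word_pair\<close>, the letter \<open>q\<close> lies on both sides of
  the cut, so both distances are forced.\<close>

lemma word_pair_exact:
  assumes "word q ({#q, x#} + N)" "q \<in># N" "c \<in> q \<odot> x" "cv c \<in> W N"
  shows "two_way c 2 (ty q - 2)"
proof -
  have "size N = ty q - 2" using wordD(5)[OF assms(1)] by simp
  then show ?thesis
    using word_len[OF assms(1), of c] word_len_cv[OF assms(1), of c] assms prd_carrier[OF assms(3)]
    by (simp add: two_way_def W_2)
qed

lemma word_pair_ex: "word q ({#q, x#} + N) \<Longrightarrow> \<exists>c. c \<in> q \<odot> x \<and> cv c \<in> W N"
  using circ_split[of "{#q, x#}" N] wordD(1)[of q "{#q, x#} + N"] by (auto simp: W_2)

lemma word_exchange: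
  assumes "word q ({#q, x#} + N)" "c \<in> q \<odot> y" "cv c \<in> W N" "arc y" shows "word q ({#q, y#} + N)"
proof -
  have "circ ({#q, y#} + N)"
    using circI[of "{#q, y#}" N c] assms wordD(2)[OF assms(1)] by (simp add: W_2)
  then show ?thesis using wordD(5)[OF assms(1)] by (simp add: word_def)
qed

text \<open>Every pair \<open>q\<close>, \<open>x\<close> spans the same relation \<open>g\<close>
  as the pair \<open>q\<close>, \<open>q\<close>, so foreign letters can be replaced by
  \<open>q\<close> one at a time; the last one is kept.\<close>

lemma exchange_to_last:
  assumes q: "arc q" and g: "g \<in> q \<odot> q" "two_way g 2 (ty q - 2)"
  shows "\<lbrakk>word q M; 2 \<le> count M q; x \<in># M; x \<noteq> q\<rbrakk> \<Longrightarrow> \<exists>x. x \<noteq> q \<and> word q ({#q, x#} + rep (ty q - 2) q)"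
proof (induct "size M - count M q" arbitrary: M x rule: less_induct)
  case less
  obtain M1 where M1: "M = add_mset x M1" using multi_member_split less by metis
  then have "2 \<le> count M1 q" using less by simp
  then obtain N where N: "M1 = add_mset q N" using multi_member_split[of q M1] by (metis count_inI not_numeral_le_zero)
  then have cN: "1 \<le> count N q" using \<open>2 \<le> count M1 q\<close> by simp
  have w: "word q ({#q, x#} + N)" using less(2) M1 N by (simp add: add_mset_commute)
  obtain c where c: "c \<in> q \<odot> x" "cv c \<in> W N" using word_pair_ex[OF w] by blast
  have qN: "q \<in># N" using cN by (metis count_greater_eq_one_iff)
  have "two_way c 2 (ty q - 2)" using word_pair_exact[OF w qN c] .
  then have cg: "c = g" using g two_way_unique by blast
  show ?case
  proof (cases "\<forall>y \<in># N. y = q")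
    case True
    moreover have "size N = ty q - 2" using wordD(5)[OF w] by simp
    ultimately have "N = rep (ty q - 2) q" using rep_eqI[of N q] by simp
    then show ?thesis using w less(5) by blast
  next
    case False
    then obtain y where y: "y \<in># N" "y \<noteq> q" by blast
    have w2: "word q ({#q, q#} + N)" using word_exchange[OF w, of c q] c cg g q by simp
    have "count N q < size N"
    proof -
      obtain N2 where "N = add_mset y N2" using y multi_member_split by metis
      then show ?thesis using y count_le_size[of N2 q] by simp
    qed
    then have "size ({#q, q#} + N) - count ({#q, q#} + N) q < size M - count M q"
      using M1 N less(5) by simp
    then show ?thesis using less(1)[of "{#q, q#} + N" y] w2 y by simp
  qed
qed

text \<open>With one foreign letter \<open>x\<close> left, \<open>g\<close> lies in both
  \<open>q \<odot> q\<close> and \<open>q \<odot> x\<close>. This forces the second kind and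
  \<open>g = \<rho> q\<close>; then a word through \<open>\<theta> q\<close> is found as well, so
  \<open>\<theta> q\<close> and \<open>\<rho> q\<close> would share their two distances.\<close>

lemma square_no_long_two_way:
  assumes q: "arc q" "ty q \<ge> 4" and w: "word q M" "2 \<le> count M q" "x \<in># M" "x \<noteq> q"
    and g: "g \<in> q \<odot> q" "two_way g 2 (ty q - 2)"
  shows False
proof -
  obtain x where x: "x \<noteq> q" "word q ({#q, x#} + rep (ty q - 2) q)" using exchange_to_last[OF q(1) g w] by blast
  have ax: "arc x" using wordD(2)[OF x(2)] by simp
  have r: "q \<in> R" "x \<in> R" "g \<in> R" using ax q arc_R g by (auto simp: two_way_def)
  obtain c where c: "c \<in> q \<odot> x" "cv c \<in> W (rep (ty q - 2) q)" using word_pair_ex[OF x(2)] by blast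
  have "two_way c 2 (ty q - 2)" using word_pair_exact[OF x(2) _ c] q by simp
  then have "c = g" using g two_way_unique by blast
  then have gx: "g \<in> q \<odot> x" "cv g \<in> W (rep (ty q - 2) q)" using c by auto
  have nt: "\<not> thin q" using thin_prd_single[of x] act_eqI[of q] gx g x r act_inj[of q q x] by metis
  have "x \<in> cv q \<odot> g" using gx(1) rotate2[of g q x] by (simp add: prd_commute)
  then obtain y where y: "y \<in> cv q \<odot> q" "x \<in> y \<odot> q" using prd_assoc g(1) by blast
  then have "y = h q" using prd_cv[OF r(1) nt] unit_prd[OF r(1)] x(1) by (auto simp: prd_commute)
  then have xh: "x \<in> h q \<odot> q" using y by simp
  have "\<not> kind1 q" using xh act_in[of "h q" q x] kind1D[of q] kind1_act[of q] x(1) by auto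
  then have k: "kind2 q" using kinds r nt by blast
  have th: "thin (\<theta> q)" "\<theta> q \<in> q \<odot> q" using kind2_\<theta>[OF k] by auto
  have "x \<in> g \<odot> cv q" using gx(1) rotate2 by blast
  then have "g \<noteq> \<theta> q" using \<theta>_prd_cv[OF k] x(1) by auto
  then have g\<rho>: "g = \<rho> q" using kind2_square[OF k] g by auto
  have "ty q - 2 = Suc (ty q - 3)" using q by simp
  then obtain f where f: "f \<in> W (rep (ty q - 3) q)" "cv g \<in> q \<odot> f" using gx(2) by (auto simp: W_add)
  have fR: "f \<in> R" using f prd_carrier by blast
  have "f \<in> cv q \<odot> cv g" using f(2) rotate2[of "cv g" q f] by (simp add: prd_commute)
  then have "f \<in> (cv (\<theta> q) \<bullet> q) \<odot> cv g" using kind2_cv[OF k] by simp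
  then have d: "\<theta> q \<bullet> f \<in> q \<odot> cv g" using act_prd_iff[of "cv (\<theta> q)" q f "cv g"] th r by simp
  have "cv (\<theta> q \<bullet> f) \<in> g \<odot> cv q" using prd_converse[OF d] by (simp add: prd_commute)
  moreover have "q \<in> g \<odot> cv q" using \<rho>_prd_cv[OF k] g\<rho> h_prd[OF r(1) nt] by simp
  \<comment> \<open>\<open>g \<odot> cv q\<close> has no constituents besides \<open>q\<close> and
    \<open>x\<close>, so this converse is an arc.\<close>
  ultimately have dx: "cv (\<theta> q \<bullet> f) = q \<or> cv (\<theta> q \<bullet> f) = x"
    using prd_card[OF _ \<open>q \<in> g \<odot> cv q\<close> \<open>x \<in> g \<odot> cv q\<close>] x(1) by metis
  define d where "d = cv (\<theta> q \<bullet> f)"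
  have "\<theta> q \<bullet> f \<in> f \<odot> \<theta> q" using act_prd[OF th(1) fR] by (simp add: prd_commute)
  then have "\<theta> q \<in> (\<theta> q \<bullet> f) \<odot> cv f" using rotate2 by blast
  then have "cv (\<theta> q) \<in> d \<odot> f" using prd_converse[of "\<theta> q" "\<theta> q \<bullet> f" "cv f"] d_def by simp
  then have ct: "cv (\<theta> q) \<in> W (add_mset d (rep (ty q - 3) q))" using f by (auto simp: W_add)
  have ad: "arcs (add_mset d (rep (ty q - 3) q))" using dx d_def q ax by auto
  have "circ ({#q, q#} + add_mset d (rep (ty q - 3) q))"
    using circI[of "{#q, q#}" _ "\<theta> q", OF _ ad _ ct] q th by (simp add: W_2)
  then have w: "word q ({#q, q#} + add_mset d (rep (ty q - 3) q))" using wordI q by simp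
  have "two_way (\<theta> q) 2 (ty q - 2)" using word_pair_exact[OF w _ th(2) ct] q by simp
  then show False using g g\<rho> two_way_unique kind2_\<rho>[OF k] by blast
qed

text \<open>Only one letter is left beside \<open>q\<close>, \<open>q\<close>. If it can be the
  symmetric arc \<open>b\<close>, it cannot also be \<open>q\<close>: otherwise
  \<open>q \<odot> q\<close> consists of \<open>cv q\<close> and \<open>b = \<theta> q\<close>,
  where \<open>b\<close> is an involution and its third power is \<open>\<epsilon>\<close>.\<close>

lemma structured_3:
  assumes q: "arc q" "ty q = 3" and two: "\<And>M. word q M \<Longrightarrow> 2 \<le> count M q"
  shows "structured q"
proof -
  have r: "q \<in> R" using q arc_R by blast
  have form: "\<exists>x. M = {#q, q, x#} \<and> (x = q \<or> arc x \<and> ty x = 2) \<and> cv x \<in> q \<odot> q" if w: "word q M" for M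
  proof -
    obtain M2 where M2: "M = {#q, q#} + M2" using count_ge_2_split[OF two[OF w]] by blast
    then have "size M2 = 1" using wordD(5)[OF w] q by simp
    then obtain x where "M2 = {#x#}" by (metis size_1_singleton_mset)
    then have x: "M = {#q, q, x#}" using M2 by simp
    then have w': "word q ({#q, q#} + {#x#})" using w by (simp add: add_mset_commute)
    have ax: "arc x" using wordD(2)[OF w'] by simp
    have "x = q \<or> ty x = 2" using word_letter_less[OF w', of x] q arc_ty[OF ax] by fastforce
    moreover obtain c where "c \<in> q \<odot> q" "cv c \<in> W {#x#}" using word_pair_ex[OF w'] by blast
    moreover have "cv c = x" using calculation W_1D by blast
    ultimately show ?thesis using x ax by (metis cv_cv)
  qed
  show ?thesis
  proof (cases "pure q")
    case False
    then obtain M where M: "word q M" "M \<noteq> rep 3 q" using q by (auto simp: pure_def)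
    then obtain b where b: "M = {#q, q, b#}" "arc b" "ty b = 2" "cv b \<in> q \<odot> q"
      using form[OF M(1)] by (auto simp: numeral_3_eq_3)
    have bs: "cv b = b" using arc_sym_iff b by simp
    have bq: "b \<in> q \<odot> q" using b bs by simp
    have "cv q \<notin> q \<odot> q"
    proof
      assume cq: "cv q \<in> q \<odot> q"
      have cb: "cv q \<noteq> b" using b bs q by (metis cv_cv numeral_eq_iff semiring_norm(88))
      have nt: "\<not> thin q" using thin_prd_single cq bq cb by blast
      have "\<not> kind1 q" using kind1_prd[of q q "cv q"] cq bq cb nt by auto
      then have k: "kind2 q" using kinds r nt by blast
      have th: "thin (\<theta> q)" "\<theta> q \<in> q \<odot> q" using kind2_\<theta>[OF k] by auto
      have "cv q \<noteq> \<theta> q" using th nt thin_cv by metis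
      then have bt: "b = \<theta> q" using kind2_square[OF k] cq bq cb by auto
      have "\<epsilon> \<in> W (rep 3 q)" using cq r by (auto simp: numeral_3_eq_3 W_unit_add W_2)
      then have "tpow (\<theta> q) 3 = \<epsilon>" using thin_power_square[OF th, of \<epsilon> 3] unit_prd[of \<epsilon>] unit_carrier by simp
      moreover have "\<theta> q \<bullet> \<theta> q = \<epsilon>" using sym_thin_square[OF th(1)] bs bt by simp
      ultimately have "\<theta> q = \<epsilon>" using th by (simp add: numeral_3_eq_3)
      then show False using bt b arc_neq_unit by simp
    qed
    then have nc: "x \<noteq> q" if "cv x \<in> q \<odot> q" for x using that by blast
    have "M' = {#q, q#} + rep (ty b - 1) b" if w: "word q M'" for M'
    proof -
      obtain x where x: "M' = {#q, q, x#}" "x = q \<or> arc x \<and> ty x = 2" "cv x \<in> q \<odot> q" using form[OF w] by blast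
      then have "arc x" "ty x = ty b" using nc b by auto
      then have "x = b" using arc_unique b by blast
      then show ?thesis using x(1) b by (simp add: add_mset_commute)
    qed
    then have "mixed q b" using q b bq ty_2_pure by (simp add: mixed_def)
    then show ?thesis using two by (auto simp: structured_def)
  qed (use two in \<open>auto simp: structured_def\<close>)
qed

text \<open>For \<open>q\<close> not pure and \<open>ty q \<ge> 4\<close>,
  \<open>square_no_long_two_way\<close> leaves an arc \<open>b\<close> as the relation spanned by
  \<open>q\<close>, \<open>q\<close> in each word, and the remaining letters complete
  \<open>b\<close> to a word of \<open>b\<close>. If \<open>b\<close> were mixed over
  \<open>v\<close>, its letter in the word of \<open>q\<close> could be exchanged for
  \<open>v\<close>, and this would leave a word of \<open>b\<close> with a single
  \<open>b\<close>.\<close>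

lemma structured_step:
  assumes q: "arc q" "ty q \<ge> 3" and S: "\<And>x. \<lbrakk>arc x; 3 \<le> ty x; ty x < ty q\<rbrakk> \<Longrightarrow> structured x"
  shows "structured q"
proof (cases "ty q = 3")
  case True
  then show ?thesis using structured_3[OF q(1)] two_letters[of q] q S by blast
next
  case False
  then have q4: "ty q \<ge> 4" using q by simp
  have two: "2 \<le> count M q" if "word q M" for M using two_letters[of q M] that q S by blast
  show ?thesis
  proof (cases "pure q")
    case False
    then obtain M0 where M0: "word q M0" "M0 \<noteq> rep (ty q) q" using q by (auto simp: pure_def)
    then obtain x0 where x0: "x0 \<in># M0" "x0 \<noteq> q" using rep_eqI[of M0 q] wordD(5)[OF M0(1)] by auto
    have no_two_way: False if "g \<in> q \<odot> q" "two_way g 2 (ty q - 2)" for g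
      using square_no_long_two_way[OF q(1) q4 M0(1) two[OF M0(1)] x0 that] .
    have form: "\<exists>b N. arc b \<and> Suc (ty b) = ty q \<and> b \<in> q \<odot> q \<and> M = {#q, q#} + N \<and> word b (add_mset b N)"
      if w: "word q M" for M
    proof -
      obtain N where N: "M = {#q, q#} + N" using count_ge_2_split[OF two[OF w]] by blast
      obtain c where c: "c \<in> q \<odot> q" "cv c \<in> W N" using word_pair_ex w N by blast
      then have "arc c" "Suc (ty c) = ty q" using word_pair(2)[of q q N c] w N q4 no_two_way by auto
      moreover have "word c (add_mset c N)"
        using calculation c wordD[OF w] N arc_R by (auto simp: word_def circ_def W_unit_add)
      ultimately show ?thesis using c N by blast
    qed
    obtain b N0 where b: "arc b" "Suc (ty b) = ty q" "b \<in> q \<odot> q" using form[OF M0(1)] by blast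
    have form: "\<exists>N. M = {#q, q#} + N \<and> word b (add_mset b N)" if "word q M" for M
      using form[OF that] b arc_unique by fastforce
    have sb: "structured b" using S b q4 by simp
    have "pure b"
    proof (rule ccontr)
      assume "\<not> pure b"
      then obtain v where m: "mixed b v" using sb by (auto simp: structured_def)
      define n where "n = ty v - 1"
      have v: "arc v" "v \<noteq> b" "ty v \<ge> 2" using mixedD[OF m] arc_ty[of v] by auto
      have n: "n \<ge> 1" "ty v = Suc n" using v by (auto simp: n_def)
      obtain N where N: "M0 = {#q, q#} + N" "word b (add_mset b N)" using form[OF M0(1)] by blast
      then have "N = add_mset b (rep n v)" using mixedD(7)[OF m N(2)] n_def by simp
      then have w: "word q ({#q, b#} + add_mset q (rep n v))" using M0(1) N by (simp add: add_mset_commute)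
      then have w': "word q ({#q, v#} + ({#q, b#} + rep (n - 1) v))" using rep_pred[OF n(1), of v] by (simp add: add_mset_commute)
      obtain c where c: "c \<in> q \<odot> b" "cv c \<in> W (add_mset q (rep n v))" using word_pair_ex[OF w] by blast
      obtain d where d: "d \<in> q \<odot> v" "cv d \<in> W ({#q, b#} + rep (n - 1) v)" using word_pair_ex[OF w'] by blast
      have "c = d" using word_pair_exact[OF w _ c] word_pair_exact[OF w' _ d] two_way_unique by simp
      then have "word q ({#q, v#} + add_mset q (rep n v))" using word_exchange[OF w, of c v] c d v by simp
      then have "word q ({#q, q#} + rep (Suc n) v)" by (simp add: add_mset_commute)
      then have "word b (add_mset b (rep (Suc n) v))" using form by fastforce
      then show False using sb v by (fastforce simp: structured_def)
    qed
    moreover have "M = {#q, q#} + rep (ty b - 1) b" if w: "word q M" for M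
    proof -
      obtain N where N: "M = {#q, q#} + N" "word b (add_mset b N)" using form[OF w] by blast
      then have "add_mset b N = rep (ty b) b" using pureD[OF \<open>pure b\<close>] by blast
      then show ?thesis using N(1) rep_pred[of "ty b" b] arc_ty[OF b(1)] by simp
    qed
    ultimately have "mixed q b" using q b by (simp add: mixed_def)
    then show ?thesis using two by (auto simp: structured_def)
  qed (use two in \<open>auto simp: structured_def\<close>)
qed

theorem structured: "\<lbrakk>arc q; ty q \<ge> 3\<rbrakk> \<Longrightarrow> structured q"
proof (induct "ty q" arbitrary: q rule: less_induct)
  case less
  then show ?case using structured_step by blast
qed

theorem square_no_larger_arc: "\<lbrakk>arc a; arc t; ty a < ty t\<rbrakk> \<Longrightarrow> t \<notin> a \<odot> a"
  using square_no_longer_arc[of "ty t" a t] structured by blast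

subsection \<open>Products of two arcs\<close>

lemma mixed_kind2:
  assumes m: "mixed q b" "kind2 q" "\<not> thin b" "ty b \<ge> 3"
  shows "kind2 b" "\<theta> b = tpow (\<theta> q) 2"
proof -
  have th: "thin (\<theta> q)" "\<theta> q \<in> q \<odot> q" using kind2_\<theta>[OF m(2)] by auto
  have t2: "thin (tpow (\<theta> q) 2)" "tpow (\<theta> q) 2 \<in> b \<odot> b"
    using thin_square_square[OF th mixedD(5)[OF m(1)]] th by auto
  show "kind2 b" using pure_not_thin_square[OF mixedD(2)[OF m(1)] m(3,4) t2] .
  then show "\<theta> b = tpow (\<theta> q) 2" using kind2_\<theta>_unique t2 by simp
qed

text \<open>Bounds the order of \<open>t\<close> by means of \<open>s\<close>. For the second kind
  \<open>tpow t 2\<close> is the fourth power of \<open>\<theta> s\<close>, whose order divides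
  \<open>ty s\<close> or \<open>ty v\<close>. For the first kind \<open>t\<close> lies in the fourth
  power of the pure arc \<open>s\<close>, and such a power contains thin relations only when it
  closes up.\<close>

lemma thin_powers_in_square:
  assumes s: "arc s" "ty s \<ge> 3" and y: "y \<in> s \<odot> s" "\<not> thin y" "\<not> arc y" and t: "thin t" "t \<in> y \<odot> y"
  shows "tpow t 2 = \<epsilon> \<or> pure s \<and> \<not> thin s \<and> tpow t (2 * ty s) = \<epsilon>
    \<or> (\<exists>v. mixed s v \<and> thin v \<and> tpow t (2 * ty v) = \<epsilon>)"
proof -
  have sR: "s \<in> R" using s arc_R by blast
  have nt: "\<not> thin s" using thin_square_thin y by blast
  have st: "pure s \<or> (\<exists>v. mixed s v)" using structured[OF s] by (simp add: structured_def)
  consider "kind1 s" | "kind2 s" using kinds sR nt by blast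
  then show ?thesis
  proof cases
    case k: 1
    have hs: "thin (h s)" "h s \<bullet> h s = \<epsilon>" using kind1D[OF k] kind1_h_square[OF k] by auto
    have ss: "s \<odot> s = {y}" using kind1_prd[OF k k refl y(1,2)] .
    have "pure s" using st mixedD(3,5) ss y(3) by (metis singletonD)
    have "y \<in> W (rep 2 s)" using y(1) by (simp add: W_rep_2)
    moreover have "W (rep 4 s) = W (rep 2 s + rep 2 s)" using rep_add[of 2 2 s] by (metis numeral_Bit0)
    ultimately have t4: "t \<in> W (rep 4 s)" using t(2) W_union by blast
    consider "ty s = 3" | "ty s = 4" | "ty s \<ge> 5" using s by linarith
    then show ?thesis
    proof cases
      case 1
      have "t \<in> W (add_mset s (rep 3 s))" using t4 rep_pred[of 4 s] by simp
      then obtain x where x: "x \<in> W (rep 3 s)" "t \<in> s \<odot> x" unfolding W_add by blast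
      then have "x = \<epsilon> \<or> x = h s" using pure_kind1_W[OF \<open>pure s\<close> k] 1 by simp
      moreover have "t \<in> x \<odot> s" using x(2) prd_commute by blast
      ultimately have "t = s"
        using unit_prd[OF sR] act_in[OF hs(1) sR, of t] kind1_act[OF k] by auto
      then show ?thesis using nt t by simp
    next
      case 2
      then have "t = \<epsilon> \<or> t = h s" using pure_kind1_W[OF \<open>pure s\<close> k] t4 by simp
      then have "tpow t 2 = \<epsilon>" using hs tpow_2 t by (metis act_unit thin_unit)
      then show ?thesis by blast
    next
      case 3
      then obtain c where "W (rep 4 s) = {c}" "\<not> thin c" using pure_kind1_single[OF \<open>pure s\<close> k, of 4] by auto
      then show ?thesis using t4 t by auto
    qed
  next
    case k: 2
    have th: "thin (\<theta> s)" "\<theta> s \<in> s \<odot> s" using kind2_\<theta>[OF k] by auto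
    have y\<rho>: "s \<odot> s = {\<theta> s, y}" using kind2_square[OF k] y(1,2) th by auto
    have t2: "tpow (\<theta> s) 2 \<in> y \<odot> y" using thin_square_square[OF th y(1)] .
    have "t = tpow (\<theta> s) 2 \<or> kind1 y \<and> t = tpow (\<theta> s) 2 \<bullet> h y"
      using thin_square_unique[OF _ t2 t] th by simp
    then have tt: "tpow t 2 = tpow (\<theta> s) 4"
    proof
      assume "t = tpow (\<theta> s) 2"
      then show ?thesis using tpow_mult[OF th(1), of 2 2] by simp
    next
      assume *: "kind1 y \<and> t = tpow (\<theta> s) 2 \<bullet> h y"
      then have "thin (h y)" "tpow (h y) 2 = \<epsilon>" using kind1D kind1_h_square tpow_2 by auto
      then have "tpow t 2 = tpow (tpow (\<theta> s) 2) 2" using * tpow_act[of "tpow (\<theta> s) 2" "h y" 2] th by simp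
      then show ?thesis using tpow_mult[OF th(1), of 2 2] by simp
    qed
    have pw: "tpow t (2 * n) = \<epsilon>" if "tpow (\<theta> s) n = \<epsilon>" for n
    proof -
      have "tpow t (2 * n) = tpow (\<theta> s) (4 * n)"
        using tpow_mult[OF t(1), of 2 n] tpow_mult[OF th(1), of 4 n] tt by simp
      then show ?thesis using tpow_dvd[OF th(1) that, of "4 * n"] by simp
    qed
    from st show ?thesis
    proof
      assume "pure s"
      then show ?thesis using pw[OF pure_kind2_order[OF _ k s(2)]] nt by blast
    next
      assume "\<exists>v. mixed s v"
      then obtain v where m: "mixed s v" by blast
      then have v: "v = \<theta> s" using y\<rho> mixedD(3,5)[OF m] y(3) by auto
      have "tpow v (ty v) = \<epsilon>" using pure_thin_order[OF mixedD(2)[OF m]] v th by simp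
      then show ?thesis using pw v m th by auto
    qed
  qed
qed

text \<open>For the first kind \<open>s = h q \<bullet> t\<close>, which would put \<open>q\<close>
  into \<open>t \<odot> t\<close>. For the second kind both \<open>s \<odot> s\<close> and
  \<open>t \<odot> t\<close> meet \<open>h q \<odot> q\<close> outside \<open>q\<close>, and there
  is at most one such class.\<close>

lemma arc_prd_configuration:
  assumes q: "arc q" "q \<in> s \<odot> t" and st: "arc s" "arc t" "s \<noteq> t" "ty t < ty q" "ty s < ty q"
    and n: "n \<in> q \<odot> s" "n \<in> q \<odot> t" and z: "z \<in> q \<odot> q" "z \<in> n \<odot> s" "z \<in> n \<odot> t"
  obtains y where "kind2 q" "y \<in> h q \<odot> q" "y \<in> s \<odot> s" "y \<in> t \<odot> t" "y \<noteq> q" "y \<in> z \<odot> cv q" "z \<in> y \<odot> q"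
proof -
  have r: "q \<in> R" "s \<in> R" "t \<in> R" using q st arc_R by auto
  have nq: "q \<notin> s \<odot> s" "q \<notin> t \<odot> t" using square_no_larger_arc st q by auto
  have nt: "\<not> thin q" using n act_eqI[of q n] act_inj[of q s t] r st(3) by metis
  have "\<not> kind1 q"
  proof
    assume k: "kind1 q"
    have hq: "thin (h q)" "cv (h q) = h q" using kind1D[OF k] by auto
    have "s \<in> cv q \<odot> n" using n(1) rotate2[of n q s] by (simp add: prd_commute)
    then obtain y where y: "y \<in> cv q \<odot> q" "s \<in> y \<odot> t" using n(2) prd_assoc by blast
    then have "y = \<epsilon> \<or> y = h q" using prd_cv[OF r(1) nt] by (auto simp: prd_commute)
    then have "s = h q \<bullet> t" using y unit_prd[OF r(3)] st(3) act_in[OF hq(1) r(3)] by auto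
    then obtain d where d: "d \<in> t \<odot> t" "q = h q \<bullet> d" using q(2) act_prd_in[OF hq(1) r(3)] by blast
    then have "q = d" using act_eq_iff[of "h q" q d] hq prd_carrier[OF d(1)] r kind1_act[OF k] by simp
    then show False using d nq by simp
  qed
  then have k: "kind2 q" using kinds r nt by blast
  obtain y where y: "y \<in> s \<odot> s" "y \<in> h q \<odot> q" "z \<in> y \<odot> q" "y \<in> z \<odot> cv q"
    using neighbour_square[OF z(2) n(1) z(1) k] .
  obtain y' where y': "y' \<in> t \<odot> t" "y' \<in> h q \<odot> q" using neighbour_square[OF z(3) n(2) z(1) k] by blast
  have "y \<noteq> q" "y' \<noteq> q" using y y' nq by auto
  then have "y' = y" using prd_card[OF y(2) y'(2) h_prd[OF r(1) nt]] by blast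
  then show thesis using that k y y' \<open>y \<noteq> q\<close> by blast
qed

lemma arc_prd_steps:
  assumes q: "q \<in> s \<odot> t" and z: "z \<in> q \<odot> q" and N: "cv z \<in> W N"
  obtains n where "n \<in> q \<odot> t" "z \<in> n \<odot> s" "cv n \<in> W (add_mset s N)"
proof -
  have "q \<in> t \<odot> s" using q by (simp add: prd_commute)
  then obtain n where n: "n \<in> q \<odot> t" "z \<in> n \<odot> s" using prd_assoc z by blast
  have "cv n \<in> s \<odot> cv z" using n(2) rotate[of "cv z" "cv n" "cv s"] converse by (simp add: prd_commute)
  then show thesis using that[OF n] N by (auto simp: W_add)
qed

text \<open>A way back from \<open>n\<close> of length at most \<open>ty q - 2\<close> would
  complete \<open>q\<close>, \<open>t\<close> to a word by \<open>word_complete\<close>, which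
  \<open>no\<close> excludes.\<close>

lemma arc_prd_two_way:
  assumes q: "arc q" "arc t" "t \<noteq> q" and n: "n \<in> q \<odot> t" "cv n \<in> W (add_mset s N)"
    and N: "arcs (add_mset s N)" "size N = ty q - 2" "ty q \<ge> 4"
    and no: "\<And>M. cv n \<in> W M \<Longrightarrow> \<not> word q (add_mset q (add_mset t M))"
  shows "two_way n 2 (ty q - 1) \<or> n = q"
proof -
  have nR: "n \<in> R" using n prd_carrier by blast
  have l2: "len n \<le> 2" using len_triangle[OF n(1)] q by (simp add: arc_def)
  have up: "len (cv n) \<le> ty q - 1" using len_W[OF n(2) N(1)] N by simp
  have "\<not> len (cv n) + 2 \<le> ty q" using word_complete[OF n(1) q(1,2)] no by blast
  then have lc: "len (cv n) = ty q - 1" using up by linarith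
  have "len n \<noteq> 0" using len_0[OF nR] lc N(3) by (intro notI) simp
  then consider "len n = 1" | "len n = 2" using l2 by linarith
  then show ?thesis
  proof cases
    case 1
    then have "arc n" "ty n = ty q" using nR lc N(3) by (auto simp: arc_def ty_def)
    then show ?thesis using arc_unique q by blast
  qed (use nR lc in \<open>simp add: two_way_def\<close>)
qed

text \<open>Factoring \<open>z\<close> through \<open>s \<odot> t\<close> in both orders gives
  \<open>n \<in> q \<odot> t\<close> and \<open>m \<in> q \<odot> s\<close>. If
  \<open>m = q\<close>, then \<open>s = h q\<close>, and \<open>z \<in> t \<odot> q\<close> gives a
  foreign letter in a word of \<open>q\<close>. Otherwise \<open>m = n\<close> and both
  \<open>s\<close> and \<open>t\<close> have the class \<open>y\<close> in their squares; the order
  of \<open>\<theta> q\<close> is \<open>ty q\<close>, which ties the types of both \<open>s\<close>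
  and \<open>t\<close> to half of \<open>ty q\<close>.\<close>

lemma arc_prd_pure:
  assumes q: "pure q" "q \<in> s \<odot> t" and st: "arc s" "arc t" "ty s < ty t" "ty t < ty q"
  shows False
proof -
  have aq: "arc q" using pure_arc q by blast
  have s2: "ty s \<ge> 2" "ty t \<ge> 3" "ty q \<ge> 4" using arc_ty[OF st(1)] st by auto
  have ne: "s \<noteq> t" "s \<noteq> q" "t \<noteq> q" using st by auto
  have r: "q \<in> R" "s \<in> R" "t \<in> R" using aq st arc_R by auto
  obtain z where z: "z \<in> q \<odot> q" "cv z \<in> W (rep (ty q - 2) q)" using pure_square_len[OF q(1)] s2 by auto
  have zt: "two_way z 2 (ty q - 2)" using pure_two_way[of q 2 "ty q - 2" z] q z s2 by (simp add: W_rep_2)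
  have nw: "\<not> word q (add_mset q (add_mset x M))" if "x \<noteq> q" for x M
    using pure_letter[OF q(1), of "add_mset q (add_mset x M)" x] that by auto
  have al: "arcs (add_mset x (rep (ty q - 2) q))" if "arc x" for x using that aq arcs_rep by simp
  obtain n where n: "n \<in> q \<odot> t" "z \<in> n \<odot> s" "cv n \<in> W (add_mset s (rep (ty q - 2) q))"
    using arc_prd_steps[OF q(2) z] .
  have "q \<in> t \<odot> s" using q(2) by (simp add: prd_commute)
  then obtain m where m: "m \<in> q \<odot> s" "z \<in> m \<odot> t" "cv m \<in> W (add_mset t (rep (ty q - 2) q))"
    using arc_prd_steps[OF _ z] by metis
  have n2: "two_way n 2 (ty q - 1) \<or> n = q"
    using arc_prd_two_way[OF aq st(2) ne(3) n(1,3) al[OF st(1)]] s2 nw[OF ne(3)] by simp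
  have "n \<noteq> q" using n(1) no_arc_in_arc_prd[OF aq st(2)] s2 by auto
  then have n2: "two_way n 2 (ty q - 1)" using n2 by simp
  have m2: "two_way m 2 (ty q - 1) \<or> m = q"
    using arc_prd_two_way[OF aq st(1) ne(2) m(1,3) al[OF st(2)]] s2 nw[OF ne(2)] by simp
  have zx: False if "arc x" "z \<in> x \<odot> q" "x \<noteq> q" for x
  proof -
    have "len (cv z) + 2 \<le> ty q" using zt s2 by (simp add: two_way_def)
    moreover have "z \<in> q \<odot> x" using that(2) by (simp add: prd_commute)
    ultimately show False using word_complete[of z q x] that(1) aq nw[OF that(3)] by blast
  qed
  show False
  proof (cases "m = q")
    case True
    have sh: "s \<in> q \<odot> cv q" using m(1) True rotate2 by blast
    then have sh': "s = h q" "\<not> thin q" using h_eqI[OF r(1) sh] arc_neq_unit[OF st(1)] by auto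
    have "t \<in> q \<odot> cv s" using q(2) rotate2 by blast
    moreover have "cv s = s" using sym_in_prd_cv[OF sh] .
    ultimately have th: "t \<in> h q \<odot> q" using sh' by (simp add: prd_commute)
    have "\<not> kind1 q" using th act_in[of "h q" q t] kind1D[of q] kind1_act[of q] ne by auto
    then have k: "kind2 q" using kinds r sh' by blast
    have "cv (\<rho> q) \<in> W (rep (ty q - 2) q)" using pure_kind2_\<rho>[OF q(1) k] s2 by simp
    then have "z = \<rho> q"
      using pure_kind2_two_way[OF q(1) k] s2 zt two_way_unique by simp
    then have "t \<in> z \<odot> cv q" using \<rho>_prd_cv[OF k] th by simp
    then have "z \<in> t \<odot> q" using rotate by simp
    then show False using zx st(2) ne(3) by blast
  next
    case False
    then have "m = n" using m2 n2 two_way_unique by blast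
    then obtain y where k: "kind2 q" and y: "y \<in> h q \<odot> q" "y \<in> s \<odot> s" "y \<in> t \<odot> t" "y \<noteq> q" "y \<in> z \<odot> cv q" "z \<in> y \<odot> q"
      using arc_prd_configuration[OF aq q(2) st(1,2) ne(1) st(4) _ _ n(1) z(1) n(2)] m st by auto
    have th: "thin (\<theta> q)" "\<theta> q \<in> q \<odot> q" using kind2_\<theta>[OF k] by auto
    have ty: "\<theta> q \<in> y \<odot> y" using thin_square_cube[OF th z(1) y(5)] .
    have ord: "tpow (\<theta> q) k = \<epsilon> \<Longrightarrow> k \<ge> 1 \<Longrightarrow> ty q \<le> k" for k
      using pure_kind2_order_ge[OF q(1) k] s2 by simp
    have dv: "ty q dvd k" if "tpow (\<theta> q) k = \<epsilon>" for k
      using tpow_order_dvd[OF th(1) _ _ ord that] pure_kind2_order[OF q(1) k] s2 by simp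
    have ynt: "\<not> thin y" using pure_kind2_no_thin_neighbour[OF q(1) k s2(3) y(1)] by blast
    have yna: "\<not> arc y" using zx y by blast
    have o2: "tpow (\<theta> q) 2 \<noteq> \<epsilon>" using ord[of 2] s2 by auto
    show False
    proof (cases "ty s = 2")
      case True
      then have "cv s = s" using arc_sym_iff st by blast
      then have "cv y = y" using y(2) sym_in_prd_cv[of y s] by simp
      then have "cv (\<theta> q) = \<theta> q" using ty sym_in_prd_cv[of "\<theta> q" y] by simp
      then show False using sym_thin_square[OF th(1)] o2 tpow_2[OF th(1)] by simp
    next
      case False
      then have s3: "ty s \<ge> 3" using s2 by simp
      have half: "2 * k = ty q" if "tpow (\<theta> q) (2 * k) = \<epsilon>" "k < ty q" "k \<ge> 1" for k
        using dvd_double_eq[OF dv[OF that(1)] that(2,3)] .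
      have half_ty: "pure x \<and> \<not> thin x \<and> 2 * ty x = ty q \<or> (\<exists>v. mixed x v \<and> thin v \<and> 2 * ty v = ty q)"
        if x: "arc x" "ty x \<ge> 3" "ty x < ty q" "y \<in> x \<odot> x" for x
      proof -
        have "2 * ty v = ty q" if "mixed x v" "tpow (\<theta> q) (2 * ty v) = \<epsilon>" for v
          using half[OF that(2)] mixedD(4)[OF that(1)] x(3) arc_ty[OF mixedD(3)[OF that(1)]] by linarith
        moreover have "2 * ty x = ty q" if "tpow (\<theta> q) (2 * ty x) = \<epsilon>" using half[OF that] x by linarith
        ultimately show ?thesis
          using thin_powers_in_square[OF x(1,2,4) ynt yna th(1) ty] o2 by blast
      qed
      have S: "pure s \<and> \<not> thin s \<and> 2 * ty s = ty q \<or> (\<exists>v. mixed s v \<and> thin v \<and> 2 * ty v = ty q)"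
        using half_ty[OF st(1) s3 less_trans[OF st(3,4)] y(2)] .
      have T: "pure t \<and> \<not> thin t \<and> 2 * ty t = ty q \<or> (\<exists>v. mixed t v \<and> thin v \<and> 2 * ty v = ty q)"
        using half_ty[OF st(2) s2(2) st(4) y(3)] .
      \<comment> \<open>As \<open>ty s < ty t\<close>, half of \<open>ty q\<close> is the type of
        \<open>s\<close> and of the arc \<open>v\<close> over which \<open>t\<close> is mixed. Hence
        \<open>v = s\<close>, but only \<open>v\<close> is thin.\<close>
      from T obtain v where v: "mixed t v" "thin v" "2 * ty v = ty q" using S st(3) mixedD(4) by fastforce
      have "pure s \<and> \<not> thin s \<and> 2 * ty s = ty q" using S v st(3) mixedD(4)[OF v(1)] mixedD(4) by fastforce
      moreover have "v = s" using arc_unique[of v s] calculation v mixedD(3)[OF v(1)] st(1) by simp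
      ultimately show False using v by simp
    qed
  qed
qed

text \<open>If \<open>t = b\<close>, distances force \<open>ty q = 4\<close> and a symmetric
  \<open>s\<close>, and then \<open>b\<close> would be symmetric as well. If
  \<open>t \<noteq> b\<close>, then \<open>b\<close> takes the place of \<open>z\<close> in the pure
  case, and the order of \<open>\<theta> b = tpow (\<theta> q) 2\<close> exceeds what
  \<open>ty s < ty b\<close> permits.\<close>

lemma arc_prd_mixed:
  assumes q: "mixed q b" "q \<in> s \<odot> t" and st: "arc s" "arc t" "ty s < ty t" "ty t < ty q"
  shows False
proof -
  have aq: "arc q" and b: "pure b" "arc b" "Suc (ty b) = ty q" "b \<in> q \<odot> q" using mixedD[OF q(1)] by auto
  have s2: "ty s \<ge> 2" "ty t \<ge> 3" "ty q \<ge> 4" "ty b \<ge> 3" using arc_ty[OF st(1)] st b by auto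
  have ne: "s \<noteq> t" "s \<noteq> q" "t \<noteq> q" "s \<noteq> b" using st b by auto
  have r: "q \<in> R" "s \<in> R" "t \<in> R" "b \<in> R" using aq st b arc_R by auto
  show False
  proof (cases "t = b")
    case True
    have "s \<in> q \<odot> cv b" using q(2) True rotate by blast
    moreover have "cv q \<in> q \<odot> cv b" using b(4) rotate[of b q q] rotate2[of "cv q" q "cv b"] rotate[of b "cv q" "cv q"] converse2
      by (metis cv_cv prd_commute rotate2)
    moreover have "s \<noteq> cv q" using st(1) len_cv_arc[of q] s2 by (auto simp: arc_def)
    ultimately have two: "s \<in> q \<odot> cv b" "cv q \<in> q \<odot> cv b" "s \<noteq> cv q" by auto
    have nt: "\<not> thin q" "\<not> thin b" using thin_prd_single[of q s "cv b" "cv q"] thin_prd_single[of "cv b" s q "cv q"] two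
      by (auto simp: prd_commute)
    have "\<not> kind1 q"
    proof
      assume k: "kind1 q"
      have hb: "h b = h q" using kind1_square_h[OF k b(4) nt(2)] .
      then have "kind1 (cv b)" using kind1D[OF k] r nt by (simp add: kind1_def)
      then have "q \<odot> cv b = {cv q}" using kind1_prd[OF k _ _ two(2)] hb r nt by simp
      then show False using two by auto
    qed
    then have k: "kind2 q" using kinds r nt by blast
    have th: "thin (\<theta> q)" "\<theta> q \<in> q \<odot> q" using kind2_\<theta>[OF k] by auto
    have "cv s \<in> b \<odot> cv q" using prd_converse[OF two(1)] by (simp add: prd_commute)
    then have "\<theta> q \<in> cv s \<odot> cv s" using thin_square_cube[OF th b(4)] by blast
    then have ts: "cv (\<theta> q) \<in> s \<odot> s" using converse2 by blast
    then have "len (cv (\<theta> q)) \<le> 2" using arc_square_len st by blast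
    moreover have "ty q - 2 \<le> len (cv (\<theta> q))" using arc_square_len[OF th(2) aq] by simp
    ultimately have "ty q = 4" using s2 by simp
    then have "ty s = 2" using st True b s2 by simp
    then have "cv s = s" using arc_sym_iff st by blast
    then have "cv (\<theta> q) = \<theta> q" using ts sym_in_prd_cv[of "cv (\<theta> q)" s] by simp
    then have "tpow (\<theta> q) 2 = \<epsilon>" using sym_thin_square[OF th(1)] tpow_2[OF th(1)] by simp
    then have "\<epsilon> \<in> b \<odot> b" using thin_square_square[OF th b(4)] by simp
    then have "cv b = b" using unit_in_prd by simp
    then show False using arc_sym_iff[OF b(2)] s2 by simp
  next
    case tb: False
    then have tyt: "ty t < ty b" using st b arc_unique[of t b] by fastforce
    have "ty s \<noteq> 2"
    proof
      assume "ty s = 2"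
      moreover have "len (cv q) \<le> len (cv s) + len (cv t)" using len_triangle_cv(1)[OF q(2)] .
      ultimately show False using tyt b by (simp add: ty_def)
    qed
    then have s3: "ty s \<ge> 3" using s2 by simp
    have b4: "ty b \<ge> 4" using s3 st tyt by simp
    have N: "cv b \<in> W (rep (ty b - 1) b)" using pure_cv[OF b(1)] .
    have nw: "\<not> word q (add_mset q (add_mset x M))" if "x \<noteq> q" "x \<noteq> b" for x M
    proof
      assume "word q (add_mset q (add_mset x M))"
      then have "add_mset q (add_mset x M) = {#q, q#} + rep (ty b - 1) b" using mixedD(7)[OF q(1)] by blast
      then have "x \<in># {#q, q#} + rep (ty b - 1) b" by (metis union_single_eq_member add_mset_commute)
      then show False using that by (auto split: if_splits)
    qed
    have al: "arcs (add_mset x (rep (ty b - 1) b))" if "arc x" for x using that b arcs_rep by simp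
    obtain n where n: "n \<in> q \<odot> t" "b \<in> n \<odot> s" "cv n \<in> W (add_mset s (rep (ty b - 1) b))"
      using arc_prd_steps[OF q(2) b(4) N] .
    have "q \<in> t \<odot> s" using q(2) by (simp add: prd_commute)
    then obtain m where m: "m \<in> q \<odot> s" "b \<in> m \<odot> t" "cv m \<in> W (add_mset t (rep (ty b - 1) b))"
      using arc_prd_steps[OF _ b(4) N] by metis
    have sz: "size (rep (ty b - 1) b) = ty q - 2" using b by simp
    have "two_way n 2 (ty q - 1) \<or> n = q"
      using arc_prd_two_way[OF aq st(2) ne(3) n(1,3) al[OF st(1)] sz s2(3)] nw[OF ne(3) tb] by blast
    moreover have "n \<noteq> q" using n(1) no_arc_in_arc_prd[OF aq st(2)] s2 by auto
    moreover have "two_way m 2 (ty q - 1) \<or> m = q"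
      using arc_prd_two_way[OF aq st(1) ne(2) m(1,3) al[OF st(2)] sz s2(3)] nw[OF ne(2,4)] by blast
    moreover have "m \<noteq> q" using m(1) no_arc_in_arc_prd[OF aq st(1)] s3 by auto
    ultimately have "m = n" using two_way_unique by blast
    then obtain y where k: "kind2 q" and y: "y \<in> h q \<odot> q" "y \<in> s \<odot> s" "y \<in> t \<odot> t" "y \<noteq> q" "y \<in> b \<odot> cv q" "b \<in> y \<odot> q"
      using arc_prd_configuration[OF aq q(2) st(1,2) ne(1) st(4) _ _ n(1) b(4) n(2)] m st by auto
    have th: "thin (\<theta> q)" "\<theta> q \<in> q \<odot> q" using kind2_\<theta>[OF k] by auto
    have qn: "\<not> thin q" "h q \<in> R" "cv (h q) = h q" "\<not> thin (h q)" using kind2D[OF k] by auto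
    have ty: "\<theta> q \<in> y \<odot> y" using thin_square_cube[OF th b(4) y(5)] .
    have yna: "\<not> arc y"
    proof
      assume "arc y"
      moreover have "len (cv b) + 2 \<le> ty q" using b by (simp add: ty_def)
      moreover have "b \<in> q \<odot> y" using y(6) by (simp add: prd_commute)
      ultimately obtain M where M: "word q (add_mset q (add_mset y M))" using word_complete aq by blast
      then have "y = b" using nw y(4) by blast
      then show False using y(2) square_no_larger_arc[OF st(1) b(2)] st tyt by simp
    qed
    have "b \<noteq> \<theta> q" using y(5) \<theta>_prd_cv[OF k] y(4) by auto
    then have b\<rho>: "b = \<rho> q" using kind2_square[OF k] b(4) by auto
    then have bnt: "\<not> thin b" using kind2_\<rho>[OF k] by simp
    have kb: "kind2 b" "\<theta> b = tpow (\<theta> q) 2" using mixed_kind2[OF q(1) k bnt s2(4)] by auto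
    have ord: "tpow (\<theta> q) (2 * k) = \<epsilon> \<Longrightarrow> k \<ge> 1 \<Longrightarrow> ty b \<le> k" for k
      using pure_kind2_order_ge[OF b(1) kb(1), of k] kb(2) tpow_mult[OF th(1), of 2 k] s2 by simp
    have ynt: "\<not> thin y"
    proof
      assume p: "thin y"
      have "q \<in> y \<odot> h q" using y(1) rotate2[of y "h q" q] qn by simp
      then have qp: "q = y \<bullet> h q" using act_in[OF p qn(2)] by simp
      have "y \<bullet> y \<in> q \<odot> q" using act_prd_in[OF p qn(2), of "y \<bullet> y" q] y(1) qp by auto
      then have "y \<bullet> y = \<theta> q" using kind2_\<theta>_unique[OF k _ ] p by simp
      then have be: "b = (y \<bullet> y) \<bullet> h q" using b\<rho> by (simp add: \<rho>_def)
      then have "h b = h (h q)" using h_act[of "y \<bullet> y" "h q"] p qn by simp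
      moreover have "h q \<odot> cv (h q) = q \<odot> cv q" using act_prd_cv[OF p qn(2)] qp by simp
      then have "h (h q) = h q" by (simp add: h_def)
      ultimately have hb: "h b = h q" by simp
      have "b \<in> (y \<bullet> y) \<odot> h q" using act_in[of "y \<bullet> y" "h q" b] p qn be by simp
      then have "y \<bullet> y \<in> h b \<odot> b" using rotate[of b "y \<bullet> y" "h q"] hb qn by (simp add: prd_commute)
      then show False using pure_kind2_no_thin_neighbour[OF b(1) kb(1) b4 _ thin_act[OF p p]] by blast
    qed
    have no: False if "tpow (\<theta> q) (2 * k) = \<epsilon>" "k \<ge> 1" "k < ty b" for k
      using ord[OF that(1,2)] that(3) by simp
    have "False" if "mixed s v" "tpow (\<theta> q) (2 * ty v) = \<epsilon>" for v
      using no[OF that(2)] mixedD(4)[OF that(1)] st(3) tyt s3 by linarith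
    moreover have "tpow (\<theta> q) 2 \<noteq> \<epsilon>" using no[of 1] b4 by auto
    moreover have "tpow (\<theta> q) (2 * ty s) \<noteq> \<epsilon>" using no[of "ty s"] s3 st(3) tyt by auto
    ultimately show False using thin_powers_in_square[OF st(1) s3 y(2) ynt yna th(1) ty] by blast
  qed
qed

theorem arc_prd_no_distinct:
  assumes "arc q" "arc s" "arc t" "q \<in> s \<odot> t" "ty s < ty t" "ty t < ty q" shows False
proof -
  have "ty q \<ge> 3" using assms arc_ty[OF assms(2)] by simp
  then have "pure q \<or> (\<exists>b. mixed q b)" using structured[OF assms(1)] by (simp add: structured_def)
  then show ?thesis using arc_prd_pure arc_prd_mixed assms by blast
qed

theorem arc_prd_distinct_types:
  assumes q: "arc q" "ty q \<ge> 3" and st: "arc s" "arc t" "ty s < ty t" "q \<in> s \<odot> t"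
  shows "ty s = 2 \<and> t = q"
proof -
  consider "ty t < ty q" | "ty t = ty q" | "ty t > ty q" by linarith
  then show ?thesis
  proof cases
    case 1
    then show ?thesis using arc_prd_no_distinct[OF q(1) st(1,2,4,3)] by simp
  next
    case 2
    then have "t = q" using arc_unique st q by simp
    moreover have "q \<notin> q \<odot> s" if "ty s \<noteq> 2" using no_arc_in_arc_prd[OF q(1) st(1) that] .
    ultimately show ?thesis using st(4) by (auto simp: prd_commute)
  next
    case 3
    have "len (cv t) \<le> len (cv q) + len s" using len_triangle_cv(3)[OF st(4)] .
    then have tt: "ty t = Suc (ty q)" using 3 st(1) by (simp add: arc_def ty_def)
    obtain N where N: "word q (add_mset q N)" using ex_word[OF q(1)] by blast
    then have cq: "cv q \<in> W N" using wordD(3) W_unit_add by blast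
    have lt: "ty x < ty t" if "x \<in># N" for x using word_letter_ty[OF N, of x] that tt by simp
    \<comment> \<open>One letter \<open>q\<close> of its word is replaced by \<open>s\<close>,
      \<open>t\<close>. The result is a word of \<open>t\<close> that contains \<open>t\<close> only
      once.\<close>
    have "circ ({#s, t#} + N)"
      using circI[of "{#s, t#}" N q] st cq wordD(2)[OF N] by (simp add: W_2)
    then have "word t ({#s, t#} + N)" using wordI[of "{#s, t#} + N" t] wordD(5)[OF N] tt by simp
    moreover have "structured t" using structured[OF st(2)] tt q by simp
    ultimately have "2 \<le> count ({#s, t#} + N) t" unfolding structured_def by blast
    moreover have "t \<notin># N" using lt by blast
    ultimately show ?thesis using st(3) by (auto simp: not_in_iff split: if_splits)
  qed
qed

section \<open>Arcs in the square of an arc and purity\<close>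

theorem square_arc_type:
  assumes q: "arc q" "ty q \<ge> 3" and t: "arc t" "t \<in> q \<odot> q" shows "Suc (ty t) = ty q"
proof -
  have "ty q - 2 \<le> len (cv t)" using arc_square_len[OF t(2) q(1)] by simp
  moreover have "\<not> ty q < ty t" using square_no_larger_arc q t by blast
  moreover have "ty t \<noteq> ty q"
    using arc_unique[of t q] no_arc_in_arc_prd[OF q(1,1)] q t by auto
  ultimately show ?thesis using q by (simp add: ty_def)
qed

text \<open>In a word of a pure \<open>q\<close>, replacing a pair \<open>q\<close>,
  \<open>q\<close> by the arc \<open>b\<close> gives a circuit that is too short but still contains
  \<open>q\<close>, as \<open>ty q \<ge> 3\<close>.\<close>

theorem square_arc_not_pure:
  assumes q: "arc q" "ty q \<ge> 3" and b: "arc b" "b \<in> q \<odot> q" shows "\<not> pure q"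
proof
  assume p: "pure q"
  have "Suc (ty b) = ty q" using square_arc_type[OF q b] .
  then have "len (cv b) + 2 \<le> ty q" by (simp add: ty_def)
  then obtain N where N: "cv b \<in> W N" "word q (add_mset q (add_mset q N))"
    using word_complete[OF b(2) q(1,1)] by blast
  then have Nq: "\<forall>x \<in># N. x = q" using pure_letter[OF p N(2)] by auto
  have "size N = ty q - 2" using wordD(5)[OF N(2)] by simp
  then have "q \<in># N" using Nq q(2) by (metis diff_is_0_eq multiset_nonemptyE not_less_eq_eq numeral_2_eq_2 numeral_3_eq_3 size_empty)
  moreover have "circ (add_mset b N)"
    using N b(1) wordD(2)[OF N(2)] arc_R by (simp add: circ_def W_unit_add)
  ultimately have "ty q \<le> Suc (size N)" using circ_size[of "add_mset b N" q] by simp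
  then show False using \<open>size N = ty q - 2\<close> q by simp
qed

theorem not_pure_iff:
  assumes q: "arc q" "ty q \<ge> 3"
  shows "\<not> pure q \<longleftrightarrow> (\<exists>b. arc b \<and> Suc (ty b) = ty q \<and> b \<in> q \<odot> q \<and> pure b)"
proof
  assume "\<not> pure q"
  then obtain b where "mixed q b" using structured[OF q] by (auto simp: structured_def)
  then show "\<exists>b. arc b \<and> Suc (ty b) = ty q \<and> b \<in> q \<odot> q \<and> pure b" using mixedD by blast
qed (use square_arc_not_pure[OF q] in blast)

end

section \<open>Two-way distances of a digraph\<close>

context weakly_distance_regular_digraph begin

abbreviation tw :: "'a \<Rightarrow> 'a \<Rightarrow> nat \<times> nat" where "tw \<equiv> two_way_distance G"

lemma swap_tw [simp]: "prod.swap (tw x y) = tw y x"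
  by (simp add: two_way_distance_def)

lemma fst_tw [simp]: "fst (tw x y) = distance G x y"
  by (simp add: two_way_distance_def)

lemma tw_in [simp]: "\<lbrakk>x \<in> verts G; y \<in> verts G\<rbrakk> \<Longrightarrow> tw x y \<in> two_way_distances G"
  by (auto simp: two_way_distances_def)

lemma twE: assumes "i \<in> two_way_distances G"
  obtains x y where "x \<in> verts G" "y \<in> verts G" "tw x y = i"
  using assms by (auto simp: two_way_distances_def)

lemma distance_le: "\<lbrakk>vwalk p G; hd p = x; last p = y\<rbrakk> \<Longrightarrow> distance G x y \<le> vwalk_length p"
  unfolding distance_def by (rule Least_le) blast

lemma distance_walk:
  assumes "x \<in> verts G" "y \<in> verts G"
  obtains p where "vwalk p G" "hd p = x" "last p = y" "vwalk_length p = distance G x y"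
proof -
  have "x \<rightarrow>\<^sup>*\<^bsub>G\<^esub> y" using assms strongly_connected by (auto simp: strongly_connected_def)
  then have "\<exists>n p. vwalk p G \<and> hd p = x \<and> last p = y \<and> vwalk_length p = n"
    by (auto simp: reachable_vwalk_conv)
  from LeastI_ex[OF this] show thesis using that unfolding distance_def by blast
qed

lemma distance_triangle:
  assumes "x \<in> verts G" "y \<in> verts G" "z \<in> verts G"
  shows "distance G x y \<le> distance G x z + distance G z y"
proof -
  obtain p where p: "vwalk p G" "hd p = x" "last p = z" "vwalk_length p = distance G x z"
    using distance_walk assms by blast
  obtain r where r: "vwalk r G" "hd r = z" "last r = y" "vwalk_length r = distance G z y"
    using distance_walk assms by blast
  have j: "joinable p r" using p r by (auto simp: vwalk_def)
  then have "vwalk_length (p \<oplus> r) = distance G x z + distance G z y"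
    using p r by (simp only: vwalk_join_vwalk_length)
  then show ?thesis
    using distance_le[OF vwalk_joinI_vwalk[OF p(1) r(1) j], of x y] p r
    by (simp add: vwalk_join_hd[OF j] vwalk_join_last[OF j])
qed

lemma distance_eq_0 [simp]: assumes "x \<in> verts G" "y \<in> verts G" shows "distance G x y = 0 \<longleftrightarrow> x = y"
proof
  assume *: "distance G x y = 0"
  obtain p where p: "vwalk p G" "hd p = x" "last p = y" "vwalk_length p = 0"
    using distance_walk assms * by metis
  then have "length p = 1" using vwalk_def[of p G] by (cases p) auto
  then show "x = y" using p by (auto simp: length_Suc_conv)
next
  assume "x = y"
  then have "distance G x y \<le> vwalk_length [x]" using assms by (intro distance_le) auto
  then show "distance G x y = 0" by simp
qed

lemma distance_Suc:
  assumes "x \<in> verts G" "y \<in> verts G" "distance G x y = Suc n"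
  obtains z where "(x, z) \<in> arcs_ends G" "z \<in> verts G" "distance G z y = n"
proof -
  obtain p where p: "vwalk p G" "hd p = x" "last p = y" "vwalk_length p = Suc n"
    using distance_walk assms by metis
  then obtain z r where r: "p = x # z # r"
    by (cases p; cases "tl p") auto
  then have zr: "(x, z) \<in> arcs_ends G" "vwalk (z # r) G" using p(1) by auto
  then have "z \<in> verts G" by (auto simp: vwalk_def)
  have "distance G z y \<le> n" using distance_le[OF zr(2), of z y] p r by simp
  moreover have "distance G x z \<le> 1" using distance_le[of "[x, z]" x z] zr assms \<open>z \<in> verts G\<close> by simp
  then have "Suc n \<le> 1 + distance G z y"
    using distance_triangle[of x y z] assms \<open>z \<in> verts G\<close> by simp
  ultimately show thesis using that zr \<open>z \<in> verts G\<close> by simp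
qed

lemma arcs_ends_verts: "(x, y) \<in> arcs_ends G \<Longrightarrow> x \<in> verts G \<and> y \<in> verts G"
  by (auto simp: arcs_ends_conv)

lemma distance_eq_1: "\<lbrakk>x \<in> verts G; y \<in> verts G\<rbrakk> \<Longrightarrow> distance G x y = Suc 0 \<longleftrightarrow> (x, y) \<in> arcs_ends G"
proof
  assume v: "x \<in> verts G" "y \<in> verts G" and "distance G x y = Suc 0"
  then obtain z where "(x, z) \<in> arcs_ends G" "z \<in> verts G" "distance G z y = 0"
    using distance_Suc by metis
  then show "(x, y) \<in> arcs_ends G" using v by simp
next
  assume v: "x \<in> verts G" "y \<in> verts G" and a: "(x, y) \<in> arcs_ends G"
  have "x \<noteq> y" using a no_loops by (auto simp: arcs_ends_conv)
  moreover have "distance G x y \<le> 1" using distance_le[of "[x, y]" x y] v a by simp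
  ultimately show "distance G x y = Suc 0" using v distance_eq_0[of x y] by linarith
qed

text \<open>Records only where intersection numbers are nonzero; see
  \<open>intersection_number_neq_0\<close>.\<close>

definition cprod :: "nat \<times> nat \<Rightarrow> nat \<times> nat \<Rightarrow> (nat \<times> nat) set" where
  "cprod i j = {tw x y | x y z. x \<in> verts G \<and> y \<in> verts G \<and> z \<in> verts G \<and> tw x z = i \<and> tw z y = j}"

lemma cprodI: "\<lbrakk>x \<in> verts G; y \<in> verts G; z \<in> verts G\<rbrakk> \<Longrightarrow> tw x y \<in> cprod (tw x z) (tw z y)"
  by (auto simp: cprod_def)

lemma cprodE: assumes "h \<in> cprod i j"
  obtains x y z where "x \<in> verts G" "y \<in> verts G" "z \<in> verts G" "tw x y = h" "tw x z = i" "tw z y = j"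
  using assms by (auto simp: cprod_def)

lemma cprod_in: "h \<in> cprod i j \<Longrightarrow> i \<in> two_way_distances G \<and> j \<in> two_way_distances G \<and> h \<in> two_way_distances G"
  by (auto simp: cprod_def two_way_distances_def)

lemma finite_intersection_set [simp]: "finite (intersection_set G i j x y)"
  by (simp add: intersection_set_def)

lemma intersection_number_neq_0:
  assumes "h \<in> two_way_distances G" "i \<in> two_way_distances G" "j \<in> two_way_distances G"
  shows "intersection_number G h i j \<noteq> 0 \<longleftrightarrow> h \<in> cprod i j"
proof
  assume n: "intersection_number G h i j \<noteq> 0"
  obtain x y where xy: "x \<in> verts G" "y \<in> verts G" "tw x y = h" using twE assms(1) by blast
  then have "card (intersection_set G i j x y) \<noteq> 0" using n intersection_number_eq[OF assms(2,3)] by force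
  then obtain z where "z \<in> intersection_set G i j x y" by fastforce
  then show "h \<in> cprod i j" using xy by (auto simp: cprod_def intersection_set_def)
next
  assume "h \<in> cprod i j"
  then obtain x y z where *: "x \<in> verts G" "y \<in> verts G" "z \<in> verts G" "tw x y = h" "tw x z = i" "tw z y = j"
    by (rule cprodE)
  then have "z \<in> intersection_set G i j x y" by (auto simp: intersection_set_def)
  then have "card (intersection_set G i j x y) \<noteq> 0" using card_eq_0_iff[of "intersection_set G i j x y"] by auto
  then show "intersection_number G h i j \<noteq> 0" using intersection_number_eq[OF assms(2,3)] * by metis
qed

text \<open>Regularity carries a triangle over one pair of vertices to every pair at the same
  two-way distance.\<close>

lemma cprod_realize:
  assumes "tw x y \<in> cprod i j" "x \<in> verts G" "y \<in> verts G"
  obtains z where "z \<in> verts G" "tw x z = i" "tw z y = j"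
proof -
  have R: "i \<in> two_way_distances G" "j \<in> two_way_distances G" using cprod_in assms by auto
  have "intersection_number G (tw x y) i j \<noteq> 0" using intersection_number_neq_0 R assms by simp
  then have "card (intersection_set G i j x y) \<noteq> 0" using intersection_number_eq R assms by metis
  then obtain z where "z \<in> intersection_set G i j x y" by fastforce
  then show thesis using that by (auto simp: intersection_set_def)
qed

section \<open>Successors and valencies\<close>

definition nbs :: "'a \<Rightarrow> nat \<times> nat \<Rightarrow> 'a set" where "nbs x i = {y \<in> verts G. tw x y = i}"

lemma finite_nbs [simp]: "finite (nbs x i)" by (simp add: nbs_def)

lemma card_nbs: "x \<in> verts G \<Longrightarrow> card (nbs x i) = subvalency G i"
  using subvalency_eq by (simp add: nbs_def)

lemma subvalency_pos: assumes "i \<in> two_way_distances G" shows "0 < subvalency G i"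
proof -
  obtain x y where "x \<in> verts G" "y \<in> verts G" "tw x y = i" using twE assms by blast
  then show ?thesis using card_nbs[of x i] card_gt_0_iff[of "nbs x i"] by (auto simp: nbs_def)
qed

lemma ex_nbs: assumes "i \<in> two_way_distances G" "x \<in> verts G" obtains y where "y \<in> verts G" "tw x y = i"
proof -
  have "nbs x i \<noteq> {}" using subvalency_pos[OF assms(1)] card_nbs[OF assms(2), of i] by auto
  then show thesis using that by (auto simp: nbs_def)
qed

lemma tw_eq_unit [simp]: "\<lbrakk>x \<in> verts G; y \<in> verts G\<rbrakk> \<Longrightarrow> tw x y = (0, 0) \<longleftrightarrow> x = y"
  by (auto simp: two_way_distance_def)

lemma tw_self [simp]: "x \<in> verts G \<Longrightarrow> tw x x = (0, 0)"
  by simp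

end

section \<open>Valencies at most two and the properties of the scheme\<close>

locale commutative_quasi_thin_digraph = weakly_distance_regular_digraph +
  assumes comm: "commutative_wdrd G" and quasi_thin: "quasi_thin G"
begin

lemma cprod_commute: "cprod i j = cprod j i"
proof -
  have "cprod i j \<subseteq> cprod j i" for i j
  proof
    fix h assume h: "h \<in> cprod i j"
    then have "h \<in> two_way_distances G" "i \<in> two_way_distances G" "j \<in> two_way_distances G" using cprod_in by auto
    then show "h \<in> cprod j i" using h comm intersection_number_neq_0 unfolding commutative_wdrd_def by metis
  qed
  then show ?thesis by blast
qed

text \<open>A valency is an intersection number with upper index \<open>(0, 0)\<close>.\<close>

lemma subvalency_le_2: assumes "i \<in> two_way_distances G" shows "subvalency G i \<le> 2"
proof -
  obtain x y where x: "x \<in> verts G" "y \<in> verts G" "tw x y = i" using twE assms by blast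
  then have R: "(0, 0) \<in> two_way_distances G" "prod.swap i \<in> two_way_distances G"
    using tw_in[of x x] tw_in[of y x] by (metis tw_eq_unit, metis swap_tw)
  have "nbs x i = intersection_set G i (prod.swap i) x x"
    by (auto simp: nbs_def intersection_set_def two_way_distance_def)
  then have e: "subvalency G i = intersection_number G (0, 0) i (prod.swap i)"
    using intersection_number_eq[OF assms R(2) x(1) x(1)] card_nbs[OF x(1), of i] x by simp
  let ?S = "{intersection_number G h i j | h i j.
      h \<in> two_way_distances G \<and> i \<in> two_way_distances G \<and> j \<in> two_way_distances G}"
  have "finite (two_way_distances G)"
  proof -
    have "two_way_distances G = (\<lambda>(x, y). tw x y) ` (verts G \<times> verts G)"
      by (auto simp: two_way_distances_def)
    then show ?thesis by simp
  qed
  moreover have "?S = (\<lambda>(h, i, j). intersection_number G h i j) `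
      (two_way_distances G \<times> two_way_distances G \<times> two_way_distances G)" by force
  ultimately have "finite ?S" by simp
  moreover have "subvalency G i \<in> ?S" using e R assms by blast
  ultimately show ?thesis using quasi_thin Max_ge[of ?S "subvalency G i"] by (simp add: quasi_thin_def)
qed

lemma cprod_swap_unit:
  assumes "i \<in> two_way_distances G" shows "cprod i (prod.swap i) = {(0, 0)} \<longleftrightarrow> subvalency G i = 1"
proof
  assume *: "cprod i (prod.swap i) = {(0, 0)}"
  obtain x y where x: "x \<in> verts G" "y \<in> verts G" "tw x y = i" using twE assms by blast
  have "z = y" if "z \<in> nbs x i" for z
  proof -
    have z: "z \<in> verts G" "tw x z = i" using that by (auto simp: nbs_def)
    have "tw z y \<in> cprod (tw z x) (tw x y)" using cprodI x z by blast
    also have "tw z x = prod.swap i" using z by (metis swap_tw)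
    finally have "tw z y = (0, 0)" using * x cprod_commute by auto
    then show ?thesis using x z by simp
  qed
  moreover have "y \<in> nbs x i" using x by (simp add: nbs_def)
  ultimately have "nbs x i = {y}" by blast
  then show "subvalency G i = 1" using card_nbs[OF x(1), of i] by simp
next
  assume *: "subvalency G i = 1"
  have "h = (0, 0)" if "h \<in> cprod i (prod.swap i)" for h
  proof -
    have "h \<in> cprod (prod.swap i) i" using that cprod_commute by blast
    then obtain x y z where *: "x \<in> verts G" "y \<in> verts G" "z \<in> verts G" "tw x y = h" "tw x z = prod.swap i" "tw z y = i"
      by (rule cprodE)
    then have "tw z x = i" by (metis swap_tw swap_swap)
    then have "x \<in> nbs z i" "y \<in> nbs z i" using * by (auto simp: nbs_def)
    moreover have "card (nbs z i) = 1" using card_nbs[of z i] * \<open>subvalency G i = 1\<close> by simp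
    ultimately have "x = y" by (metis card_1_singletonE singletonD)
    then show ?thesis using * by auto
  qed
  moreover have "(0, 0) \<in> cprod i (prod.swap i)"
  proof -
    obtain x y where x: "x \<in> verts G" "y \<in> verts G" "tw x y = i" using twE assms by blast
    then have "tw x x \<in> cprod i (prod.swap i)" using cprodI[of x x y] by (metis swap_tw)
    then show ?thesis using x by simp
  qed
  ultimately show "cprod i (prod.swap i) = {(0, 0)}" by blast
qed

lemma cprod_rotate: "c \<in> cprod a b \<Longrightarrow> a \<in> cprod c (prod.swap b)"
proof -
  assume "c \<in> cprod a b"
  then obtain x y z where "x \<in> verts G" "y \<in> verts G" "z \<in> verts G" "tw x y = c" "tw x z = a" "tw z y = b"
    by (rule cprodE)
  then show ?thesis using cprodI[of x z y] by (metis swap_tw)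
qed

text \<open>The pairs of arcs \<open>x \<rightarrow> z \<rightarrow> y\<close> of types \<open>a\<close>, \<open>b\<close>. There are at most four of them, and every
  constituent of \<open>cprod a b\<close> accounts for at least two unless \<open>a\<close> or \<open>b\<close> has valency one.\<close>

definition paths :: "'a \<Rightarrow> nat \<times> nat \<Rightarrow> nat \<times> nat \<Rightarrow> ('a \<times> 'a) set" where
  "paths x a b = Sigma (nbs x a) (\<lambda>z. nbs z b)"

lemma finite_paths [simp]: "finite (paths x a b)"
  by (simp add: paths_def)

lemma card_paths: assumes "x \<in> verts G" shows "card (paths x a b) = subvalency G a * subvalency G b"
proof -
  have "card (paths x a b) = (\<Sum>z \<in> nbs x a. card (nbs z b))" by (simp add: paths_def)
  also have "\<dots> = (\<Sum>z \<in> nbs x a. subvalency G b)"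
  proof (intro sum.cong refl)
    fix z assume "z \<in> nbs x a"
    then have "z \<in> verts G" by (simp add: nbs_def)
    then show "card (nbs z b) = subvalency G b" by (rule card_nbs)
  qed
  finally show ?thesis using card_nbs[OF assms] by simp
qed

definition paths_to :: "'a \<Rightarrow> nat \<times> nat \<Rightarrow> nat \<times> nat \<Rightarrow> nat \<times> nat \<Rightarrow> ('a \<times> 'a) set" where
  "paths_to x a b c = {(z, y) \<in> paths x a b. tw x y = c}"

lemma finite_paths_to [simp]: "finite (paths_to x a b c)"
  by (rule finite_subset[OF _ finite_paths[of x a b]]) (auto simp: paths_to_def)

text \<open>The projections to the last and to the middle vertex are onto the successors of type
  \<open>c\<close> and of type \<open>a\<close>.\<close>

lemma card_paths_to:
  assumes "c \<in> cprod a b" "x \<in> verts G" shows "subvalency G c \<le> card (paths_to x a b c)"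
    "subvalency G a \<le> card (paths_to x a b c)"
proof -
  have "nbs x c \<subseteq> snd ` paths_to x a b c"
  proof
    fix y assume "y \<in> nbs x c"
    then have y: "y \<in> verts G" "tw x y = c" by (auto simp: nbs_def)
    then obtain z where "z \<in> verts G" "tw x z = a" "tw z y = b" using cprod_realize assms by metis
    then have "(z, y) \<in> paths_to x a b c" using y by (auto simp: paths_to_def paths_def nbs_def)
    then show "y \<in> snd ` paths_to x a b c" by force
  qed
  then have "card (nbs x c) \<le> card (snd ` paths_to x a b c)" by (intro card_mono) auto
  also have "\<dots> \<le> card (paths_to x a b c)" by (intro card_image_le) auto
  finally show "subvalency G c \<le> card (paths_to x a b c)" using card_nbs assms by simp
  have "nbs x a \<subseteq> fst ` paths_to x a b c"
  proof
    fix z assume "z \<in> nbs x a"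
    then have z: "z \<in> verts G" "tw x z = a" by (auto simp: nbs_def)
    then obtain y where "y \<in> verts G" "tw x y = c" "tw y z = prod.swap b"
      using cprod_realize[of x z c "prod.swap b"] cprod_rotate[OF assms(1)] assms(2) by metis
    moreover then have "tw z y = b" by (metis swap_tw swap_swap)
    ultimately have "(z, y) \<in> paths_to x a b c" using z by (auto simp: paths_to_def paths_def nbs_def)
    then show "z \<in> fst ` paths_to x a b c" by force
  qed
  then have "card (nbs x a) \<le> card (fst ` paths_to x a b c)" by (intro card_mono) auto
  also have "\<dots> \<le> card (paths_to x a b c)" by (intro card_image_le) auto
  finally show "subvalency G a \<le> card (paths_to x a b c)" using card_nbs assms by simp
qed

lemma cprod_card:
  assumes c: "c \<in> cprod a b" "c' \<in> cprod a b" "c'' \<in> cprod a b"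
  shows "c = c' \<or> c = c'' \<or> c' = c''"
proof (rule ccontr)
  assume ne: "\<not> (c = c' \<or> c = c'' \<or> c' = c'')"
  have R: "a \<in> two_way_distances G" "b \<in> two_way_distances G" "c \<in> two_way_distances G"
    "c' \<in> two_way_distances G" "c'' \<in> two_way_distances G" using cprod_in c by auto
  obtain x where x: "x \<in> verts G" using twE R by blast
  have "card (paths_to x a b c \<union> (paths_to x a b c' \<union> paths_to x a b c''))
      = card (paths_to x a b c) + (card (paths_to x a b c') + card (paths_to x a b c''))"
  proof -
    have "paths_to x a b c \<inter> (paths_to x a b c' \<union> paths_to x a b c'') = {}" "paths_to x a b c' \<inter> paths_to x a b c'' = {}"
      using ne by (auto simp: paths_to_def)
    then show ?thesis by (simp add: card_Un_disjoint)
  qed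
  moreover have "card (paths_to x a b c \<union> (paths_to x a b c' \<union> paths_to x a b c'')) \<le> card (paths x a b)"
    by (intro card_mono) (auto simp: paths_to_def)
  ultimately have le: "card (paths_to x a b c) + (card (paths_to x a b c') + card (paths_to x a b c''))
      \<le> subvalency G a * subvalency G b" using card_paths[OF x] by simp
  have pos: "1 \<le> card (paths_to x a b c)" "1 \<le> card (paths_to x a b c')" "1 \<le> card (paths_to x a b c'')"
    using card_paths_to(1)[OF c(1) x] card_paths_to(1)[OF c(2) x] card_paths_to(1)[OF c(3) x]
      subvalency_pos R by (metis Suc_leI One_nat_def le_trans)+
  have ka: "subvalency G a = 1 \<or> subvalency G a = 2" "subvalency G b \<le> 2"
    using subvalency_pos[OF R(1)] subvalency_le_2[OF R(1)] subvalency_le_2[OF R(2)] by linarith+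
  from ka(1) show False
  proof
    assume "subvalency G a = 1" then show False using le pos ka by simp
  next
    assume a2: "subvalency G a = 2"
    then have "subvalency G a * subvalency G b \<le> 4" using ka by simp
    then show False using le card_paths_to(2)[OF c(1) x] card_paths_to(2)[OF c(2) x] card_paths_to(2)[OF c(3) x] a2
      by linarith
  qed
qed

text \<open>\<open>a \<in> cprod a h\<close> yields an \<open>a\<close>-successor \<open>w\<close>
  with \<open>tw w z' = h\<close>, different from \<open>z'\<close>; there are only two such
  successors, so \<open>w = z\<close>.\<close>

lemma nbs_connected:
  assumes h: "h \<in> cprod a (prod.swap a)" "h \<noteq> (0, 0)" and z: "z \<in> nbs x a" "z' \<in> nbs x a" "z \<noteq> z'" and x: "x \<in> verts G"
  shows "tw z z' = h"
proof -
  have "a \<in> cprod a h" using cprod_rotate[OF h(1)] cprod_commute[of h a] by simp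
  moreover have zv: "z \<in> verts G" "tw x z = a" "z' \<in> verts G" "tw x z' = a" using z by (auto simp: nbs_def)
  ultimately obtain w where w: "w \<in> verts G" "tw x w = a" "tw w z' = h" using cprod_realize[of x z' a h] x by metis
  have "w \<noteq> z'" using w h(2) zv by auto
  have "w \<in> nbs x a" using w by (auto simp: nbs_def)
  moreover have "card (nbs x a) \<le> 2" using subvalency_le_2 card_nbs[OF x, of a] tw_in[OF x zv(1)] zv by metis
  ultimately have "w = z"
  proof -
    have "card {w, z, z'} \<le> 2" using \<open>w \<in> nbs x a\<close> z \<open>card (nbs x a) \<le> 2\<close> card_mono[of "nbs x a" "{w, z, z'}"] by simp
    then show ?thesis using \<open>w \<noteq> z'\<close> z(3) by (auto simp: card_insert_if split: if_splits)
  qed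
  then show ?thesis using w by simp
qed

lemma subvalency_2:
  assumes "h \<in> cprod a (prod.swap a)" "h \<noteq> (0, 0)" shows "subvalency G a = 2"
proof -
  have R: "a \<in> two_way_distances G" using cprod_in assms by auto
  then have "subvalency G a \<noteq> 1" using cprod_swap_unit[OF R] assms by auto
  then show ?thesis using subvalency_pos[OF R] subvalency_le_2[OF R] by linarith
qed

text \<open>The two \<open>a\<close>-successors of \<open>x\<close> are related by the thin
  \<open>h\<close>, so what is of type \<open>b\<close> from one is of type \<open>b\<close> from
  the other. Hence every \<open>c\<close>-successor is reached through both, which uses up all four
  paths.\<close>

lemma cprod_single:
  assumes h: "h \<noteq> (0, 0)" "cprod h (prod.swap h) = {(0, 0)}" "h \<in> cprod a (prod.swap a)" "h \<in> cprod b (prod.swap b)"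
    and c: "c \<in> cprod a b" "cprod c (prod.swap c) \<noteq> {(0, 0)}"
  shows "cprod a b = {c}"
proof -
  have R: "a \<in> two_way_distances G" "b \<in> two_way_distances G" "c \<in> two_way_distances G" "h \<in> two_way_distances G"
    using cprod_in c h by auto
  have k: "subvalency G h = 1" "subvalency G a = 2" "subvalency G b = 2"
    using cprod_swap_unit[OF R(4)] h subvalency_2 by auto
  have kc: "subvalency G c = 2"
    using cprod_swap_unit[OF R(3)] c(2) subvalency_pos[OF R(3)] subvalency_le_2[OF R(3)] by linarith
  have "c' = c" if c': "c' \<in> cprod a b" for c'
  proof (rule ccontr)
    assume ne: "c' \<noteq> c"
    obtain x where x: "x \<in> verts G" using twE R by blast
    have "nbs x a \<times> nbs x c \<subseteq> paths_to x a b c"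
    proof clarify
      fix z y assume z: "z \<in> nbs x a" and y: "y \<in> nbs x c"
      then have v: "z \<in> verts G" "y \<in> verts G" "tw x z = a" "tw x y = c" by (auto simp: nbs_def)
      obtain w where w: "w \<in> verts G" "tw x w = a" "tw w y = b" using cprod_realize[of x y a b] c v x by metis
      have "tw z y = b"
      proof (cases "w = z")
        case False
        have wz: "tw w z = h" using nbs_connected[OF h(3,1) _ z False x] w by (auto simp: nbs_def)
        have "b \<in> cprod h b" using cprod_rotate[OF h(4)] by simp
        then obtain u where u: "u \<in> verts G" "tw w u = h" "tw u y = b" using cprod_realize[of w y h b] w v by metis
        have "card (nbs w h) = 1" using card_nbs w k by simp
        moreover have "u \<in> nbs w h" "z \<in> nbs w h" using u wz v by (auto simp: nbs_def)
        ultimately have "u = z" by (metis card_1_singletonE singletonD)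
        then show ?thesis using u by simp
      qed (use w in simp)
      then show "(z, y) \<in> paths_to x a b c" using z v by (auto simp: paths_to_def paths_def nbs_def)
    qed
    then have "card (nbs x a \<times> nbs x c) \<le> card (paths_to x a b c)" by (intro card_mono) auto
    then have "4 \<le> card (paths_to x a b c)" using card_nbs[OF x] k kc by (simp add: card_cartesian_product)
    moreover have "2 \<le> card (paths_to x a b c')" using card_paths_to(2)[OF c' x] k by simp
    moreover have "card (paths_to x a b c \<union> paths_to x a b c') = card (paths_to x a b c) + card (paths_to x a b c')"
    proof -
      have "paths_to x a b c \<inter> paths_to x a b c' = {}" using ne by (auto simp: paths_to_def)
      then show ?thesis by (simp add: card_Un_disjoint)
    qed
    moreover have "card (paths_to x a b c \<union> paths_to x a b c') \<le> card (paths x a b)"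
      by (intro card_mono) (auto simp: paths_to_def)
    ultimately show False using card_paths[OF x, of a b] k by simp
  qed
  then show ?thesis using c by blast
qed

text \<open>Let \<open>y\<close> be a common \<open>a\<close>-successor of the
  \<open>a\<close>-successors \<open>z\<close>, \<open>z'\<close> of \<open>x\<close>. If
  \<open>c = tw x y\<close> had valency two, \<open>z\<close> and \<open>z'\<close> would have the
  same \<open>a\<close>-successors, and by regularity so would \<open>z\<close> and each vertex of
  type \<open>h\<close> from it. A further vertex \<open>u\<close> of this kind would be a third
  \<open>a\<close>-predecessor of \<open>y\<close>, so \<open>h\<close> would have valency
  one.\<close>

lemma cprod_square_thin:
  assumes h: "h \<in> cprod a (prod.swap a)" "cprod h (prod.swap h) \<noteq> {(0, 0)}"
  shows "\<exists>t \<in> cprod a a. cprod t (prod.swap t) = {(0, 0)}"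
proof -
  have R: "a \<in> two_way_distances G" "h \<in> two_way_distances G" using cprod_in h by auto
  obtain x where x: "x \<in> verts G" using twE R by blast
  have c0: "cprod (0, 0) (prod.swap (0, 0)) = {(0, 0)}"
  proof -
    have "nbs x (0, 0) = {x}" using x by (auto simp: nbs_def)
    then have "subvalency G (0, 0) = 1" using card_nbs[OF x, of "(0, 0)"] by simp
    moreover have "(0, 0) \<in> two_way_distances G" using tw_in[OF x x] x by simp
    ultimately show ?thesis by (rule iffD2[OF cprod_swap_unit, rotated])
  qed
  have h0: "h \<noteq> (0, 0)" using h(2) c0 by metis
  have k: "subvalency G a = 2" using subvalency_2[OF h(1) h0] .
  then have "card (nbs x a) = 2" using card_nbs[OF x] by simp
  then obtain z z' where z: "nbs x a = {z, z'}" "z \<noteq> z'" by (meson card_2_iff)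
  then have v: "z \<in> verts G" "z' \<in> verts G" "tw x z = a" "tw x z' = a" by (auto simp: nbs_def)
  have zz: "tw z z' = h" using nbs_connected[OF h(1) h0 _ _ z(2) x] z(1) by simp
  obtain y where y: "y \<in> verts G" "tw z y = a" "tw y z' = prod.swap a"
    using cprod_realize[of z z' a "prod.swap a"] h(1) zz v by metis
  then have y': "tw z' y = a" by (metis swap_tw swap_swap)
  define c where "c = tw x y"
  have ca: "c \<in> cprod a a" using cprodI[of x y z] x y v by (simp add: c_def)
  have cR: "c \<in> two_way_distances G" using cprod_in ca by blast
  have "subvalency G c = 1"
  proof (rule ccontr)
    assume "subvalency G c \<noteq> 1"
    then have kc: "card (nbs x c) = 2"
      using subvalency_pos[OF cR] subvalency_le_2[OF cR] card_nbs[OF x, of c] by linarith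
    have "nbs x c = nbs z a" "nbs x c = nbs z' a"
    proof -
      have both: "z \<in> intersection_set G a a x y1 \<and> z' \<in> intersection_set G a a x y1" if "y1 \<in> nbs x c" for y1
      proof -
        have y1: "y1 \<in> verts G" "tw x y1 = c" using that by (auto simp: nbs_def)
        have "{z, z'} \<subseteq> intersection_set G a a x y" using v y y' by (auto simp: intersection_set_def)
        then have "2 \<le> card (intersection_set G a a x y)"
          using card_mono[of "intersection_set G a a x y" "{z, z'}"] z(2) by simp
        also have "card (intersection_set G a a x y) = card (intersection_set G a a x y1)"
          using weakly_distance_regular[OF cR R(1) R(1) x y(1) _ x y1(1)] y1 c_def by simp
        finally have "2 \<le> card (intersection_set G a a x y1)" .
        moreover have "intersection_set G a a x y1 \<subseteq> {z, z'}" using z(1) by (auto simp: intersection_set_def nbs_def)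
        ultimately have "intersection_set G a a x y1 = {z, z'}"
          using card_seteq[of "{z, z'}" "intersection_set G a a x y1"] z(2) by simp
        then show ?thesis by simp
      qed
      have "nbs x c \<subseteq> nbs z a" "nbs x c \<subseteq> nbs z' a"
        using both by (auto simp: intersection_set_def nbs_def)
      then show "nbs x c = nbs z a" "nbs x c = nbs z' a"
        using card_seteq[of "nbs z a" "nbs x c"] card_seteq[of "nbs z' a" "nbs x c"] card_nbs v k kc by auto
    qed
    then have eq: "nbs z a = nbs z' a" by simp
    have "u = z'" if "u \<in> nbs z h" for u
    proof (rule ccontr)
      assume uz: "u \<noteq> z'"
      have u: "u \<in> verts G" "tw z u = h" using that by (auto simp: nbs_def)
      have sub: "intersection_set G a (prod.swap a) z w = nbs z a \<inter> nbs w a" for w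
        by (auto simp: intersection_set_def nbs_def two_way_distance_def)
      have swR: "prod.swap a \<in> two_way_distances G" using tw_in[OF v(1) x] v by (metis swap_tw)
      have "card (nbs z a \<inter> nbs u a) = card (nbs z a \<inter> nbs z' a)"
        using weakly_distance_regular[OF R(2) R(1) swR v(1) u(1) u(2) v(1) v(2) zz] sub by simp
      also have "\<dots> = 2" using eq card_nbs v k by simp
      finally have "nbs z a \<inter> nbs u a = nbs z a"
        using card_seteq[of "nbs z a" "nbs z a \<inter> nbs u a"] card_nbs v k by simp
      then have "y \<in> nbs u a" using y by (auto simp: nbs_def)
      then have "u \<in> nbs y (prod.swap a)" "z \<in> nbs y (prod.swap a)" "z' \<in> nbs y (prod.swap a)"
        using u(1) v(1,2) y(2) y' swap_tw[of u y] swap_tw[of z y] swap_tw[of z' y] by (auto simp: nbs_def)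
      then have "card {u, z, z'} \<le> card (nbs y (prod.swap a))" by (intro card_mono) auto
      also have "\<dots> \<le> 2" using card_nbs y subvalency_le_2[OF swR] by simp
      finally have "u = z" using uz z(2) by (auto simp: card_insert_if split: if_splits)
      then show False using u h0 v by simp
    qed
    moreover have "z' \<in> nbs z h" using zz v by (simp add: nbs_def)
    ultimately have "nbs z h = {z'}" by blast
    then have "subvalency G h = 1" using card_nbs[OF v(1), of h] by simp
    then show False using cprod_swap_unit[OF R(2)] h(2) by blast
  qed
  then show ?thesis using cprod_swap_unit[OF cR] ca by blast
qed

lemma scheme: "quasi_thin_scheme (two_way_distances G) cprod (0, 0) prod.swap fst"
proof
  show "cprod a b = cprod b a" for a b by (rule cprod_commute)
  show "\<exists>y \<in> cprod a b. c \<in> cprod y d" if c: "c \<in> cprod a x" "x \<in> cprod b d" for a b c d x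
  proof -
    obtain u v w where 1: "u \<in> verts G" "v \<in> verts G" "w \<in> verts G" "tw u v = c" "tw u w = a" "tw w v = x"
      using c(1) by (rule cprodE)
    obtain z where 2: "z \<in> verts G" "tw w z = b" "tw z v = d" using cprod_realize[of w v b d] c(2) 1 by metis
    then show ?thesis using 1 2 cprodI[of u z w] cprodI[of u v z] by metis
  qed
  show "a \<in> two_way_distances G \<and> b \<in> two_way_distances G \<and> c \<in> two_way_distances G" if "c \<in> cprod a b" for a b c
    using cprod_in that by blast
  show "cprod a b \<noteq> {}" if ab: "a \<in> two_way_distances G" "b \<in> two_way_distances G" for a b
  proof -
    obtain x z where x: "x \<in> verts G" "z \<in> verts G" "tw x z = a" using twE ab by blast
    obtain y where "y \<in> verts G" "tw z y = b" using ex_nbs ab x by blast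
    then show ?thesis using cprodI[of x y z] x by auto
  qed
  have "verts G \<noteq> {}" using strongly_connected by (auto simp: strongly_connected_def)
  then show "(0, 0) \<in> two_way_distances G" using tw_in tw_eq_unit by (metis all_not_in_conv)
  show "cprod (0, 0) a = {a}" if a: "a \<in> two_way_distances G" for a
  proof
    show "cprod (0, 0) a \<subseteq> {a}" by (auto simp: cprod_def)
    obtain x z where "x \<in> verts G" "z \<in> verts G" "tw x z = a" using twE a by blast
    then show "{a} \<subseteq> cprod (0, 0) a" using cprodI[of x z x] by simp
  qed
  show "a \<in> cprod c (prod.swap b)" if "c \<in> cprod a b" for a b c using cprod_rotate that .
  show "prod.swap c \<in> cprod (prod.swap a) (prod.swap b)" if "c \<in> cprod a b" for a b c
  proof -
    obtain x y z where *: "x \<in> verts G" "y \<in> verts G" "z \<in> verts G" "tw x y = c" "tw x z = a" "tw z y = b"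
      using \<open>c \<in> cprod a b\<close> by (rule cprodE)
    then have "tw y x \<in> cprod (tw y z) (tw z x)" using cprodI by blast
    then show ?thesis using * cprod_commute by (metis swap_tw)
  qed
  show "c = c' \<or> c = c'' \<or> c' = c''" if "c \<in> cprod a b" "c' \<in> cprod a b" "c'' \<in> cprod a b" for a b c c' c''
    using cprod_card that .
  show "cprod a b = {c}" if "h \<noteq> (0, 0)" "cprod h (prod.swap h) = {(0, 0)}" "h \<in> cprod a (prod.swap a)"
    "h \<in> cprod b (prod.swap b)" "c \<in> cprod a b" "cprod c (prod.swap c) \<noteq> {(0, 0)}" for a b c h
    using cprod_single that .
  show "\<exists>t \<in> cprod a a. cprod t (prod.swap t) = {(0, 0)}"
    if "h \<in> cprod a (prod.swap a)" "cprod h (prod.swap h) \<noteq> {(0, 0)}" for a h using cprod_square_thin that .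
  show "\<exists>a d. fst a = 1 \<and> fst d = n \<and> c \<in> cprod a d" if c: "c \<in> two_way_distances G" "fst c = Suc n" for c n
  proof -
    obtain x y where x: "x \<in> verts G" "y \<in> verts G" "tw x y = c" using twE c by blast
    moreover have "distance G x y = Suc n" using c(2) x by auto
    ultimately obtain z where z: "(x, z) \<in> arcs_ends G" "z \<in> verts G" "distance G z y = n"
      using distance_Suc by metis
    then have "tw x y \<in> cprod (tw x z) (tw z y)" "distance G x z = 1" using cprodI x distance_eq_1[of x z] by auto
    then show ?thesis using x z by (intro exI[of _ "tw x z"] exI[of _ "tw z y"]) simp
  qed
  show "fst c \<le> Suc (fst d)" if c: "c \<in> cprod a d" "fst a = 1" for a c d
  proof -
    obtain x y z where "x \<in> verts G" "y \<in> verts G" "z \<in> verts G" "tw x y = c" "tw x z = a" "tw z y = d"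
      using c(1) by (rule cprodE)
    then show ?thesis using distance_triangle[of x y z] c(2) by auto
  qed
  show "c = (0, 0)" if c: "c \<in> two_way_distances G" "fst c = 0" for c
  proof -
    obtain x y where x: "x \<in> verts G" "y \<in> verts G" "tw x y = c" using twE c by blast
    then have "x = y" using c(2) distance_eq_0[of x y] by auto
    then show ?thesis using x by auto
  qed
qed (auto simp: prod_eq_iff)

sublocale S: quasi_thin_scheme "two_way_distances G" cprod "(0, 0)" prod.swap fst
  by (rule scheme)

section \<open>Walks, circuits and words\<close>

lemma arc_iff: "S.arc a \<longleftrightarrow> a \<in> two_way_distances G \<and> fst a = 1"
  by (simp add: S.arc_def)

lemma ty_eq: "S.ty a = Suc (snd a)"
  by (simp add: S.ty_def)

lemma arc_type_ge: "(1, r) \<in> two_way_distances G \<Longrightarrow> r \<ge> 1"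
  using S.arc_ty[of "(1, r)"] by (simp add: arc_iff ty_eq)

lemma tw_arc: "(x, y) \<in> arcs_ends G \<Longrightarrow> S.arc (tw x y)"
  using arcs_ends_verts[of x y] distance_eq_1[of x y] by (auto simp: arc_iff)

lemma arc_of_type_iff:
  "arc_of_type G (1, r) (x, y) \<longleftrightarrow> (x, y) \<in> arcs_ends G \<and> tw x y = (1, r)"
  using distance_eq_1[of x y] arcs_ends_verts[of x y]
  by (auto simp: arc_of_type_def two_way_distance_def)

abbreviation types :: "'a list \<Rightarrow> (nat \<times> nat) list" where
  "types p \<equiv> map (\<lambda>(x, y). tw x y) (vwalk_arcs p)"

lemma walk_types:
  assumes "vwalk p G"
  shows "tw (hd p) (last p) \<in> S.W (mset (types p)) \<and> (\<forall>a \<in> set (types p). S.arc a) \<and> last p \<in> verts G"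
  using assms
proof (induct p rule: vwalk_induct)
  case (Base u)
  then show ?case by simp
next
  case (Cons u v es)
  have "u \<in> verts G" "v \<in> verts G" using arcs_ends_verts[OF Cons(1)] by auto
  then have "tw u (last (v # es)) \<in> cprod (tw u v) (tw v (last (v # es)))" using cprodI Cons(2) by blast
  moreover have "types (u # v # es) = tw u v # types (v # es)" by simp
  moreover have "tw v (last (v # es)) \<in> S.W (mset (types (v # es)))" using Cons(2) by simp
  ultimately have "tw u (last (v # es)) \<in> S.W (mset (types (u # v # es)))"
    unfolding \<open>types (u # v # es) = _\<close> mset.simps S.W_add by blast
  then show ?case using Cons(2) tw_arc[OF Cons(1)] by simp
qed

text \<open>By commutativity of the product, the letters of a word can be realised along a walk in
  any prescribed order.\<close>

lemma realize_types:
  "\<lbrakk>tw x y \<in> S.W (mset as); \<forall>a \<in> set as. S.arc a; x \<in> verts G; y \<in> verts G\<rbrakk>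
    \<Longrightarrow> \<exists>p. vwalk p G \<and> hd p = x \<and> last p = y \<and> types p = as"
proof (induct as arbitrary: x)
  case Nil
  then show ?case by (intro exI[of _ "[x]"]) auto
next
  case (Cons a as)
  then obtain h where h: "h \<in> S.W (mset as)" "tw x y \<in> cprod a h" by (auto simp: S.W_add)
  obtain z where z: "z \<in> verts G" "tw x z = a" "tw z y = h" using cprod_realize[OF h(2)] Cons by metis
  then obtain p where p: "vwalk p G" "hd p = z" "last p = y" "types p = as"
    using Cons(1)[of z] Cons(3,5) h by auto
  have "(x, z) \<in> arcs_ends G" using distance_eq_1[of x z] z Cons by (auto simp: arc_iff)
  moreover have "p \<noteq> []" using p by auto
  ultimately show ?case using p z Cons
    by (intro exI[of _ "x # p"]) (auto intro: vwalk_consI)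
qed

text \<open>Circuits of length \<open>q\<close> through an arc of this type and words of the type
  correspond: a word is realised by a closed walk, and a circuit is read off as a word.\<close>

lemma pure_type_iff:
  assumes q: "(1, q - 1) \<in> two_way_distances G" shows "pure_type G q \<longleftrightarrow> S.pure (1, q - 1)"
proof -
  define a :: "nat \<times> nat" where "a = (1, q - 1)"
  have aq: "S.arc a" using q by (simp add: arc_iff a_def)
  have q2: "q \<ge> 2" using arc_type_ge[OF q] by simp
  then have tq: "S.ty a = q" by (simp add: ty_eq a_def)
  show ?thesis unfolding a_def[symmetric]
  proof
    assume pt: "pure_type G q"
    show "S.pure a" unfolding S.pure_def tq
    proof (intro conjI allI impI aq)
      fix M assume w: "S.word a M"
      obtain as where as: "M = mset (a # as)" by (metis S.wordD(4)[OF w] ex_mset mset.simps(2) multi_member_split)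
      obtain x where x: "x \<in> verts G" using strongly_connected by (auto simp: strongly_connected_def)
      obtain p where p: "vwalk p G" "hd p = x" "last p = x" "types p = a # as"
        using realize_types[of x x "a # as"] x S.wordD(2,3)[OF w] as by auto
      have "p \<noteq> []" using p(1) by (auto simp: vwalk_def)
      then have lp: "length p = Suc q"
        using S.wordD(5)[OF w] as tq arg_cong[OF p(4), of length] vwalk_length_simp[of p, unfolded vwalk_length_def]
        by (cases p) auto
      then have bl: "butlast p \<noteq> []" "p \<noteq> []" using q2 by (auto simp flip: length_0_conv)
      \<comment> \<open>The closed walk \<open>p\<close> lists its start twice, a circuit only
        once.\<close>
      define c where "c = butlast p"
      have pc: "p = c @ [x]" using p bl by (metis append_butlast_last_id c_def)
      have hc: "hd c = x" using p(2) pc bl by (metis c_def hd_append2)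
      have ca: "circuit_arcs c = set (vwalk_arcs p)" by (simp add: circuit_arcs_def hc pc)
      have ends: "set (vwalk_arcs p) \<subseteq> arcs_ends G" using p(1) by (auto simp: vwalk_def)
      have "c \<noteq> []" using bl by (simp add: c_def)
      then have "vwalk c G" using p(1) pc vwalkI_append_l by metis
      moreover have "(last c, x) \<in> set (vwalk_arcs p)"
        unfolding pc using vwalk_arcs_append[OF \<open>c \<noteq> []\<close>, of "[x]"] by simp
      then have "(last c, x) \<in> arcs_ends G" using ends by blast
      then have "distance G (last c) (hd c) = 1"
        using hc distance_eq_1[of "last c" x] arcs_ends_verts by simp
      ultimately have circ: "circuit G c" by (simp add: circuit_def)
      have "a \<in> set (types p)" using p(4) by simp
      then obtain e where e: "e \<in> set (vwalk_arcs p)" "a = (case e of (x, y) \<Rightarrow> tw x y)" by auto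
      then have "arc_of_type G (1, q - 1) (fst e, snd e)"
        unfolding arc_of_type_iff using ends a_def by (auto simp: split_beta)
      then have "arc_of_type G (1, q - 1) e" by simp
      then have "pure_arc G q e" using pt unfolding pure_type_def by blast
      moreover have "length c = q" using lp by (simp add: c_def)
      ultimately have all: "arc_of_type G (1, q - 1) f" if "f \<in> set (vwalk_arcs p)" for f
        using that circ e ca unfolding pure_arc_def by blast
      have types_a: "b = a" if b: "b \<in> set (types p)" for b
      proof -
        obtain f where f: "f \<in> set (vwalk_arcs p)" "b = (case f of (x, y) \<Rightarrow> tw x y)" using b by auto
        have "arc_of_type G (1, q - 1) (fst f, snd f)" using all[OF f(1)] by simp
        then show ?thesis unfolding arc_of_type_iff using f(2) by (simp add: split_beta a_def)
      qed
      have M: "set_mset M = set (types p)" unfolding p(4) as by simp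
      have "\<forall>b \<in># M. b = a" unfolding M using types_a by (rule ballI)
      then show "M = replicate_mset q a" using S.rep_eqI[of M a] S.wordD(5)[OF w] tq by metis
    qed
  next
    assume p: "S.pure a"
    show "pure_type G q" unfolding pure_type_def pure_arc_def
    proof (intro conjI allI impI ballI q)
      fix e assume "arc_of_type G (1, q - 1) e" then show "arc_of_type G (1, q - 1) e" .
    next
      fix e w f
      assume e: "arc_of_type G (1, q - 1) e" and w: "circuit G w \<and> length w = q \<and> e \<in> circuit_arcs w"
        and f: "f \<in> circuit_arcs w"
      have w': "vwalk w G" "distance G (last w) (hd w) = 1" "length w = q" "w \<noteq> []"
        using w by (auto simp: circuit_def vwalk_def)
      define c where "c = w @ [hd w]"
      have lv: "last w \<in> verts G" "hd w \<in> verts G" using w' by (auto simp: vwalk_def)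
      then have la: "(last w, hd w) \<in> arcs_ends G" using w' distance_eq_1 by simp
      have c: "vwalk c G" using w' la lv vwalk_arcs_append[of w "[hd w]"] by (auto simp: c_def vwalk_def)
      have "hd c = hd w" "last c = hd w" using w' by (auto simp: c_def)
      then have W: "(0, 0) \<in> S.W (mset (types c))" "\<forall>a \<in> set (types c). S.arc a"
        using walk_types[OF c] lv by auto
      have "length (types c) = q" using w'(3) vwalk_length_simp[of c, unfolded vwalk_length_def] by (simp add: c_def)
      then have sz: "size (mset (types c)) = q" by (simp only: size_mset)
      have ty: "tw (fst g) (snd g) \<in> set (types c)" if "g \<in> circuit_arcs w" for g
        using that by (simp add: circuit_arcs_def c_def split_beta)
      have "tw (fst e) (snd e) = a"
        using e arc_of_type_iff[of "q - 1" "fst e" "snd e"] by (simp add: a_def del: One_nat_def)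
      then have "a \<in> set (types c)" using w ty[of e] by simp
      then have "S.word a (mset (types c))" using W sz tq by (simp add: S.word_def S.circ_def del: mset_map)
      then have M: "mset (types c) = replicate_mset q a" using S.pureD[OF p] tq by metis
      have "b = a" if "b \<in> set (types c)" for b
        using that M by (metis in_replicate_mset set_mset_mset)
      then have "tw (fst f) (snd f) = a" using ty[OF f] by blast
      moreover have "f \<in> arcs_ends G" using f c by (auto simp: circuit_arcs_def c_def vwalk_def)
      ultimately show "arc_of_type G (1, q - 1) f"
        using arc_of_type_iff[of "q - 1" "fst f" "snd f"] by (simp add: a_def del: One_nat_def)
    qed
  qed
qed

end

theorem theorem2p1:
  fixes G :: "('a, 'b) pre_digraph" and q :: nat
  assumes "weakly_distance_regular_digraph G"
    and "commutative_wdrd G"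
    and "quasi_thin G"
    and "valency G > 3"
    and "q \<ge> 3"
    and "(1, q - 1) \<in> two_way_distances G"
  shows
    "(\<forall>s t. (1, s - 1) \<in> two_way_distances G \<and> (1, t - 1) \<in> two_way_distances G \<and> s < t \<and>
        intersection_number G (1, q - 1) (1, s - 1) (1, t - 1) \<noteq> 0 \<longrightarrow> s = 2 \<and> t = q) \<and>
     ((mixed_type G q \<longleftrightarrow>
        (1, q - 2) \<in> two_way_distances G \<and>
        intersection_number G (1, q - 2) (1, q - 1) (1, q - 1) \<noteq> 0 \<and> pure_type G (q - 1)) \<and>
      (mixed_type G q \<longleftrightarrow>
        (\<exists>s. (1, s - 1) \<in> two_way_distances G \<and>
          intersection_number G (1, s - 1) (1, q - 1) (1, q - 1) \<noteq> 0))) \<and>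
     (\<forall>s. (1, s - 1) \<in> two_way_distances G \<and>
        intersection_number G (1, s - 1) (1, q - 1) (1, q - 1) \<noteq> 0 \<longrightarrow> s = q - 1)"
proof -
  interpret commutative_quasi_thin_digraph G
    using assms(1-3) by (intro commutative_quasi_thin_digraph.intro commutative_quasi_thin_digraph_axioms.intro)
  have q3: "q \<ge> 3" and q: "(1, q - 1) \<in> two_way_distances G" using assms by auto
  \<comment> \<open>\<open>arc_type_ge\<close> gives \<open>s - 1 \<ge> 1\<close>, so the truncated
    subtraction loses nothing and the type is \<open>s\<close> itself.\<close>
  have arc: "S.arc (1, s - 1)" "S.ty (1, s - 1) = s" if "(1, s - 1) \<in> two_way_distances G" for s
    using that arc_type_ge[OF that] by (auto simp: arc_iff ty_eq)
  have pure: "pure_type G q \<longleftrightarrow> S.pure (1, q - 1)" using pure_type_iff[OF q] .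
  \<comment> \<open>Brings \<open>(1, q - 2)\<close> into the form \<open>(1, s - 1)\<close> with
    \<open>s = q - 1\<close>.\<close>
  have sq: "q - 2 = (q - 1) - 1" by simp
  have i: "s = 2 \<and> t = q" if "(1, s - 1) \<in> two_way_distances G" "(1, t - 1) \<in> two_way_distances G" "s < t"
    "intersection_number G (1, q - 1) (1, s - 1) (1, t - 1) \<noteq> 0" for s t
  proof -
    have "(1, q - 1) \<in> cprod (1, s - 1) (1, t - 1)" using intersection_number_neq_0 that q by blast
    then have *: "S.ty (1, s - 1) = 2 \<and> (1, t - 1) = (1 :: nat, q - 1)"
      using S.arc_prd_distinct_types[OF arc(1)[OF q] _ arc(1)[OF that(1)] arc(1)[OF that(2)]]
      unfolding arc(2)[OF q] arc(2)[OF that(1)] arc(2)[OF that(2)] using q3 that(3) by blast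
    then have "S.ty (1, t - 1) = S.ty (1, q - 1)" by simp
    with * show ?thesis unfolding arc(2)[OF that(1)] arc(2)[OF that(2)] arc(2)[OF q] by blast
  qed
  have iii: "s = q - 1" if "(1, s - 1) \<in> two_way_distances G"
    "intersection_number G (1, s - 1) (1, q - 1) (1, q - 1) \<noteq> 0" for s
  proof -
    have "(1, s - 1) \<in> cprod (1, q - 1) (1, q - 1)" using intersection_number_neq_0 that q by blast
    then show ?thesis
      using S.square_arc_type[of "(1, q - 1)" "(1, s - 1)"] arc[OF that(1)] arc[OF q] q3 by simp
  qed
  have ex: "mixed_type G q \<longleftrightarrow> (\<exists>b. S.arc b \<and> Suc (S.ty b) = q \<and> b \<in> cprod (1, q - 1) (1, q - 1) \<and> S.pure b)"
    using S.not_pure_iff[of "(1, q - 1)"] arc[OF q] q3 q pure by (simp add: mixed_type_def)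
  have b: "mixed_type G q \<longleftrightarrow> (1, q - 2) \<in> two_way_distances G \<and>
        intersection_number G (1, q - 2) (1, q - 1) (1, q - 1) \<noteq> 0 \<and> pure_type G (q - 1)"
  proof
    assume "mixed_type G q"
    then obtain b where b: "S.arc b" "Suc (S.ty b) = q" "b \<in> cprod (1, q - 1) (1, q - 1)" "S.pure b" using ex by blast
    then have "b = (1, q - 2)" by (cases b) (auto simp: arc_iff ty_eq)
    then show "(1, q - 2) \<in> two_way_distances G \<and>
        intersection_number G (1, q - 2) (1, q - 1) (1, q - 1) \<noteq> 0 \<and> pure_type G (q - 1)"
      using b intersection_number_neq_0[of "(1, q - 2)" "(1, q - 1)" "(1, q - 1)"] q pure_type_iff[of "q - 1"] sq
      by (simp add: arc_iff)
  next
    assume *: "(1, q - 2) \<in> two_way_distances G \<and>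
        intersection_number G (1, q - 2) (1, q - 1) (1, q - 1) \<noteq> 0 \<and> pure_type G (q - 1)"
    then have "S.arc (1, q - 2)" "Suc (S.ty (1, q - 2)) = q" "(1, q - 2) \<in> cprod (1, q - 1) (1, q - 1)" "S.pure (1, q - 2)"
      using q intersection_number_neq_0[of "(1, q - 2)" "(1, q - 1)" "(1, q - 1)"] pure_type_iff[of "q - 1"] sq q3
      by (auto simp: arc_iff ty_eq)
    then show "mixed_type G q" using ex by blast
  qed
  moreover have "mixed_type G q \<longleftrightarrow> (\<exists>s. (1, s - 1) \<in> two_way_distances G \<and>
          intersection_number G (1, s - 1) (1, q - 1) (1, q - 1) \<noteq> 0)"
  proof
    assume "mixed_type G q"
    then show "\<exists>s. (1, s - 1) \<in> two_way_distances G \<and>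
          intersection_number G (1, s - 1) (1, q - 1) (1, q - 1) \<noteq> 0" using b sq by metis
  next
    assume "\<exists>s. (1, s - 1) \<in> two_way_distances G \<and>
          intersection_number G (1, s - 1) (1, q - 1) (1, q - 1) \<noteq> 0"
    then obtain s where s: "(1, s - 1) \<in> two_way_distances G"
      "intersection_number G (1, s - 1) (1, q - 1) (1, q - 1) \<noteq> 0" by blast
    then have "(1, s - 1) \<in> cprod (1, q - 1) (1, q - 1)" using intersection_number_neq_0 q by blast
    then show "mixed_type G q"
      using S.square_arc_not_pure[of "(1, q - 1)" "(1, s - 1)"] arc[OF s(1)] arc[OF q] q3 q pure
      by (simp add: mixed_type_def)
  qed
  ultimately show ?thesis using i iii by blast
qed

end
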